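(* Assume conditions $A_1(1)$–$A_1(3)$ and $A_2(1)$–$A_2(2)$ stated in the context. Let $\sigma^2\sim \mathrm{IG}(a_0,b_0)$ and, conditionally on $\sigma^2$, $\pi(\beta\mid\sigma^2)=\prod_{j=1}^{p_n}[g_\lambda(\beta_j/\sigma)/\sigma]$. Suppose that for some constant $u>0$ and some sequence $a_n\asymp \sqrt{s\log p_n/n}/p_n$ the density $g_\lambda$ satisfies $$1-\int_{-a_n}^{a_n}g_\lambda(x)\,dx\le p_n^{-(1+u)},\qquad -\log\Big(\inf_{x\in[-E_n,E_n]}g_\lambda(x)\Big)=O(\log p_n).$$ Let $\epsilon_n=M\sqrt{s\log p_n/n}$, where the constant $M>0$ is sufficiently large. Then there are positive constants $c_1,c_2,c_3$ such that, for all sufficiently large $n$, $$P^*\Big(\pi\big(\|\beta-\beta^*\|\ge c_1\sigma^*\epsilon_n\mid D_n\big)\ge e^{-c_2n\epsilon_n^2}\Big)\le e^{-c_3n\epsilon_n^2}$$ and $$P^*\Big(\pi\big(\|\beta-\beta^*\|_1\ge c_1\sqrt{s}\,\epsilon_n\sigma^*\mid D_n\big)\ge e^{-c_2n\epsilon_n^2}\Big)\le e^{-c_3n\epsilon_n^2}.$$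
   Context: Model: for each $n$, $y=X\beta^*+\sigma^*\varepsilon$ with $\varepsilon\sim N(0,I_n)$, $X$ an $n\times p_n$ design matrix, true coefficient vector $\beta^*\in\mathbb{R}^{p_n}$, and true standard deviation $\sigma^*>0$ which is unknown to the statistician, fixed, and does not change with $n$. $D_n=(X,y)$; $P^*$ is the probability under the true parameters $(\beta^*,\sigma^* )$. $\xi^*=\{j:\beta_j^*\ne0\}$, $s=|\xi^*|=\|\beta^*\|_0$. $\|\cdot\|$ is the $L_2$ norm, $\|\cdot\|_1$ the $L_1$ norm. For $\xi\subset\{1,\dots,p_n\}$, $|\xi|$ is its cardinality and $X_\xi$ the submatrix of $X$ with columns indexed by $\xi$; $\lambda_{\min}(\cdot)$ is the smallest eigenvalue of a square matrix. Asymptotic notation (as $n\to\infty$, positive sequences): $a\prec b$ means $\lim a/b=0$; $a\asymp b$ means $0<\liminf a/b\le\limsup a/b<\infty$; $a\preccurlyeq b$ means $a\prec b$ or $a\asymp b$. Prior and posterior: $\mathrm{IG}(a_0,b_0)$ is the inverse-gamma distribution with fixed hyperparameters $a_0,b_0>0$; $g_\lambda$ is a probability density on $\mathbb{R}$ with tuning parameter(s) $\lambda$ which may depend on $n$. The posterior is $\pi(\beta,\sigma^2\mid D_n)\propto \sigma^{-n}\exp\{-\|y-X\beta\|^2/(2\sigma^2)\}\,\pi(\beta\mid\sigma^2)\pi(\sigma^2)$. Conditions. $A_1(1)$: the columns $x_j$ of $X$ satisfy $x_j\in[-1,1]^n$ for all $j$. $A_1(2)$: $p_n\succcurlyeq n$.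 $A_1(3)$: there exist an integer $\bar p$ (depending on $n$ and $p_n$) and a fixed constant $\lambda_0>0$ such that $\bar p\succ s$ and $\lambda_{\min}(X_\xi^TX_\xi)\ge n\lambda_0$ for every $\xi$ with $|\xi|\le\bar p$. $A_2(1)$: $s\log p_n\prec n$. $A_2(2)$: $\max_j|\beta_j^*/\sigma^*|\le\gamma_3E_n$ for some fixed $\gamma_3\in(0,1)$, where $E_n$ is a positive sequence nondecreasing in $n$. *)

theory Defs
  imports
    "HOL-Probability.Probability"
    "HOL-Library.Landau_Symbols"
    "Jordan_Normal_Form.Char_Poly"
    "Jordan_Normal_Form.DL_Submatrix"
begin

text \<open>
  The asymptotic relations are relations between (eventually) positive sequences. Positivity is part
  of the definitions because \<^term>\<open>x / 0 = (0::real)\<close> would otherwise make the limits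
  hold for degenerate sequences.
\<close>

definition ev_positive :: "(nat \<Rightarrow> real) \<Rightarrow> bool" where
  "ev_positive a \<longleftrightarrow> (\<forall>\<^sub>F n in sequentially. 0 < a n)"

definition prec :: "(nat \<Rightarrow> real) \<Rightarrow> (nat \<Rightarrow> real) \<Rightarrow> bool" where
  "prec a b \<longleftrightarrow> ev_positive a \<and> ev_positive b \<and> (\<lambda>n. a n / b n) \<longlonglongrightarrow> 0"

definition asymp_order :: "(nat \<Rightarrow> real) \<Rightarrow> (nat \<Rightarrow> real) \<Rightarrow> bool" where
  "asymp_order a b \<longleftrightarrow> ev_positive a \<and> ev_positive b \<and>
     0 < liminf (\<lambda>n. ereal (a n / b n)) \<and> limsup (\<lambda>n. ereal (a n / b n)) < \<infinity>"

definition preceq :: "(nat \<Rightarrow> real) \<Rightarrow> (nat \<Rightarrow> real) \<Rightarrow> bool" where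
  "preceq a b \<longleftrightarrow> prec a b \<or> asymp_order a b"

text \<open>
  Only meaningful for matrices with a nonempty set of eigenvalues, e.g. real symmetric matrices
  of positive dimension.
\<close>

definition lambda_min :: "real mat \<Rightarrow> real" where
  "lambda_min A = Min {k. eigenvalue A k}"

definition cols_submatrix :: "real mat \<Rightarrow> nat set \<Rightarrow> real mat" where
  "cols_submatrix X \<xi> = submatrix X UNIV \<xi>"

definition gram :: "real mat \<Rightarrow> real mat" where
  "gram A = transpose_mat A * A"

text \<open>
  A vector of length \<open>k\<close> is a function on \<open>nat\<close> of which only the values at indices below \<open>k\<close>
  matter, so that \<open>k\<close> may depend on \<open>n\<close> and product measures \<open>PiM {..<k}\<close> apply. Coordinates are
  numbered from 0.
\<close>

definition lin_pred :: "real mat \<Rightarrow> (nat \<Rightarrow> real) \<Rightarrow> nat \<Rightarrow> real" where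
  "lin_pred X \<beta> i = (X *\<^sub>v vec (dim_col X) \<beta>) $ i"

definition supp :: "nat \<Rightarrow> (nat \<Rightarrow> real) \<Rightarrow> nat set" where
  "supp k \<beta> = {j. j < k \<and> \<beta> j \<noteq> 0}"

definition l2_norm :: "nat \<Rightarrow> (nat \<Rightarrow> real) \<Rightarrow> real" where
  "l2_norm k v = L2_set v {..<k}"

definition l1_norm :: "nat \<Rightarrow> (nat \<Rightarrow> real) \<Rightarrow> real" where
  "l1_norm k v = (\<Sum>j<k. \<bar>v j\<bar>)"

definition std_gaussian :: "nat \<Rightarrow> (nat \<Rightarrow> real) measure" where
  "std_gaussian n = (\<Pi>\<^sub>M i\<in>{..<n}. density lborel std_normal_density)"

text \<open>The law of \<open>y = X \<beta> + \<sigma> \<epsilon>\<close> with \<open>\<epsilon> \<sim> N(0, I)\<close>, for a fixed design \<open>X\<close>.\<close>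

definition response_law :: "real mat \<Rightarrow> (nat \<Rightarrow> real) \<Rightarrow> real \<Rightarrow> (nat \<Rightarrow> real) measure" where
  "response_law X \<beta> \<sigma> =
     distr (std_gaussian (dim_row X)) (\<Pi>\<^sub>M i\<in>{..<dim_row X}. borel)
       (\<lambda>\<epsilon>. \<lambda>i\<in>{..<dim_row X}. lin_pred X \<beta> i + \<sigma> * \<epsilon> i)"

definition prob_density :: "(real \<Rightarrow> real) \<Rightarrow> bool" where
  "prob_density g \<longleftrightarrow> g \<in> borel_measurable borel \<and> (\<forall>x. 0 \<le> g x) \<and>
     (\<integral>\<^sup>+ x. ennreal (g x) \<partial>lborel) = 1"

definition inverse_gamma_density :: "real \<Rightarrow> real \<Rightarrow> real \<Rightarrow> real" where
  "inverse_gamma_density a b v =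
     (if 0 < v then b powr a / Gamma a * v powr (- a - 1) * exp (- b / v) else 0)"

text \<open>Below, \<open>v\<close> stands for the variance \<open>\<sigma>\<^sup>2\<close>, i.e. \<open>\<sigma> = sqrt v\<close>.\<close>

definition coef_prior :: "nat \<Rightarrow> (real \<Rightarrow> real) \<Rightarrow> (nat \<Rightarrow> real) \<Rightarrow> real \<Rightarrow> real" where
  "coef_prior k g \<beta> v = (\<Prod>j<k. g (\<beta> j / sqrt v) / sqrt v)"

text \<open>The Gaussian likelihood up to a constant factor.\<close>

definition likelihood :: "real mat \<Rightarrow> (nat \<Rightarrow> real) \<Rightarrow> (nat \<Rightarrow> real) \<Rightarrow> real \<Rightarrow> real" where
  "likelihood X y \<beta> v =
     inverse (sqrt v) ^ dim_row X *
     exp (- ((l2_norm (dim_row X) (\<lambda>i. y i - lin_pred X \<beta> i))\<^sup>2) / (2 * v))"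

definition unnorm_posterior ::
  "(real \<Rightarrow> real) \<Rightarrow> real \<Rightarrow> real \<Rightarrow> real mat \<Rightarrow> (nat \<Rightarrow> real) \<Rightarrow> (nat \<Rightarrow> real) \<times> real \<Rightarrow> real" where
  "unnorm_posterior g a0 b0 X y = (\<lambda>(\<beta>, v).
     likelihood X y \<beta> v * coef_prior (dim_col X) g \<beta> v * inverse_gamma_density a0 b0 v)"

definition param_base :: "nat \<Rightarrow> ((nat \<Rightarrow> real) \<times> real) measure" where
  "param_base k = (\<Pi>\<^sub>M j\<in>{..<k}. lborel) \<Otimes>\<^sub>M lborel"

text \<open>The joint posterior of \<open>(\<beta>, \<sigma>\<^sup>2)\<close> given \<open>(X, y)\<close>.\<close>

definition posterior ::
  "(real \<Rightarrow> real) \<Rightarrow> real \<Rightarrow> real \<Rightarrow> real mat \<Rightarrow> (nat \<Rightarrow> real) \<Rightarrow> ((nat \<Rightarrow> real) \<times> real) measure" where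
  "posterior g a0 b0 X y =
     density (param_base (dim_col X))
       (\<lambda>\<theta>. ennreal (unnorm_posterior g a0 b0 X y \<theta>) /
            (\<integral>\<^sup>+ \<theta>'. ennreal (unnorm_posterior g a0 b0 X y \<theta>') \<partial>param_base (dim_col X)))"

definition posterior_prob ::
  "(real \<Rightarrow> real) \<Rightarrow> real \<Rightarrow> real \<Rightarrow> real mat \<Rightarrow> (nat \<Rightarrow> real) \<Rightarrow> ((nat \<Rightarrow> real) \<Rightarrow> bool) \<Rightarrow> real" where
  "posterior_prob g a0 b0 X y Q =
     measure (posterior g a0 b0 X y) {\<theta> \<in> space (posterior g a0 b0 X y). Q (fst \<theta>)}"

end

theory Submission
  imports Defs
begin

text \<open>
  Write \<open>L = s log p\<close>, \<open>d = (\<beta> - \<beta>*) / \<sigma>*\<close> and \<open>\<rho> = \<sigma> / \<sigma>*\<close>, and bound the ratio of the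
  likelihood at \<open>(\<beta>, \<sigma>\<^sup>2)\<close> to the likelihood at the truth. On a noise event of probability
  \<open>1 - exp (- L / 8)\<close> three things happen. (1) The ratio is at least \<open>exp (- C L)\<close> on a neighbourhood of the
  truth of prior mass at least \<open>exp (- C L)\<close>, which bounds the normalising constant from below.
  (2) The ratio has expectation 1 for each parameter, so Markov's inequality makes the
  posterior weight of vectors with more than \<open>K s\<close> coordinates above \<open>a \<sigma>\<close> as small as their prior mass
  \<open>p powr (- u K s)\<close>, up to constants in the exponent. (3) For all other vectors, \<open>X d\<close> is \<open>X w\<close> for a
  \<open>(K + 1) s\<close>-sparse \<open>w\<close> plus a remainder of size \<open>\<rho> sqrt L\<close>. The projections of the noise on all
  \<open>(K + 1) s\<close>-dimensional column spaces have squared norm \<open>O(L)\<close> and \<open>\<parallel>\<epsilon>\<parallel>\<^sup>2 = n + O(sqrt (n L))\<close>, so the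
  log ratio is at most \<open>O(L) - \<parallel>X w\<parallel>\<^sup>2 / 16\<close> if \<open>\<rho> \<le> 2\<close> and at most \<open>- n / 8\<close> if \<open>\<rho> \<ge> 2\<close>. The restricted
  eigenvalue condition turns the distance of \<open>\<beta>\<close> to \<open>\<beta>*\<close> into a lower bound on \<open>\<parallel>X w\<parallel>\<^sup>2\<close>.
\<close>

section \<open>Smallest eigenvalues and Rayleigh quotients\<close>

text \<open>Two obstacles shape the argument. Noise can be controlled uniformly only over column
  spaces of dimension O(s): a union bound over supports of size k costs \<open>p ^ k\<close>, which
  is exp(O(L)) only for k = O(s), and the eigenvalue condition likewise stops at
  \<open>pbar\<close>. A continuous prior gives no exact zeros, so sparsity is counted above a
  threshold, a multiple of \<sigma> because the prior is on \<beta> / \<sigma>. And \<sigma> is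
  unknown: the likelihood bounds must hold for all \<rho> > 0, although the coordinates below the
  threshold cause errors growing like \<rho> and like its square. The constants must avoid a circle.
  The lower bound exp(- C1 L) for the normalising constant fixes K, since a prior mass of order
  exp(- u K L) has to beat it; K fixes the noise level \<open>c2\<close>, and then \<open>c\<close>,
  \<open>H\<close> and the radius \<open>R\<close>. So C1 must not depend on K: that lower bound
  uses only the correlations of the noise with single columns, at a level fixed in advance. Its
  neighbourhood has radius 1 / n in each coordinate of the true support, a cost of only exp(- O(L))
  because n is at most p squared for large n.\<close>

definition ip :: "nat \<Rightarrow> (nat \<Rightarrow> real) \<Rightarrow> (nat \<Rightarrow> real) \<Rightarrow> real" where
  "ip n u v = (\<Sum>i<n. u i * v i)"

text \<open>A minimiser of the quadratic form on the unit sphere is an eigenvector, by the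
  first-order condition along each coordinate direction; homogeneity carries minimality from the
  sphere to all \<open>w\<close>.\<close>

lemma rayleigh_min_eigenvector:
  fixes M :: "nat \<Rightarrow> nat \<Rightarrow> real"
  assumes k: "0 < k" and sym: "\<And>i j. i < k \<Longrightarrow> j < k \<Longrightarrow> M i j = M j i"
  obtains m v where "\<exists>i<k. v i \<noteq> 0" "\<forall>i<k. (\<Sum>j<k. M i j * v j) = m * v i"
    "\<And>w. m * ip k w w \<le> ip k w (\<lambda>i. \<Sum>j<k. M i j * w j)"
proof -
  define q where "q w = ip k w (\<lambda>i. \<Sum>j<k. M i j * w j)" for w
  \<comment> \<open>Vectors are functions on all of \<open>nat\<close>, so the coordinates from
    \<open>k\<close> on are pinned to 0: a product of compact sets is compact in the product
    topology, and the sphere is closed in it.\<close>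
  define B where "B = (\<Pi>\<^sub>E i\<in>UNIV. if i < k then {-1..1::real} else {0})"
  define S where "S = B \<inter> {w. ip k w w = 1}"
  have "compact B"
    unfolding B_def compactin_euclidean_iff[symmetric] euclidean_product_topology[symmetric]
    by (subst compactin_PiE) (auto simp: compactin_euclidean_iff)
  moreover have cont_ip: "continuous_on UNIV (\<lambda>w. ip k w w)"
    unfolding ip_def by (intro continuous_intros continuous_on_product_coordinates)
  hence "closed {w. ip k w w = 1}"
    by (auto intro!: closed_Collect_eq continuous_on_const)
  ultimately have "compact S" unfolding S_def by (rule compact_Int_closed)
  moreover have "(\<lambda>i. if i = 0 then 1 else 0) \<in> S"
    using k by (auto simp: S_def B_def ip_def if_distrib[of "\<lambda>x. x * _"] sum.delta cong: if_cong)
  hence "S \<noteq> {}" by blast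
  moreover have "continuous_on S q"
    unfolding q_def ip_def
    by (intro continuous_intros continuous_on_subset[OF continuous_on_product_coordinates]) auto
  ultimately obtain v where v: "v \<in> S" and vmin: "\<And>w. w \<in> S \<Longrightarrow> q v \<le> q w"
    using continuous_attains_inf[of S q] by blast
  have vv: "ip k v v = 1" using v by (simp add: S_def)
  have q_scale: "q (\<lambda>i. c * w i) = c^2 * q w" for c w
    by (simp add: q_def ip_def sum_distrib_left power2_eq_square algebra_simps)
  have ip_scale: "ip k (\<lambda>i. c * w i) (\<lambda>i. c * w i) = c^2 * ip k w w" for c w
    by (simp add: ip_def sum_distrib_left power2_eq_square algebra_simps)
  have ge: "q v * ip k w w \<le> q w" for w
  proof (cases "ip k w w = 0")
    case True
    hence "\<And>i. i < k \<Longrightarrow> w i = 0"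
      unfolding ip_def by (subst (asm) sum_nonneg_eq_0_iff) auto
    hence "q w = 0" by (simp add: q_def ip_def)
    with True show ?thesis by simp
  next
    case False
    have pos: "ip k w w > 0"
      using False by (simp add: ip_def sum_nonneg less_le)
    define c where "c = 1 / sqrt (ip k w w)"
    define w' where "w' i = (if i < k then c * w i else 0)" for i
    have eq: "ip k w' w' = 1" "q w' = c^2 * q w"
    proof -
      have "ip k w' w' = ip k (\<lambda>i. c * w i) (\<lambda>i. c * w i)" by (simp add: ip_def w'_def)
      also have "\<dots> = 1" unfolding ip_scale using pos by (simp add: c_def power_divide)
      finally show "ip k w' w' = 1" .
      have "q w' = q (\<lambda>i. c * w i)" by (simp add: q_def ip_def w'_def)
      thus "q w' = c^2 * q w" by (simp add: q_scale)
    qed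
    have "\<bar>w' i\<bar> \<le> 1" if "i < k" for i
    proof -
      have "w' i * w' i \<le> ip k w' w'"
        unfolding ip_def using that by (intro member_le_sum) auto
      thus ?thesis using eq abs_square_le_1[of "w' i"] by (simp only: power2_eq_square)
    qed
    hence "w' \<in> S" using eq by (auto simp: S_def B_def w'_def abs_le_iff)
    from vmin[OF this] have "q v \<le> q w / ip k w w"
      using pos by (simp add: eq c_def power_divide)
    thus ?thesis using pos by (simp add: field_simps)
  qed
  have "(\<Sum>j<k. M i j * v j) = q v * v i" if i: "i < k" for i
  proof (rule ccontr)
    define d where "d = (\<Sum>j<k. M i j * v j) - q v * v i"
    assume "\<not> ?thesis"
    hence d: "d \<noteq> 0" by (simp add: d_def)
    define e where "e = M i i - q v"
    \<comment> \<open>This is \<open>ge\<close> at the minimiser perturbed by \<open>t\<close> in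
      coordinate \<open>i\<close>. The constant terms cancel, leaving a polynomial in
      \<open>t\<close> with linear coefficient \<open>2 * d\<close>.\<close>
    have ineq: "0 \<le> 2 * t * d + t^2 * e" for t
    proof -
      define w where "w j = v j + t * (if j = i then 1 else 0)" for j
      have wv: "ip k w w = 1 + 2 * t * v i + t^2"
      proof -
        have "ip k w w = (\<Sum>j<k. v j * v j + (if j = i then 2 * t * v i + t^2 else 0))"
          unfolding ip_def w_def by (intro sum.cong) (auto simp: algebra_simps power2_eq_square)
        thus ?thesis using vv i by (simp add: sum.distrib ip_def)
      qed
      have Mw: "(\<Sum>j<k. M l j * w j) = (\<Sum>j<k. M l j * v j) + t * M l i" for l
      proof -
        have "(\<Sum>j<k. M l j * w j) = (\<Sum>j<k. M l j * v j + (if j = i then t * M l i else 0))"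
          unfolding w_def by (intro sum.cong) (auto simp: algebra_simps)
        thus ?thesis using i by (simp add: sum.distrib)
      qed
      have "q w = (\<Sum>l<k. v l * (\<Sum>j<k. M l j * v j) + t * (v l * M l i) +
              (if l = i then t * (\<Sum>j<k. M i j * v j) + t^2 * M i i else 0))"
        unfolding q_def ip_def Mw
        by (intro sum.cong refl) (auto simp: w_def algebra_simps power2_eq_square)
      also have "\<dots> = q v + t * (\<Sum>l<k. M i l * v l) + (t * (\<Sum>j<k. M i j * v j) + t^2 * M i i)"
      proof -
        have "(\<Sum>l<k. v l * M l i) = (\<Sum>l<k. M i l * v l)"
          using sym i by (intro sum.cong) (auto simp: mult.commute)
        thus ?thesis using i by (simp add: sum.distrib q_def ip_def sum_distrib_left[symmetric])
      qed
      finally have qw: "q w = q v + 2 * t * (\<Sum>l<k. M i l * v l) + t^2 * M i i" by simp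
      show ?thesis using ge[of w] unfolding qw wv d_def e_def by (simp add: algebra_simps)
    qed
    \<comment> \<open>The sign of \<open>e\<close> is unknown; dividing by
      \<open>\<bar>e\<bar> + 1\<close> makes the quadratic term at most \<open>- t * d\<close>, so
      the whole expression is at most \<open>t * d\<close>, which is negative.\<close>
    define t where "t = - d / (\<bar>e\<bar> + 1)"
    have "t^2 * e \<le> t^2 * (\<bar>e\<bar> + 1)" by (intro mult_left_mono) auto
    also have "t * (\<bar>e\<bar> + 1) = - d" by (simp add: t_def)
    hence "t^2 * (\<bar>e\<bar> + 1) = - t * d" by (simp add: power2_eq_square mult.assoc)
    finally have "0 \<le> t * d" using ineq[of t] by simp
    moreover have "t * d = - (d\<^sup>2 / (\<bar>e\<bar> + 1))"
      by (simp add: t_def power2_eq_square)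
    moreover have "0 < d\<^sup>2 / (\<bar>e\<bar> + 1)" using d by (simp add: add_nonneg_pos)
    ultimately show False by simp
  qed
  moreover have "\<exists>i<k. v i \<noteq> 0"
    using vv unfolding ip_def by (intro ccontr[of "\<exists>i<k. v i \<noteq> 0"]) simp
  ultimately show ?thesis using that[of v "q v"] ge unfolding q_def by blast
qed

text \<open>The minimum of the quadratic form is itself an eigenvalue, so \<open>lambda_min\<close>
  is at most it. \<open>Min\<close> is meaningful here because the eigenvalues are roots of the
  nonzero characteristic polynomial, hence finitely many.\<close>

lemma lambda_min_rayleigh:
  fixes A :: "real mat"
  assumes A: "A \<in> carrier_mat k k" and k: "0 < k"
    and sym: "\<And>i j. i < k \<Longrightarrow> j < k \<Longrightarrow> A $$ (i, j) = A $$ (j, i)"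
  shows "lambda_min A * ip k w w \<le> ip k w (\<lambda>i. \<Sum>j<k. A $$ (i, j) * w j)"
proof -
  obtain m v where v: "\<exists>i<k. v i \<noteq> 0" "\<forall>i<k. (\<Sum>j<k. A $$ (i, j) * v j) = m * v i"
    and ge: "\<And>w. m * ip k w w \<le> ip k w (\<lambda>i. \<Sum>j<k. A $$ (i, j) * w j)"
    by (rule rayleigh_min_eigenvector[OF k, of "\<lambda>i j. A $$ (i, j)"]) (use sym in auto)
  have "A *\<^sub>v vec k v = m \<cdot>\<^sub>v vec k v"
  proof (rule eq_vecI)
    fix i assume "i < dim_vec (m \<cdot>\<^sub>v vec k v)"
    hence i: "i < k" by simp
    thus "(A *\<^sub>v vec k v) $ i = (m \<cdot>\<^sub>v vec k v) $ i"
      using A v(2) by (simp add: scalar_prod_def atLeast0LessThan)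
  qed (use A in auto)
  moreover have "vec k v \<noteq> 0\<^sub>v k" using v(1) by (metis index_vec index_zero_vec(1))
  ultimately have "eigenvalue A m"
    using A unfolding eigenvalue_def eigenvector_def by (intro exI[of _ "vec k v"]) auto
  moreover have "finite {x. eigenvalue A x}"
  proof -
    have "{x. eigenvalue A x} = {x. poly (char_poly A) x = 0}"
      using eigenvalue_root_char_poly[OF A] by auto
    moreover have "char_poly A \<noteq> 0" using degree_monic_char_poly[OF A] by auto
    ultimately show ?thesis by (simp add: poly_roots_finite)
  qed
  ultimately have "lambda_min A \<le> m" unfolding lambda_min_def by (intro Min_le) auto
  hence "lambda_min A * ip k w w \<le> m * ip k w w"
    by (intro mult_right_mono) (auto simp: ip_def sum_nonneg)
  thus ?thesis using ge[of w] by simp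
qed

text \<open>The quadratic form of a Gram matrix is the squared norm of the fitted vector.
  \<open>submatrix\<close> renumbers the columns in \<open>\<xi>\<close> by \<open>pick\<close>;
  reindexing along that bijection returns to sums over \<open>\<xi>\<close> itself, the form used
  from here on.\<close>

lemma restricted_eigenvalue:
  assumes X: "X \<in> carrier_mat n p" and \<xi>: "\<xi> \<subseteq> {..<p}" "\<xi> \<noteq> {}"
  shows "lambda_min (gram (cols_submatrix X \<xi>)) * (\<Sum>j\<in>\<xi>. (d j)\<^sup>2)
     \<le> (\<Sum>i<n. (\<Sum>j\<in>\<xi>. X $$ (i, j) * d j)\<^sup>2)"
proof -
  define k where "k = card \<xi>"
  have fin: "finite \<xi>" using \<xi> finite_subset by blast
  have k: "0 < k" using \<xi> fin by (simp add: k_def card_gt_0_iff)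
  have bij: "bij_betw (pick \<xi>) {..<k} \<xi>"
  proof (rule bij_betw_imageI)
    show inj: "inj_on (pick \<xi>) {..<k}"
      by (auto simp: k_def intro!: strict_mono_on_imp_inj_on strict_mono_onI pick_mono)
    have "pick \<xi> ` {..<k} \<subseteq> \<xi>" by (auto simp: k_def pick_in_set)
    moreover have "card (pick \<xi> ` {..<k}) = card \<xi>" using inj by (simp add: card_image k_def)
    ultimately show "pick \<xi> ` {..<k} = \<xi>" using fin by (simp add: card_subset_eq)
  qed
  let ?C = "cols_submatrix X \<xi>" and ?x = "\<lambda>i a. X $$ (i, pick \<xi> a)"
  have sets: "{i. i < dim_row X \<and> i \<in> UNIV} = {..<n}" "{j. j < dim_col X \<and> j \<in> \<xi>} = \<xi>"
    using X \<xi> by auto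
  have C: "?C \<in> carrier_mat n k"
    unfolding cols_submatrix_def carrier_mat_def using X by (simp add: dim_submatrix sets(2)[unfolded carrier_matD(2)[OF X]] k_def)
  have Ci: "?C $$ (i, a) = ?x i a" if "i < n" "a < k" for i a
    using that unfolding cols_submatrix_def submatrix_def sets by (simp add: k_def pick_UNIV)
  have G: "gram ?C \<in> carrier_mat k k" using C by (auto simp: gram_def)
  have Gab: "gram ?C $$ (a, b) = (\<Sum>i<n. ?x i a * ?x i b)" if "a < k" "b < k" for a b
    using that C Ci by (simp add: gram_def scalar_prod_def atLeast0LessThan)
  define w where "w a = d (pick \<xi> a)" for a
  have "lambda_min (gram ?C) * ip k w w \<le> ip k w (\<lambda>a. \<Sum>b<k. gram ?C $$ (a, b) * w b)"
    by (rule lambda_min_rayleigh[OF G k]) (simp add: Gab mult.commute)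
  also have "\<dots> = (\<Sum>a<k. \<Sum>b<k. \<Sum>i<n. w a * ?x i a * (?x i b * w b))"
    unfolding ip_def by (intro sum.cong refl) (simp add: Gab sum_distrib_left sum_distrib_right algebra_simps)
  also have "\<dots> = (\<Sum>a<k. \<Sum>i<n. \<Sum>b<k. w a * ?x i a * (?x i b * w b))"
    by (intro sum.cong refl sum.swap)
  also have "\<dots> = (\<Sum>i<n. \<Sum>a<k. \<Sum>b<k. w a * ?x i a * (?x i b * w b))"
    by (rule sum.swap)
  also have "\<dots> = (\<Sum>i<n. (\<Sum>a<k. ?x i a * w a)\<^sup>2)"
    by (intro sum.cong refl) (simp add: power2_eq_square sum_product algebra_simps)
  also have "(\<lambda>i. \<Sum>a<k. ?x i a * w a) = (\<lambda>i. \<Sum>j\<in>\<xi>. X $$ (i, j) * d j)"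
    unfolding w_def by (intro ext sum.reindex_bij_betw[OF bij])
  also have "ip k w w = (\<Sum>j\<in>\<xi>. (d j)\<^sup>2)"
    unfolding ip_def w_def using sum.reindex_bij_betw[OF bij, of "\<lambda>j. (d j)\<^sup>2"]
    by (simp add: power2_eq_square)
  finally show ?thesis .
qed

section \<open>Exponential moments and concentration of Gaussian noise\<close>

lemma sets_std_gaussian [measurable_cong]: "sets (std_gaussian n) = sets (PiM {..<n} (\<lambda>_. borel))"
  unfolding std_gaussian_def by (intro sets_PiM_cong) auto

lemma product_prob_space_gaussian:
  "product_prob_space (\<lambda>_ :: nat. density lborel (\<lambda>x. ennreal (std_normal_density x)))"
proof -
  have "prob_space (density lborel (\<lambda>x. ennreal (std_normal_density x)))"
    by (rule prob_space_normal_density) simp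
  thus ?thesis
    by (simp add: product_prob_space_def product_sigma_finite_def product_prob_space_axioms_def
        prob_space_imp_sigma_finite)
qed

lemma prob_space_std_gaussian: "prob_space (std_gaussian n)"
  unfolding std_gaussian_def
  by (intro prob_space_PiM prob_space_normal_density) simp

lemma measurable_ip [measurable]:
  assumes "\<And>i. i < n \<Longrightarrow> (\<lambda>x. f x i) \<in> borel_measurable M"
    "\<And>i. i < n \<Longrightarrow> (\<lambda>x. g x i) \<in> borel_measurable M"
  shows "(\<lambda>x. ip n (f x) (g x)) \<in> borel_measurable M"
  unfolding ip_def using assms by (intro borel_measurable_sum borel_measurable_times) auto

lemma measurable_gaussian_coord:
  "i < n \<Longrightarrow> (\<lambda>e. e i) \<in> borel_measurable (std_gaussian n)"
  by measurable

lemma nn_integral_std_gaussian_prod: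
  assumes [measurable]: "\<And>i. i < n \<Longrightarrow> f i \<in> borel_measurable borel"
  shows "(\<integral>\<^sup>+e. (\<Prod>i<n. f i (e i)) \<partial>std_gaussian n) =
    (\<Prod>i<n. \<integral>\<^sup>+x. ennreal (std_normal_density x) * f i x \<partial>lborel)"
proof -
  interpret product_prob_space "\<lambda>_ :: nat. density lborel (\<lambda>x. ennreal (std_normal_density x))"
    by (rule product_prob_space_gaussian)
  have "(\<integral>\<^sup>+e. (\<Prod>i<n. f i (e i)) \<partial>std_gaussian n) =
    (\<Prod>i<n. \<integral>\<^sup>+x. f i x \<partial>density lborel (\<lambda>x. ennreal (std_normal_density x)))"
    unfolding std_gaussian_def by (rule product_nn_integral_prod) auto
  also have "\<dots> = (\<Prod>i<n. \<integral>\<^sup>+x. ennreal (std_normal_density x) * f i x \<partial>lborel)"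
    by (intro prod.cong refl nn_integral_density) auto
  finally show ?thesis .
qed

lemma nn_integral_normal_density:
  assumes "0 < s"
  shows "(\<integral>\<^sup>+x. ennreal (normal_density m s x) \<partial>lborel) = 1"
  using prob_space.emeasure_space_1[OF prob_space_normal_density[OF assms, of m]]
  by (simp add: emeasure_density)

lemma gaussian_mgf:
  "(\<integral>\<^sup>+x. ennreal (std_normal_density x) * ennreal (exp (c * x)) \<partial>lborel) = ennreal (exp (c\<^sup>2 / 2))"
proof -
  have eq: "std_normal_density x * exp (c * x) = exp (c\<^sup>2 / 2) * normal_density c 1 x" for x
    by (simp add: normal_density_def exp_add[symmetric] power2_eq_square field_simps)
  have "(\<integral>\<^sup>+x. ennreal (std_normal_density x) * ennreal (exp (c * x)) \<partial>lborel) =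
      (\<integral>\<^sup>+x. ennreal (exp (c\<^sup>2 / 2)) * ennreal (normal_density c 1 x) \<partial>lborel)"
    by (simp add: eq ennreal_mult[symmetric])
  thus ?thesis by (simp add: nn_integral_cmult nn_integral_normal_density)
qed

lemma gaussian_square_mgf:
  assumes t: "t < 1 / 2"
  shows "(\<integral>\<^sup>+x. ennreal (std_normal_density x) * ennreal (exp (t * x\<^sup>2)) \<partial>lborel) =
    ennreal (1 / sqrt (1 - 2 * t))"
proof -
  define r where "r = 1 / sqrt (1 - 2 * t)"
  have r: "0 < r" using t by (simp add: r_def)
  have r2: "1 / r\<^sup>2 = 1 - 2 * t" using t by (simp add: r_def power_divide)
  have eq: "std_normal_density x * exp (t * x\<^sup>2) = r * normal_density 0 r x" for x
  proof -
    have "- x\<^sup>2 / (2 * r\<^sup>2) = - x\<^sup>2 / 2 * (1 / r\<^sup>2)" by simp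
    also have "\<dots> = - x\<^sup>2 / 2 + t * x\<^sup>2" unfolding r2 by (simp add: field_simps)
    finally have e: "- x\<^sup>2 / (2 * r\<^sup>2) = - x\<^sup>2 / 2 + t * x\<^sup>2" .
    have "sqrt (2 * pi * r\<^sup>2) = sqrt (2 * pi) * r" using r by (simp add: real_sqrt_mult)
    thus ?thesis using r e unfolding normal_density_def by (simp add: exp_add[symmetric])
  qed
  have "(\<integral>\<^sup>+x. ennreal (std_normal_density x) * ennreal (exp (t * x\<^sup>2)) \<partial>lborel) =
      (\<integral>\<^sup>+x. ennreal r * ennreal (normal_density 0 r x) \<partial>lborel)"
    using r by (simp add: eq ennreal_mult[symmetric])
  also have "\<dots> = ennreal r" using r by (simp add: nn_integral_cmult nn_integral_normal_density)
  finally show ?thesis by (simp add: r_def)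
qed

lemma std_gaussian_mgf:
  "(\<integral>\<^sup>+e. ennreal (exp (ip n c e)) \<partial>std_gaussian n) = ennreal (exp (ip n c c / 2))"
proof -
  have "(\<integral>\<^sup>+e. ennreal (exp (ip n c e)) \<partial>std_gaussian n) =
      (\<integral>\<^sup>+e. (\<Prod>i<n. ennreal (exp (c i * e i))) \<partial>std_gaussian n)"
    by (simp add: ip_def exp_sum prod_ennreal)
  also have "\<dots> = (\<Prod>i<n. \<integral>\<^sup>+x. ennreal (std_normal_density x) * ennreal (exp (c i * x)) \<partial>lborel)"
    by (rule nn_integral_std_gaussian_prod) auto
  also have "\<dots> = ennreal (exp (\<Sum>i<n. (c i)\<^sup>2 / 2))"
    by (simp add: gaussian_mgf prod_ennreal exp_sum)
  finally show ?thesis by (simp add: ip_def sum_divide_distrib power2_eq_square)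
qed

lemma std_gaussian_square_mgf:
  assumes "t < 1 / 2"
  shows "(\<integral>\<^sup>+e. ennreal (exp (t * ip n e e)) \<partial>std_gaussian n) = ennreal ((1 / sqrt (1 - 2 * t)) ^ n)"
proof -
  have "(\<integral>\<^sup>+e. ennreal (exp (t * ip n e e)) \<partial>std_gaussian n) =
      (\<integral>\<^sup>+e. (\<Prod>i<n. ennreal (exp (t * (e i)\<^sup>2))) \<partial>std_gaussian n)"
    by (simp add: ip_def sum_distrib_left exp_sum prod_ennreal power2_eq_square)
  also have "\<dots> = (\<Prod>i<n. \<integral>\<^sup>+x. ennreal (std_normal_density x) * ennreal (exp (t * x\<^sup>2)) \<partial>lborel)"
    by (rule nn_integral_std_gaussian_prod) auto
  also have "\<dots> = ennreal ((1 / sqrt (1 - 2 * t)) ^ n)"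
    using assms by (simp add: gaussian_square_mgf prod_ennreal ennreal_power)
  finally show ?thesis .
qed

text \<open>Writing \<open>exp (w\<^sup>2 / 4)\<close> as a Gaussian mixture of exponentials of linear forms
  replaces the rotation invariance of the Gaussian law by Tonelli's theorem.\<close>

lemma std_gaussian_projection_mgf:
  assumes orth: "\<And>a b. a < k \<Longrightarrow> b < k \<Longrightarrow> ip n (Q a) (Q b) = (if a = b then 1 else 0)"
  shows "(\<integral>\<^sup>+e. ennreal (exp ((\<Sum>a<k. (ip n e (Q a))\<^sup>2) / 4)) \<partial>std_gaussian n) = ennreal (sqrt 2 ^ k)"
proof -
  interpret K: prob_space "std_gaussian k" by (rule prob_space_std_gaussian)
  interpret N: prob_space "std_gaussian n" by (rule prob_space_std_gaussian)
  interpret KN: pair_sigma_finite "std_gaussian k" "std_gaussian n" ..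
  define h where "h t e = exp (ip k (\<lambda>a. ip n e (Q a) / sqrt 2) t)" for t e
  \<comment> \<open>For fixed \<open>e\<close> this is the Gaussian moment generating function in
    \<open>t\<close> at the vector \<open>ip n e (Q a) / sqrt 2\<close>; its half squared norm is
    the exponent with factor 1/4.\<close>
  have mix: "ennreal (exp ((\<Sum>a<k. (ip n e (Q a))\<^sup>2) / 4)) = (\<integral>\<^sup>+t. ennreal (h t e) \<partial>std_gaussian k)" for e
    unfolding h_def std_gaussian_mgf
    by (simp add: ip_def[of k] sum_divide_distrib power2_eq_square)
  have swap: "h t e = exp (ip n (\<lambda>i. \<Sum>a<k. t a * Q a i / sqrt 2) e)" for t e
    unfolding h_def ip_def
    by (simp add: sum_distrib_left sum_distrib_right sum_divide_distrib algebra_simps)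
       (rule sum.swap)
  \<comment> \<open>After the exchange of integrals the linear form in \<open>e\<close> has
    coefficient vector the combination of the \<open>Q a\<close> with weights
    \<open>t a / sqrt 2\<close>, so orthonormality leaves a chi-square moment in \<open>t\<close> at
    1/4, equal to \<open>sqrt 2\<close> per dimension.\<close>
  have quad: "ip n (\<lambda>i. \<Sum>a<k. t a * Q a i / sqrt 2) (\<lambda>i. \<Sum>a<k. t a * Q a i / sqrt 2) = ip k t t / 2" for t
  proof -
    have "ip n (\<lambda>i. \<Sum>a<k. t a * Q a i / sqrt 2) (\<lambda>i. \<Sum>a<k. t a * Q a i / sqrt 2) =
        (\<Sum>i<n. \<Sum>a<k. \<Sum>b<k. t a * t b / 2 * (Q a i * Q b i))"
      unfolding ip_def by (simp add: sum_product algebra_simps)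
    also have "\<dots> = (\<Sum>a<k. \<Sum>i<n. \<Sum>b<k. t a * t b / 2 * (Q a i * Q b i))" by (rule sum.swap)
    also have "\<dots> = (\<Sum>a<k. \<Sum>b<k. \<Sum>i<n. t a * t b / 2 * (Q a i * Q b i))"
      by (intro sum.cong refl sum.swap)
    also have "\<dots> = (\<Sum>a<k. \<Sum>b<k. t a * t b / 2 * ip n (Q a) (Q b))"
      unfolding ip_def sum_distrib_left ..
    also have "\<dots> = (\<Sum>a<k. \<Sum>b<k. if a = b then t a * t b / 2 else 0)"
      by (intro sum.cong refl) (simp add: orth)
    also have "\<dots> = (\<Sum>a<k. t a * t a / 2)" by (intro sum.cong refl) simp
    finally show ?thesis by (simp add: ip_def sum_divide_distrib)
  qed
  have [measurable]: "(\<lambda>(t, e). ennreal (h t e)) \<in> borel_measurable (std_gaussian k \<Otimes>\<^sub>M std_gaussian n)"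
  proof -
    have "(\<lambda>z. fst z a) \<in> borel_measurable (std_gaussian k \<Otimes>\<^sub>M std_gaussian n)" if "a < k" for a
      using measurable_compose[OF measurable_fst measurable_gaussian_coord[OF that]] .
    moreover have "(\<lambda>z. snd z i) \<in> borel_measurable (std_gaussian k \<Otimes>\<^sub>M std_gaussian n)" if "i < n" for i
      using measurable_compose[OF measurable_snd measurable_gaussian_coord[OF that]] .
    ultimately show ?thesis
      unfolding h_def case_prod_unfold by measurable
  qed
  have "(\<integral>\<^sup>+e. ennreal (exp ((\<Sum>a<k. (ip n e (Q a))\<^sup>2) / 4)) \<partial>std_gaussian n) =
      (\<integral>\<^sup>+e. \<integral>\<^sup>+t. ennreal (h t e) \<partial>std_gaussian k \<partial>std_gaussian n)"
    unfolding mix ..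
  also have "\<dots> = (\<integral>\<^sup>+t. \<integral>\<^sup>+e. ennreal (h t e) \<partial>std_gaussian n \<partial>std_gaussian k)"
    by (rule KN.Fubini') measurable
  also have "\<dots> = (\<integral>\<^sup>+t. ennreal (exp (1 / 4 * ip k t t)) \<partial>std_gaussian k)"
    unfolding swap std_gaussian_mgf quad by simp
  also have "\<dots> = ennreal (sqrt 2 ^ k)"
    by (subst std_gaussian_square_mgf) (simp_all add: real_sqrt_divide)
  finally show ?thesis .
qed

text \<open>Gram-Schmidt, one column at a time. A column already in the span leaves the basis
  unchanged, so \<open>k\<close> may be smaller than \<open>card J\<close> and linearly dependent
  columns are covered.\<close>

lemma orthonormal_basis_exists:
  assumes "finite J"
  shows "\<exists>k Q. k \<le> card J \<and>
    (\<forall>a<k. \<forall>b<k. ip n (Q a) (Q b) = (if a = b then 1 else 0)) \<and>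
    (\<forall>j\<in>J. \<exists>c. \<forall>i<n. x j i = (\<Sum>a<k. c a * Q a i))"
  using assms
proof (induction J rule: finite_induct)
  case empty
  show ?case by (rule exI[of _ 0]) simp
next
  case (insert j J)
  then obtain k Q where k: "k \<le> card J"
    and orth: "\<And>a b. a < k \<Longrightarrow> b < k \<Longrightarrow> ip n (Q a) (Q b) = (if a = b then 1 else 0)"
    and span: "\<And>j. j \<in> J \<Longrightarrow> \<exists>c. \<forall>i<n. x j i = (\<Sum>a<k. c a * Q a i)"
    by blast
  define c where "c a = ip n (x j) (Q a)" for a
  define r where "r i = x j i - (\<Sum>a<k. c a * Q a i)" for i
  have rQ: "ip n r (Q b) = 0" if b: "b < k" for b
  proof -
    have "ip n r (Q b) = c b - (\<Sum>i<n. \<Sum>a<k. c a * (Q a i * Q b i))"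
      by (simp add: r_def ip_def c_def left_diff_distrib sum_subtractf sum_distrib_right mult.assoc)
    also have "(\<Sum>i<n. \<Sum>a<k. c a * (Q a i * Q b i)) = (\<Sum>a<k. \<Sum>i<n. c a * (Q a i * Q b i))"
      by (rule sum.swap)
    also have "\<dots> = (\<Sum>a<k. c a * ip n (Q a) (Q b))" by (simp add: ip_def sum_distrib_left)
    also have "\<dots> = (\<Sum>a<k. if a = b then c a else 0)"
      using b by (intro sum.cong refl) (simp add: orth)
    finally show ?thesis using b by simp
  qed
  show ?case
  proof (cases "ip n r r = 0")
    case True
    hence "\<And>i. i < n \<Longrightarrow> r i = 0"
      unfolding ip_def by (subst (asm) sum_nonneg_eq_0_iff) auto
    hence "\<forall>i<n. x j i = (\<Sum>a<k. c a * Q a i)" by (simp add: r_def)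
    thus ?thesis using k orth span insert.hyps
      by (intro exI[of _ k] exI[of _ Q]) auto
  next
    case False
    define R where "R = sqrt (ip n r r)"
    have R: "R > 0" "R * R = ip n r r"
      using False by (auto simp: R_def ip_def sum_nonneg less_le)
    define Q' where "Q' a = (if a = k then (\<lambda>i. r i / R) else Q a)" for a
    have div: "ip n (\<lambda>i. r i / R) v = ip n r v / R" for v
      by (simp add: ip_def sum_divide_distrib)
    have kk: "ip n (\<lambda>i. r i / R) (\<lambda>i. r i / R) = 1"
      using R False by (simp add: ip_def sum_divide_distrib[symmetric])
    have div': "ip n v (\<lambda>i. r i / R) = ip n r v / R" for v
      by (simp add: ip_def sum_divide_distrib mult.commute)
    have "\<forall>a<Suc k. \<forall>b<Suc k. ip n (Q' a) (Q' b) = (if a = b then 1 else 0)"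
    proof (intro allI impI)
      fix a b assume ab: "a < Suc k" "b < Suc k"
      consider "a = k" "b = k" | "a = k" "b < k" | "a < k" "b = k" | "a < k" "b < k"
        using ab by linarith
      thus "ip n (Q' a) (Q' b) = (if a = b then 1 else 0)"
        by cases (auto simp: Q'_def kk div div' rQ orth)
    qed
    moreover have "\<exists>c. \<forall>i<n. x l i = (\<Sum>a<Suc k. c a * Q' a i)" if "l \<in> insert j J" for l
    proof (cases "l = j")
      case True
      show ?thesis using R True
        by (intro exI[of _ "\<lambda>a. if a = k then R else c a"]) (simp add: Q'_def r_def)
    next
      case False
      with that span obtain d where "\<forall>i<n. x l i = (\<Sum>a<k. d a * Q a i)" by blast
      thus ?thesis
        by (intro exI[of _ "\<lambda>a. if a = k then 0 else d a"]) (simp add: Q'_def)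
    qed
    moreover have "Suc k \<le> card (insert j J)" using k insert.hyps by simp
    ultimately show ?thesis by blast
  qed
qed

text \<open>\<open>F e\<close> is the squared norm of the projection of \<open>e\<close> on the span
  of the columns, and the inequality is Cauchy-Schwarz in an orthonormal basis. The existential
  hides the basis and its dimension; the moment bound is relaxed to depend only on
  \<open>card J\<close>.\<close>

lemma projection_statistic:
  assumes J: "finite J"
  shows "\<exists>F. F \<in> borel_measurable (std_gaussian n) \<and>
    (\<forall>e d. (ip n e (\<lambda>i. \<Sum>j\<in>J. x j i * d j))\<^sup>2 \<le>
       F e * ip n (\<lambda>i. \<Sum>j\<in>J. x j i * d j) (\<lambda>i. \<Sum>j\<in>J. x j i * d j)) \<and>
    (\<integral>\<^sup>+e. ennreal (exp (F e / 4)) \<partial>std_gaussian n) \<le> ennreal (2 ^ card J)"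
proof -
  obtain k Q where k: "k \<le> card J"
    and orth: "\<And>a b. a < k \<Longrightarrow> b < k \<Longrightarrow> ip n (Q a) (Q b) = (if a = b then 1 else 0)"
    and span: "\<forall>j\<in>J. \<exists>c. \<forall>i<n. x j i = (\<Sum>a<k. c a * Q a i)"
    using orthonormal_basis_exists[OF J, of n x] by blast
  obtain c where c: "\<And>j i. j \<in> J \<Longrightarrow> i < n \<Longrightarrow> x j i = (\<Sum>a<k. c j a * Q a i)"
    using bchoice[OF span] by blast
  define F where "F e = (\<Sum>a<k. (ip n e (Q a))\<^sup>2)" for e
  have "F \<in> borel_measurable (std_gaussian n)"
    unfolding F_def by measurable
  moreover have "(ip n e w)\<^sup>2 \<le> F e * ip n w w" if w: "w = (\<lambda>i. \<Sum>j\<in>J. x j i * d j)" for e d w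
  proof -
    define b where "b a = (\<Sum>j\<in>J. c j a * d j)" for a
    have wi: "w i = (\<Sum>a<k. b a * Q a i)" if "i < n" for i
    proof -
      have "w i = (\<Sum>j\<in>J. \<Sum>a<k. c j a * Q a i * d j)"
        unfolding w using that by (intro sum.cong refl) (simp add: c sum_distrib_right)
      also have "\<dots> = (\<Sum>a<k. \<Sum>j\<in>J. c j a * Q a i * d j)" by (rule sum.swap)
      finally show ?thesis by (simp add: b_def sum_distrib_left sum_distrib_right mult_ac)
    qed
    have ipw: "ip n v w = (\<Sum>a<k. b a * ip n v (Q a))" for v
    proof -
      have "ip n v w = (\<Sum>i<n. \<Sum>a<k. b a * (v i * Q a i))"
        unfolding ip_def by (intro sum.cong refl) (simp add: wi sum_distrib_left algebra_simps)
      also have "\<dots> = (\<Sum>a<k. \<Sum>i<n. b a * (v i * Q a i))" by (rule sum.swap)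
      finally show ?thesis by (simp add: ip_def sum_distrib_left)
    qed
    have "ip n w (Q a) = b a" if a: "a < k" for a
    proof -
      have "ip n w (Q a) = ip n (Q a) w" by (simp add: ip_def mult.commute)
      also have "\<dots> = (\<Sum>b'<k. if b' = a then b b' else 0)"
        unfolding ipw using a by (intro sum.cong refl) (auto simp: orth)
      finally show ?thesis using a by simp
    qed
    hence ww: "ip n w w = (\<Sum>a<k. (b a)\<^sup>2)"
      unfolding ipw by (intro sum.cong refl) (simp add: power2_eq_square)
    show ?thesis unfolding ww unfolding ipw[of e] F_def using Cauchy_Schwarz_ineq_sum[of b "\<lambda>a. ip n e (Q a)" "{..<k}"]
      by (simp add: mult.commute)
  qed
  moreover have "(\<integral>\<^sup>+e. ennreal (exp (F e / 4)) \<partial>std_gaussian n) \<le> ennreal (2 ^ card J)"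
  proof -
    have "(\<integral>\<^sup>+e. ennreal (exp (F e / 4)) \<partial>std_gaussian n) = ennreal (sqrt 2 ^ k)"
      unfolding F_def by (rule std_gaussian_projection_mgf) (rule orth)
    moreover have "sqrt 2 ^ k \<le> 2 ^ k"
      by (intro power_mono real_le_lsqrt) auto
    moreover have "(2::real) ^ k \<le> 2 ^ card J" using k by (intro power_increasing) auto
    ultimately show ?thesis by (auto intro!: ennreal_leI intro: order_trans)
  qed
  ultimately show ?thesis by blast
qed

section \<open>Markov and union bounds: the noise events\<close>

lemma (in finite_measure) exponential_markov:
  assumes [measurable]: "f \<in> borel_measurable M"
    and B: "(\<integral>\<^sup>+x. ennreal (exp (f x)) \<partial>M) \<le> ennreal B" "0 \<le> B"
  shows "measure M {x \<in> space M. c \<le> f x} \<le> B * exp (- c)"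
proof -
  have "{x \<in> space M. c \<le> f x} = {x \<in> space M. 1 \<le> ennreal (exp (- c)) * ennreal (exp (f x))}"
    by (auto simp: ennreal_mult[symmetric] exp_add[symmetric])
  also have "emeasure M \<dots> \<le> ennreal (exp (- c)) * (\<integral>\<^sup>+x. ennreal (exp (f x)) * indicator (space M) x \<partial>M)"
    by (rule nn_integral_Markov_inequality) auto
  also have "(\<integral>\<^sup>+x. ennreal (exp (f x)) * indicator (space M) x \<partial>M) = (\<integral>\<^sup>+x. ennreal (exp (f x)) \<partial>M)"
    by (intro nn_integral_cong) simp
  also have "ennreal (exp (- c)) * \<dots> \<le> ennreal (exp (- c)) * ennreal B"
    by (rule mult_left_mono[OF B(1)]) simp
  finally show ?thesis using B
    by (simp add: ennreal_mult[symmetric] emeasure_eq_measure mult.commute)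
qed

text \<open>Every nonempty set of at most \<open>k\<close> indices is the set of entries of a list
  of length exactly \<open>k\<close>, obtained by repeating one of its elements. Nonemptiness
  supplies the element to repeat.\<close>

lemma card_small_subsets:
  assumes "0 < p"
  shows "card {\<xi>. \<xi> \<subseteq> {..<p} \<and> \<xi> \<noteq> {} \<and> card \<xi> \<le> k} \<le> p ^ k"
proof -
  have "{\<xi>. \<xi> \<subseteq> {..<p} \<and> \<xi> \<noteq> {} \<and> card \<xi> \<le> k} \<subseteq> set ` {xs. set xs \<subseteq> {..<p} \<and> length xs = k}"
  proof (rule subsetI)
    fix \<xi> assume "\<xi> \<in> {\<xi>. \<xi> \<subseteq> {..<p} \<and> \<xi> \<noteq> {} \<and> card \<xi> \<le> k}"
    then obtain y where \<xi>: "\<xi> \<subseteq> {..<p}" "card \<xi> \<le> k" "y \<in> \<xi>" by auto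
    obtain xs where xs: "set xs = \<xi>" "length xs = card \<xi>"
      using finite_distinct_list[of \<xi>] \<xi>(1) by (metis distinct_card finite_lessThan finite_subset)
    have "set (replicate (k - card \<xi>) y @ xs) = \<xi>"
      using xs \<xi> by (auto simp: set_replicate_conv_if)
    moreover have "length (replicate (k - card \<xi>) y @ xs) = k" using xs \<xi> by simp
    ultimately show "\<xi> \<in> set ` {xs. set xs \<subseteq> {..<p} \<and> length xs = k}"
      using \<xi>(1) by (intro image_eqI[of _ _ "replicate (k - card \<xi>) y @ xs"]) auto
  qed
  hence "card {\<xi>. \<xi> \<subseteq> {..<p} \<and> \<xi> \<noteq> {} \<and> card \<xi> \<le> k} \<le>
      card {xs. set xs \<subseteq> {..<p} \<and> length xs = k}"
    by (intro surj_card_le finite_lists_length_eq) auto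
  thus ?thesis by (simp add: card_lists_length_eq)
qed

text \<open>The projections of \<open>e\<close> on all small column spaces have squared norm at most
  \<open>T\<close>, expressed without projections. The quantifier over \<open>d\<close> comes after
  \<open>e\<close>, so the bound applies to every parameter simultaneously.\<close>

definition projection_bounded :: "nat \<Rightarrow> nat \<Rightarrow> (nat \<Rightarrow> nat \<Rightarrow> real) \<Rightarrow> nat \<Rightarrow> real \<Rightarrow> (nat \<Rightarrow> real) \<Rightarrow> bool" where
  "projection_bounded n p x k T e \<longleftrightarrow> (\<forall>\<xi>\<subseteq>{..<p}. \<xi> \<noteq> {} \<longrightarrow> card \<xi> \<le> k \<longrightarrow> (\<forall>d.
      (ip n e (\<lambda>i. \<Sum>j\<in>\<xi>. x j i * d j))\<^sup>2 \<le>
         T * ip n (\<lambda>i. \<Sum>j\<in>\<xi>. x j i * d j) (\<lambda>i. \<Sum>j\<in>\<xi>. x j i * d j)))"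

lemma projection_boundedD:
  "projection_bounded n p x k T e \<Longrightarrow> \<xi> \<subseteq> {..<p} \<Longrightarrow> \<xi> \<noteq> {} \<Longrightarrow> card \<xi> \<le> k \<Longrightarrow>
    (ip n e (\<lambda>i. \<Sum>j\<in>\<xi>. x j i * d j))\<^sup>2 \<le>
      T * ip n (\<lambda>i. \<Sum>j\<in>\<xi>. x j i * d j) (\<lambda>i. \<Sum>j\<in>\<xi>. x j i * d j)"
  unfolding projection_bounded_def by blast

text \<open>A union bound over supports. The conclusion gives a measurable \<open>G\<close> on which
  the property holds, rather than the probability of the property itself, because the latter
  quantifies over uncountably many \<open>d\<close>.\<close>

lemma uniform_projection_event:
  fixes x :: "nat \<Rightarrow> nat \<Rightarrow> real"
  assumes p: "0 < p"
  shows "\<exists>G\<in>sets (std_gaussian n).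
    measure (std_gaussian n) (space (std_gaussian n) - G) \<le> (2 * real p) ^ k * exp (- T / 4) \<and>
    (\<forall>e\<in>G. projection_bounded n p x k T e)"
proof -
  interpret prob_space "std_gaussian n" by (rule prob_space_std_gaussian)
  define Fam where "Fam = {\<xi>. \<xi> \<subseteq> {..<p} \<and> \<xi> \<noteq> {} \<and> card \<xi> \<le> k}"
  have fin: "finite \<xi>" if "\<xi> \<in> Fam" for \<xi> using that finite_subset by (auto simp: Fam_def)
  have finF: "finite Fam" unfolding Fam_def by (rule finite_subset[of _ "Pow {..<p}"]) auto
  have "\<forall>\<xi>\<in>Fam. \<exists>F. F \<in> borel_measurable (std_gaussian n) \<and>
    (\<forall>e d. (ip n e (\<lambda>i. \<Sum>j\<in>\<xi>. x j i * d j))\<^sup>2 \<le>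
       F e * ip n (\<lambda>i. \<Sum>j\<in>\<xi>. x j i * d j) (\<lambda>i. \<Sum>j\<in>\<xi>. x j i * d j)) \<and>
    (\<integral>\<^sup>+e. ennreal (exp (F e / 4)) \<partial>std_gaussian n) \<le> ennreal (2 ^ card \<xi>)"
    using projection_statistic fin by blast
  from bchoice[OF this] obtain F where
    F [measurable]: "\<And>\<xi>. \<xi> \<in> Fam \<Longrightarrow> F \<xi> \<in> borel_measurable (std_gaussian n)"
    and Fb: "\<And>\<xi> e d. \<xi> \<in> Fam \<Longrightarrow> (ip n e (\<lambda>i. \<Sum>j\<in>\<xi>. x j i * d j))\<^sup>2 \<le>
       F \<xi> e * ip n (\<lambda>i. \<Sum>j\<in>\<xi>. x j i * d j) (\<lambda>i. \<Sum>j\<in>\<xi>. x j i * d j)"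
    and Fi: "\<And>\<xi>. \<xi> \<in> Fam \<Longrightarrow> (\<integral>\<^sup>+e. ennreal (exp (F \<xi> e / 4)) \<partial>std_gaussian n) \<le> ennreal (2 ^ card \<xi>)"
    by blast
  define Bad where "Bad \<xi> = {e \<in> space (std_gaussian n). T / 4 \<le> F \<xi> e / 4}" for \<xi>
  have Bad_sets: "Bad \<xi> \<in> sets (std_gaussian n)" if "\<xi> \<in> Fam" for \<xi>
    unfolding Bad_def using F[OF that] by measurable
  define G where "G = space (std_gaussian n) - (\<Union>\<xi>\<in>Fam. Bad \<xi>)"
  have "G \<in> sets (std_gaussian n)"
    unfolding G_def using Bad_sets finF by (intro sets.compl_sets sets.finite_UN) auto
  moreover have "measure (std_gaussian n) (space (std_gaussian n) - G) \<le> (2 * real p) ^ k * exp (- T / 4)"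
  proof -
    have "space (std_gaussian n) - G = (\<Union>\<xi>\<in>Fam. Bad \<xi>)"
      by (auto simp: G_def Bad_def)
    also have "measure (std_gaussian n) \<dots> \<le> (\<Sum>\<xi>\<in>Fam. measure (std_gaussian n) (Bad \<xi>))"
      using Bad_sets finF by (intro finite_measure_subadditive_finite) auto
    also have "\<dots> \<le> (\<Sum>\<xi>\<in>Fam. 2 ^ k * exp (- T / 4))"
    proof (rule sum_mono)
      fix \<xi> assume \<xi>: "\<xi> \<in> Fam"
      have "measure (std_gaussian n) (Bad \<xi>) \<le> 2 ^ card \<xi> * exp (- (T / 4))"
        unfolding Bad_def using F[OF \<xi>] Fi[OF \<xi>] by (intro exponential_markov) auto
      also have "\<dots> \<le> 2 ^ k * exp (- T / 4)"
        using \<xi> by (intro mult_mono power_increasing) (auto simp: Fam_def)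
      finally show "measure (std_gaussian n) (Bad \<xi>) \<le> 2 ^ k * exp (- T / 4)" .
    qed
    also have "\<dots> = real (card Fam) * (2 ^ k * exp (- T / 4))" by simp
    also have "\<dots> \<le> real (p ^ k) * (2 ^ k * exp (- T / 4))"
      using card_small_subsets[OF p, of k] by (intro mult_right_mono of_nat_mono) (auto simp: Fam_def)
    finally show ?thesis by (simp add: power_mult_distrib mult_ac)
  qed
  moreover have "(ip n e (\<lambda>i. \<Sum>j\<in>\<xi>. x j i * d j))\<^sup>2 \<le>
         T * ip n (\<lambda>i. \<Sum>j\<in>\<xi>. x j i * d j) (\<lambda>i. \<Sum>j\<in>\<xi>. x j i * d j)"
    if "e \<in> G" "\<xi> \<subseteq> {..<p}" "\<xi> \<noteq> {}" "card \<xi> \<le> k" for e \<xi> d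
  proof -
    have \<xi>: "\<xi> \<in> Fam" using that by (simp add: Fam_def)
    hence "F \<xi> e < T" using that(1) by (auto simp: G_def Bad_def)
    hence "F \<xi> e * ip n (\<lambda>i. \<Sum>j\<in>\<xi>. x j i * d j) (\<lambda>i. \<Sum>j\<in>\<xi>. x j i * d j) \<le>
        T * ip n (\<lambda>i. \<Sum>j\<in>\<xi>. x j i * d j) (\<lambda>i. \<Sum>j\<in>\<xi>. x j i * d j)"
      by (intro mult_right_mono) (auto simp: ip_def sum_nonneg)
    thus ?thesis using Fb[OF \<xi>] order_trans by blast
  qed
  hence "\<forall>e\<in>G. projection_bounded n p x k T e"
    unfolding projection_bounded_def by blast
  ultimately show ?thesis by blast
qed

text \<open>Chernoff bound; the sign \<tau> treats both tails at once. With
  \<open>t = \<tau> * q / 4\<close> the log moment is at most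
  \<open>4 * t\<^sup>2 * n = L / 4\<close>, while the threshold becomes \<open>L / 2\<close>. The
  hypothesis \<open>L \<le> real n\<close> keeps \<open>t\<close> within 1/4 of 0.\<close>

lemma chi_square_one_sided:
  assumes L: "0 < L" "L \<le> real n" and \<tau>: "\<tau> = 1 \<or> \<tau> = - 1"
  shows "measure (std_gaussian n) {e \<in> space (std_gaussian n).
      2 * sqrt (real n * L) \<le> \<tau> * (ip n e e - real n)} \<le> exp (- L / 4)"
proof -
  interpret prob_space "std_gaussian n" by (rule prob_space_std_gaussian)
  define q where "q = sqrt (L / real n)"
  have n: "0 < real n" using L by linarith
  have q: "0 < q" "q \<le> 1" "q\<^sup>2 = L / real n" using L n by (auto simp: q_def)
  define t where "t = \<tau> * q / 4"
  have t2: "t\<^sup>2 = L / real n / 16" using \<tau> q by (auto simp: t_def power_divide power_mult_distrib)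
  have tb: "\<bar>t\<bar> \<le> 1 / 4" using \<tau> q by (auto simp: t_def)
  hence t1: "0 < 1 - 2 * t" by linarith
  have "sqrt (real n * L) = q * real n"
    using n L by (simp add: q_def real_sqrt_mult real_sqrt_divide field_simps)
  hence qn: "q * sqrt (real n * L) = L" using n q by (simp add: power2_eq_square field_simps)
  \<comment> \<open>The bound \<open>\<bar>ln (1 + x) - x\<bar> \<le> 2 * x\<^sup>2\<close> at
    \<open>x = - 2 * t\<close>, halved: the linear terms cancel and only second order in
    \<open>t\<close> survives.\<close>
  have one: "exp (- t) * (1 / sqrt (1 - 2 * t)) \<le> exp (4 * t\<^sup>2)"
  proof -
    have "- t - ln (1 - 2 * t) / 2 \<le> 4 * t\<^sup>2"
      using abs_ln_one_plus_x_minus_x_bound[of "- 2 * t"] tb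
      by (simp add: power_mult_distrib abs_le_iff) linarith
    hence "exp (- t - ln (1 - 2 * t) / 2) \<le> exp (4 * t\<^sup>2)" by simp
    moreover have "exp (ln (1 - 2 * t) / 2) = sqrt (1 - 2 * t)"
      using t1 by (simp add: ln_sqrt[symmetric])
    ultimately show ?thesis by (simp add: exp_diff)
  qed
  have "(\<integral>\<^sup>+e. ennreal (exp (t * (ip n e e - real n))) \<partial>std_gaussian n) =
      (\<integral>\<^sup>+e. ennreal (exp (- t * real n)) * ennreal (exp (t * ip n e e)) \<partial>std_gaussian n)"
    by (simp add: ennreal_mult[symmetric] exp_add[symmetric] algebra_simps)
  also have "\<dots> = ennreal (exp (- t * real n)) * ennreal ((1 / sqrt (1 - 2 * t)) ^ n)"
    using t1 by (subst nn_integral_cmult) (auto simp: std_gaussian_square_mgf)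
  also have "\<dots> = ennreal ((exp (- t) * (1 / sqrt (1 - 2 * t))) ^ n)"
  proof -
    have "exp (- t * real n) = exp (- t) ^ n"
      by (simp add: exp_of_nat_mult[symmetric] mult.commute)
    thus ?thesis using t1 by (simp add: ennreal_mult[symmetric] power_divide)
  qed
  also have "\<dots> \<le> ennreal (exp (4 * t\<^sup>2) ^ n)"
    using one t1 by (intro ennreal_leI power_mono) auto
  also have "exp (4 * t\<^sup>2) ^ n = exp (L / 4)"
    using n by (simp add: t2 exp_of_nat_mult[symmetric])
  finally have "measure (std_gaussian n) {e \<in> space (std_gaussian n).
      L / 2 \<le> t * (ip n e e - real n)} \<le> exp (L / 4) * exp (- (L / 2))"
    by (intro exponential_markov) auto
  moreover have "L / 2 \<le> t * (ip n e e - real n) \<longleftrightarrow> 2 * sqrt (real n * L) \<le> \<tau> * (ip n e e - real n)" for e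
  proof -
    have "L / 2 \<le> t * (ip n e e - real n) \<longleftrightarrow>
        q / 4 * (2 * sqrt (real n * L)) \<le> q / 4 * (\<tau> * (ip n e e - real n))"
      using qn by (simp add: t_def algebra_simps)
    thus ?thesis using q by (simp only: mult_le_cancel_left_pos zero_less_divide_iff) simp
  qed
  ultimately show ?thesis by (simp add: exp_add[symmetric])
qed

lemma chi_square_event:
  assumes L: "0 < L" "L \<le> real n"
  shows "\<exists>G\<in>sets (std_gaussian n).
    measure (std_gaussian n) (space (std_gaussian n) - G) \<le> 2 * exp (- L / 4) \<and>
    (\<forall>e\<in>G. \<bar>ip n e e - real n\<bar> \<le> 2 * sqrt (real n * L))"
proof -
  interpret prob_space "std_gaussian n" by (rule prob_space_std_gaussian)
  define B where "B \<tau> = {e \<in> space (std_gaussian n).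
      2 * sqrt (real n * L) \<le> \<tau> * (ip n e e - real n)}" for \<tau> :: real
  have [measurable]: "B \<tau> \<in> sets (std_gaussian n)" for \<tau> unfolding B_def by measurable
  define G where "G = space (std_gaussian n) - (B 1 \<union> B (-1))"
  have "measure (std_gaussian n) (space (std_gaussian n) - G) = measure (std_gaussian n) (B 1 \<union> B (-1))"
    by (rule arg_cong[where f = "measure _"]) (auto simp: G_def B_def)
  also have "\<dots> \<le> measure (std_gaussian n) (B 1) + measure (std_gaussian n) (B (-1))"
    by (intro measure_Un_le) auto
  also have "\<dots> \<le> exp (- L / 4) + exp (- L / 4)"
    unfolding B_def by (intro add_mono chi_square_one_sided L) auto
  finally have "measure (std_gaussian n) (space (std_gaussian n) - G) \<le> 2 * exp (- L / 4)" by simp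
  moreover have "G \<in> sets (std_gaussian n)" by (simp add: G_def)
  moreover have "\<forall>e\<in>G. \<bar>ip n e e - real n\<bar> \<le> 2 * sqrt (real n * L)"
    by (auto simp: G_def B_def)
  ultimately show ?thesis by blast
qed

section \<open>The likelihood ratio as a function of the scale\<close>

lemma ip_nonneg [simp]: "0 \<le> ip n v v"
  by (simp add: ip_def sum_nonneg)

text \<open>Expand the square and pay for the cross terms of \<open>w\<close> with half of its
  squared norm: a quarter goes to the noise and a quarter to the remainder \<open>r\<close>.\<close>

lemma residual_lower_bound:
  assumes A: "(ip n e w)\<^sup>2 \<le> A * ip n w w" "0 \<le> A"
    and B: "\<bar>ip n e r\<bar> \<le> B" and R: "ip n r r \<le> R"
  shows "ip n e e + ip n w w / 2 - 4 * A - 2 * B - 4 * R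
    \<le> ip n (\<lambda>i. e i - (w i + r i)) (\<lambda>i. e i - (w i + r i))"
proof -
  have eq: "ip n (\<lambda>i. e i - (w i + r i)) (\<lambda>i. e i - (w i + r i)) =
      ip n e e - 2 * ip n e w - 2 * ip n e r + ip n w w + 2 * ip n w r + ip n r r"
    unfolding ip_def
    by (simp add: sum_subtractf[symmetric] sum.distrib[symmetric] sum_distrib_left algebra_simps)
  \<comment> \<open>The arithmetic-geometric mean inequality, with weights 1/8 and 2 chosen so that
    four times their product is 1.\<close>
  have "(ip n e w)\<^sup>2 \<le> (ip n w w / 8 + 2 * A)\<^sup>2"
    using A sum_squares_ge_zero[of "ip n w w / 8 - 2 * A" 0]
    by (simp add: power2_eq_square algebra_simps)
  hence ew: "\<bar>ip n e w\<bar> \<le> ip n w w / 8 + 2 * A"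
    using A by (intro abs_le_square_iff[THEN iffD2, of "ip n e w" "ip n w w / 8 + 2 * A", THEN order_trans]) auto
  have "(\<Sum>i<n. - (w i * w i) / 4 - 4 * (r i * r i)) \<le> (\<Sum>i<n. 2 * (w i * r i))"
  proof (rule sum_mono)
    fix i
    show "- (w i * w i) / 4 - 4 * (r i * r i) \<le> 2 * (w i * r i)"
      using sum_squares_ge_zero[of "w i / 2 + 2 * r i" 0] by (simp add: algebra_simps)
  qed
  hence wr: "- ip n w w / 4 - 4 * ip n r r \<le> 2 * ip n w r"
    by (simp add: ip_def sum_subtractf sum_distrib_left sum_divide_distrib sum_negf)
  show ?thesis unfolding eq using ew wr B R ip_nonneg[of n r] unfolding abs_le_iff by linarith
qed

text \<open>Log density ratio of a normal law with covariance \<rho> squared times the identity to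
  the standard one in dimension \<open>n\<close>: \<open>N\<close> is the squared norm of the noise,
  \<open>Z\<close> that of the noise minus the mean. In applications \<rho> is \<sigma> /
  \<sigma>*.\<close>

definition log_lr :: "real \<Rightarrow> real \<Rightarrow> real \<Rightarrow> real \<Rightarrow> real" where
  "log_lr n \<rho> Z N = - n * ln \<rho> - Z / (2 * \<rho>\<^sup>2) + N / 2"

text \<open>With \<open>t = 1 / \<rho>\<^sup>2\<close> the bounds come from the concave function \<open>ln t - \<kappa> t\<close>, maximal at
  \<open>t = 1 / \<kappa>\<close>, where \<open>\<kappa>\<close> is close to 1.\<close>

lemma log_lr_upper:
  fixes n L :: real
  assumes n: "0 < n" "0 < L" and \<rho>: "0 < \<rho>" and c: "0 \<le> c" and W: "0 \<le> W"
    and Z: "N + W / 2 - c * L * (1 + \<rho>\<^sup>2) \<le> Z"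
    and N: "\<bar>N - n\<bar> \<le> 2 * sqrt (n * L)"
    and small: "400 * L \<le> n" "20 * c * L \<le> n"
  shows "\<rho> \<le> 2 \<Longrightarrow> log_lr n \<rho> Z N \<le> (c + 8 + 2 * c\<^sup>2) * L - W / 16"
    and "2 \<le> \<rho> \<Longrightarrow> log_lr n \<rho> Z N \<le> - n / 8"
proof -
  define q where "q = L / n"
  have q: "0 < q" "q \<le> 1 / 400" "c * q \<le> 1 / 20" "L = q * n"
    using n small by (auto simp: q_def field_simps)
  define t where "t = 1 / \<rho>\<^sup>2"
  have t: "0 < t" using \<rho> by (simp add: t_def)
  have lnt: "ln t = - 2 * ln \<rho>" using \<rho> by (simp add: t_def ln_div ln_realpow)
  define h where "h = N / n - 1"
  have Nh: "N = n * (1 + h)" using n by (simp add: h_def field_simps)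
  have "sqrt (n * L) = n * sqrt q" using n q by (simp add: real_sqrt_mult)
  with N n have h: "\<bar>h\<bar> \<le> 2 * sqrt q"
    by (simp add: h_def abs_le_iff field_simps)
  hence h2: "h\<^sup>2 \<le> 4 * q"
    using q power_mono[OF h, of 2] by (simp add: power_mult_distrib)
  have "sqrt q \<le> 1 / 20" using q by (intro real_le_lsqrt) (auto simp: power2_eq_square)
  with h have h1: "\<bar>h\<bar> \<le> 1 / 10" by linarith
  \<comment> \<open>Multiplying the error \<open>c * L * (1 + \<rho>\<^sup>2)\<close> by
    \<open>t / 2\<close> leaves \<open>c * L / 2\<close> plus a term linear in \<open>t\<close>. The
    latter is merged into the slope \<kappa>, which is why an error growing with \<rho> is
    harmless.\<close>
  define \<kappa> where "\<kappa> = 1 + (h - c * q)"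
  have cq: "0 \<le> c * q" using c q by simp
  have \<kappa>: "17 / 20 \<le> \<kappa>" "\<bar>h - c * q\<bar> \<le> 1 / 2" using h1 q(3) cq unfolding \<kappa>_def by linarith+
  have main: "log_lr n \<rho> Z N \<le> n / 2 * (ln t - \<kappa> * t + 1 + h) + c * L / 2 - W * t / 4"
  proof -
    have "(N + W / 2 - c * L * (1 + \<rho>\<^sup>2)) * (t / 2) \<le> Z * (t / 2)"
      using Z t by (intro mult_right_mono) auto
    moreover have "\<rho>\<^sup>2 * t = 1" using \<rho> by (simp add: t_def)
    hence "(N + W / 2 - c * L * (1 + \<rho>\<^sup>2)) * (t / 2) = N * t / 2 + W * t / 4 - c * L * t / 2 - c * L / 2"
      by (simp add: algebra_simps)
    moreover have "Z * (t / 2) = Z / (2 * \<rho>\<^sup>2)" by (simp add: t_def)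
    moreover have "n * ln \<rho> = - n * ln t / 2" unfolding lnt by simp
    moreover have "n / 2 * (ln t - \<kappa> * t + 1 + h) = n * ln t / 2 - N * t / 2 + c * L * t / 2 + N / 2"
      unfolding \<kappa>_def Nh q(4) by (simp add: algebra_simps add_divide_distrib diff_divide_distrib)
    ultimately show ?thesis unfolding log_lr_def by linarith
  qed
  show "log_lr n \<rho> Z N \<le> (c + 8 + 2 * c\<^sup>2) * L - W / 16" if "\<rho> \<le> 2"
  proof -
    have "\<rho>\<^sup>2 \<le> 4" using that \<rho> power_mono[of \<rho> 2 2] by simp
    \<comment> \<open>The threshold 2 for \<rho> ensures that the signal term
      \<open>W * t / 4\<close> keeps at least \<open>W / 16\<close>.\<close>
    hence "1 / 4 \<le> t" using \<rho> by (simp add: t_def field_simps)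
    hence Wt: "W / 16 \<le> W * t / 4" using W mult_left_mono[of "1/4" t W] by simp
    have "ln (\<kappa> * t) \<le> \<kappa> * t - 1" using \<kappa> t by (intro ln_le_minus_one) simp
    hence "ln t - \<kappa> * t + 1 + h \<le> h - ln \<kappa>" using \<kappa> t by (simp add: ln_mult)
    \<comment> \<open>The first-order term \<open>h\<close> cancels. This is essential:
      \<open>h\<close> has order \<open>sqrt (L / n)\<close>, and only its square is of order
      \<open>L / n\<close>.\<close>
    also have "\<dots> \<le> c * q + 2 * (h - c * q)\<^sup>2"
      using abs_ln_one_plus_x_minus_x_bound[OF \<kappa>(2)] by (simp add: \<kappa>_def abs_le_iff)
    also have "(h - c * q)\<^sup>2 \<le> 2 * h\<^sup>2 + 2 * (c * q)\<^sup>2"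
      using sum_squares_ge_zero[of "h + c * q" 0] by (simp add: power2_eq_square algebra_simps)
    also have "\<dots> \<le> 8 * q + 2 * c\<^sup>2 * q"
    proof -
      have "(c * q)\<^sup>2 = c\<^sup>2 * q * q" by (simp add: power2_eq_square)
      also have "\<dots> \<le> c\<^sup>2 * q * 1" using q by (intro mult_left_mono) auto
      finally show ?thesis using h2 by simp
    qed
    finally have "ln t - \<kappa> * t + 1 + h \<le> (c + 16 + 4 * c\<^sup>2) * q" by (simp add: algebra_simps)
    hence "n / 2 * (ln t - \<kappa> * t + 1 + h) \<le> n / 2 * ((c + 16 + 4 * c\<^sup>2) * q)"
      using n by (intro mult_left_mono) auto
    with main Wt have "log_lr n \<rho> Z N \<le> n / 2 * ((c + 16 + 4 * c\<^sup>2) * q) + c * L / 2 - W / 16" by linarith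
    also have "\<dots> = (c + 8 + 2 * c\<^sup>2) * L - W / 16" unfolding q(4) by (simp add: algebra_simps)
    finally show ?thesis .
  qed
  show "log_lr n \<rho> Z N \<le> - n / 8" if "2 \<le> \<rho>"
  proof -
    have "4 \<le> \<rho>\<^sup>2" using that power_mono[of 2 \<rho> 2] by simp
    hence t4: "t \<le> 1 / 4" using \<rho> by (simp add: t_def field_simps)
    \<comment> \<open>For large \<rho> the signal may be damped away, but the wrong scale is
      penalised by itself. The tangent of \<open>ln\<close> at 1/4 has slope 4, above \<kappa>, so
      the worst case is \<open>t = 1 / 4\<close>, with value at most -2/5.\<close>
    have "ln (4 * t) \<le> 4 * t - 1" using t by (intro ln_le_minus_one) simp
    moreover have "ln (4 * t) = ln 4 + ln t" using t by (simp add: ln_mult)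
    moreover have "ln (4::real) = 2 * ln 2" using ln_realpow[of 2 2] by simp
    moreover have "(2::real) / 3 \<le> ln 2" by (rule ln2_ge_two_thirds)
    ultimately have "ln t \<le> 4 * t - 1 - 4 / 3" by linarith
    moreover have "(4 - \<kappa>) * t \<le> (4 - \<kappa>) * (1 / 4)"
    proof (rule mult_left_mono[OF t4])
      show "0 \<le> 4 - \<kappa>" using h1 cq by (simp add: \<kappa>_def abs_le_iff)
    qed
    ultimately have "ln t - \<kappa> * t + 1 + h \<le> - (2 / 5)" using \<kappa>(1) h1
      by (simp add: algebra_simps abs_le_iff)
    hence "n / 2 * (ln t - \<kappa> * t + 1 + h) \<le> n / 2 * (- (2 / 5))"
      using n by (intro mult_left_mono) auto
    moreover have "c * L \<le> n / 20" using small by simp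
    moreover have "0 \<le> W * t / 4" using W t by simp
    ultimately show ?thesis using main n by linarith
  qed
qed

section \<open>Prior masses\<close>

lemma inverse_gamma_density_measurable [measurable]:
  "inverse_gamma_density a b \<in> borel_measurable borel"
  unfolding inverse_gamma_density_def by measurable

lemma inverse_gamma_density_nonneg: "0 < a \<Longrightarrow> 0 \<le> inverse_gamma_density a b v"
  by (simp add: inverse_gamma_density_def Gamma_real_pos less_imp_le)

text \<open>The exponential factor tames the power near 0, so the density is bounded there; beyond 1
  the power alone is integrable.\<close>

lemma inverse_gamma_total_mass_finite:
  assumes a: "0 < a" and b: "0 < b"
  obtains C where "0 < C" "(\<integral>\<^sup>+v. ennreal (inverse_gamma_density a b v) \<partial>lborel) \<le> ennreal C"
proof -
  define K where "K = b powr a / Gamma a"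
  have K: "0 < K" using a b by (simp add: K_def Gamma_real_pos)
  \<comment> \<open>Raising \<open>x \<le> exp x\<close> at \<open>x = b / (v * (a + 1))\<close> to
    the power \<open>a + 1\<close> bounds \<open>exp (- b / v)\<close> by a multiple of
    \<open>v powr (a + 1)\<close>. This cancels the power of \<open>v\<close> in the density exactly
    and leaves \<open>K1\<close>.\<close>
  define K1 where "K1 = (b / (a + 1)) powr (- (a + 1))"
  have K1: "0 < K1" using a b by (simp add: K1_def)
  define f where "f v = K * v powr (- a - 1)" for v :: real
  have bnd1: "inverse_gamma_density a b v \<le> K * K1" for v
  proof (cases "0 < v")
    case True
    have "b / (v * (a + 1)) \<le> exp (b / (v * (a + 1)))"
      using exp_ge_add_one_self[of "b / (v * (a + 1))"] by linarith
    hence "(b / (v * (a + 1))) powr (a + 1) \<le> exp (b / (v * (a + 1))) powr (a + 1)"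
      using a b True by (intro powr_mono2) auto
    also have "\<dots> = exp (b / v)" using a True by (simp add: powr_def)
    finally have "inverse (exp (b / v)) \<le> inverse ((b / (v * (a + 1))) powr (a + 1))"
      using a b True by (intro le_imp_inverse_le) auto
    hence "exp (- b / v) \<le> (b / (v * (a + 1))) powr (- (a + 1))"
      by (simp only: exp_minus powr_minus minus_divide_left[symmetric])
    moreover have "- a - 1 = - (a + 1)" by simp
    ultimately have "v powr (- a - 1) * exp (- b / v) \<le> v powr (- (a + 1)) * (b / (v * (a + 1))) powr (- (a + 1))"
      by (simp only: mult_left_mono powr_ge_zero)
    also have "\<dots> = K1" using a b True unfolding K1_def by (subst powr_mult[symmetric]) auto
    finally show ?thesis using K True
      by (simp add: inverse_gamma_density_def K_def[symmetric] mult.assoc)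
  qed (use K K1 in \<open>simp add: inverse_gamma_density_def\<close>)
  have bnd2: "inverse_gamma_density a b v \<le> f v" if "0 < v" for v
  proof -
    have "K * v powr (- a - 1) * exp (- b / v) \<le> K * v powr (- a - 1) * 1"
      using K b that by (intro mult_left_mono) auto
    thus ?thesis using that by (simp add: inverse_gamma_density_def f_def K_def)
  qed
  have tail: "(\<integral>\<^sup>+v. ennreal (f v) * indicator {1..} v \<partial>lborel) = ennreal (0 - (- K / a * 1 powr (- a)))"
  proof (rule nn_integral_FTC_atLeast)
    show "f \<in> borel_measurable borel" unfolding f_def by measurable
    show "((\<lambda>v. - K / a * v powr (- a)) has_real_derivative f x) (at x)" if "1 \<le> x" for x
      using that a by (auto intro!: derivative_eq_intros simp: f_def)
    show "0 \<le> f x" for x using K by (simp add: f_def)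
    have "((\<lambda>v. v powr (- a)) \<longlongrightarrow> 0) at_top" using a
      by (intro tendsto_neg_powr filterlim_ident) auto
    hence "((\<lambda>v. - K / a * v powr (- a)) \<longlongrightarrow> - K / a * 0) at_top"
      by (rule tendsto_mult_left)
    thus "((\<lambda>v. - K / a * v powr (- a)) \<longlongrightarrow> 0) at_top" by simp
  qed
  have "(\<integral>\<^sup>+v. ennreal (inverse_gamma_density a b v) \<partial>lborel) \<le>
      (\<integral>\<^sup>+v. ennreal (K * K1) * indicator {0..1} v + ennreal (f v) * indicator {1..} v \<partial>lborel)"
  proof (rule nn_integral_mono)
    fix v :: real
    consider "v \<le> 0" | "0 < v" "v \<le> 1" | "1 < v" by linarith
    thus "ennreal (inverse_gamma_density a b v) \<le>
        ennreal (K * K1) * indicator {0..1} v + ennreal (f v) * indicator {1..} v"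
    proof cases
      case 1
      thus ?thesis by (simp add: inverse_gamma_density_def)
    next
      case 2
      have "ennreal (inverse_gamma_density a b v) \<le> ennreal (K * K1)" by (intro ennreal_leI bnd1)
      thus ?thesis using 2 by (simp add: add_increasing2)
    next
      case 3
      thus ?thesis using bnd2[of v] by (simp add: ennreal_leI)
    qed
  qed
  also have "\<dots> = ennreal (K * K1) + ennreal (K / a)"
    using tail by (subst nn_integral_add) (auto simp: f_def nn_integral_cmult)
  also have "\<dots> = ennreal (K * K1 + K / a)" using K K1 a by (simp add: ennreal_plus)
  finally show ?thesis using K K1 a by (intro that[of "K * K1 + K / a"] add_pos_pos) auto
qed

lemma inverse_gamma_density_lower:
  assumes a: "0 < a" and b: "0 < b" and V: "0 < V"
  obtains c where "0 < c" "\<And>v. V \<le> v \<Longrightarrow> v \<le> 2 * V \<Longrightarrow> c \<le> inverse_gamma_density a b v"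
proof
  let ?c = "b powr a / Gamma a * (2 * V) powr (- a - 1) * exp (- b / V)"
  show "0 < ?c" using a b V by (simp add: Gamma_real_pos)
  fix v assume v: "V \<le> v" "v \<le> 2 * V"
  have "(2 * V) powr (- a - 1) \<le> v powr (- a - 1)"
    using a V v by (intro powr_mono2') auto
  moreover have "exp (- b / V) \<le> exp (- b / v)" using b V v by (simp add: frac_le)
  ultimately have "(2 * V) powr (- a - 1) * exp (- b / V) \<le> v powr (- a - 1) * exp (- b / v)"
    by (intro mult_mono) auto
  hence "b powr a / Gamma a * ((2 * V) powr (- a - 1) * exp (- b / V)) \<le>
      b powr a / Gamma a * (v powr (- a - 1) * exp (- b / v))"
    using a by (intro mult_left_mono) (auto simp: Gamma_real_pos less_imp_le)
  thus "?c \<le> inverse_gamma_density a b v" using V v by (simp add: inverse_gamma_density_def mult.assoc)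
qed

section \<open>Integration against the joint prior of coefficients and variance\<close>

lemma sigma_finite_PiM_lborel: "sigma_finite_measure (\<Pi>\<^sub>M j\<in>{..<k::nat}. (lborel :: real measure))"
proof -
  interpret product_sigma_finite "\<lambda>_::nat. lborel :: real measure" ..
  show ?thesis by (rule sigma_finite) simp
qed

lemma sets_param_base [measurable_cong]:
  "sets (param_base k) = sets ((\<Pi>\<^sub>M j\<in>{..<k}. borel) \<Otimes>\<^sub>M borel)"
  unfolding param_base_def by (intro sets_pair_measure_cong sets_PiM_cong) auto

lemma param_coord_measurable:
  "j < k \<Longrightarrow> (\<lambda>\<theta>. fst \<theta> j) \<in> borel_measurable (param_base k)"
  "snd \<in> borel_measurable (param_base k)"
  by measurable

text \<open>The variance is the outer variable because the coefficients are independent only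
  conditionally on it.\<close>

lemma nn_integral_param_base:
  assumes "f \<in> borel_measurable (param_base k)"
  shows "(\<integral>\<^sup>+\<theta>. f \<theta> \<partial>param_base k) = (\<integral>\<^sup>+v. \<integral>\<^sup>+\<beta>. f (\<beta>, v) \<partial>(\<Pi>\<^sub>M j\<in>{..<k}. lborel) \<partial>lborel)"
proof -
  interpret sigma_finite_measure "\<Pi>\<^sub>M j\<in>{..<k}. (lborel :: real measure)" by (rule sigma_finite_PiM_lborel)
  interpret pair_sigma_finite "\<Pi>\<^sub>M j\<in>{..<k}. (lborel :: real measure)" "lborel :: real measure" ..
  show ?thesis using assms unfolding param_base_def by (simp add: nn_integral_snd[symmetric])
qed

text \<open>Substituting \<open>t = sqrt v * x\<close> removes the scale, so that prior
  probabilities of events expressed in \<beta> / \<sigma> are uniform in \<open>v\<close>.\<close>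

lemma nn_integral_scaled_density:
  assumes [measurable]: "h \<in> borel_measurable borel" "g \<in> borel_measurable borel" and v: "0 < v"
  shows "(\<integral>\<^sup>+t. h (t / sqrt v) * ennreal (g (t / sqrt v) / sqrt v) \<partial>lborel) = (\<integral>\<^sup>+x. h x * ennreal (g x) \<partial>lborel)"
proof -
  have "(\<integral>\<^sup>+t. h (t / sqrt v) * ennreal (g (t / sqrt v) / sqrt v) \<partial>lborel) =
      ennreal \<bar>sqrt v\<bar> * (\<integral>\<^sup>+x. h ((0 + sqrt v * x) / sqrt v) * ennreal (g ((0 + sqrt v * x) / sqrt v) / sqrt v) \<partial>lborel)"
    using v by (intro nn_integral_real_affine) auto
  also have "\<dots> = (\<integral>\<^sup>+x. ennreal (sqrt v) * (h x * ennreal (g x / sqrt v)) \<partial>lborel)"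
    using v by (subst nn_integral_cmult) auto
  also have "\<dots> = (\<integral>\<^sup>+x. h x * ennreal (g x) \<partial>lborel)"
  proof (rule nn_integral_cong)
    fix x
    have "ennreal (sqrt v) * ennreal (g x / sqrt v) = ennreal (g x)"
      using v by (subst ennreal_mult'[symmetric]) auto
    thus "ennreal (sqrt v) * (h x * ennreal (g x / sqrt v)) = h x * ennreal (g x)"
      by (simp add: mult.left_commute)
  qed
  finally show ?thesis .
qed

lemma coef_prior_nonneg: "\<forall>x. 0 \<le> g x \<Longrightarrow> 0 < v \<Longrightarrow> 0 \<le> coef_prior k g \<beta> v"
  by (simp add: coef_prior_def prod_nonneg)

lemma nn_integral_coef_prior:
  assumes h: "\<And>j. j < k \<Longrightarrow> h j \<in> borel_measurable borel"
    and g [measurable]: "g \<in> borel_measurable borel" and nonneg: "\<forall>x. 0 \<le> g x" and v: "0 < v"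
  shows "(\<integral>\<^sup>+\<beta>. (\<Prod>j<k. h j (\<beta> j)) * ennreal (coef_prior k g \<beta> v) \<partial>(\<Pi>\<^sub>M j\<in>{..<k}. lborel)) =
    (\<Prod>j<k. \<integral>\<^sup>+t. h j t * ennreal (g (t / sqrt v) / sqrt v) \<partial>lborel)"
proof -
  interpret product_sigma_finite "\<lambda>_::nat. lborel :: real measure" ..
  have "(\<integral>\<^sup>+\<beta>. (\<Prod>j<k. h j (\<beta> j)) * ennreal (coef_prior k g \<beta> v) \<partial>(\<Pi>\<^sub>M j\<in>{..<k}. lborel)) =
      (\<integral>\<^sup>+\<beta>. (\<Prod>j<k. h j (\<beta> j) * ennreal (g (\<beta> j / sqrt v) / sqrt v)) \<partial>(\<Pi>\<^sub>M j\<in>{..<k}. lborel))"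
    using nonneg v by (simp add: coef_prior_def prod_ennreal[symmetric] prod.distrib)
  also have "\<dots> = (\<Prod>j<k. \<integral>\<^sup>+t. h j t * ennreal (g (t / sqrt v) / sqrt v) \<partial>lborel)"
    using h by (intro product_nn_integral_prod) auto
  finally show ?thesis .
qed

definition prior_density :: "nat \<Rightarrow> (real \<Rightarrow> real) \<Rightarrow> real \<Rightarrow> real \<Rightarrow> (nat \<Rightarrow> real) \<times> real \<Rightarrow> real" where
  "prior_density k g a0 b0 \<theta> = coef_prior k g (fst \<theta>) (snd \<theta>) * inverse_gamma_density a0 b0 (snd \<theta>)"

lemma prior_density_nonneg:
  "\<forall>x. 0 \<le> g x \<Longrightarrow> 0 < a0 \<Longrightarrow> 0 \<le> prior_density k g a0 b0 \<theta>"
  by (cases "0 < snd \<theta>")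
    (auto simp: prior_density_def coef_prior_nonneg inverse_gamma_density_nonneg, simp add: inverse_gamma_density_def)

lemma prior_density_eq_0: "snd \<theta> \<le> 0 \<Longrightarrow> prior_density k g a0 b0 \<theta> = 0"
  by (simp add: prior_density_def inverse_gamma_density_def)

lemma prior_density_measurable [measurable]:
  assumes [measurable]: "g \<in> borel_measurable borel"
  shows "prior_density k g a0 b0 \<in> borel_measurable (param_base k)"
proof -
  have [measurable]: "(\<lambda>\<theta>. fst \<theta> j) \<in> borel_measurable (param_base k)" if "j < k" for j
    using that by (rule param_coord_measurable)
  have [measurable]: "snd \<in> borel_measurable (param_base k)" by (rule param_coord_measurable)
  show ?thesis unfolding prior_density_def coef_prior_def by measurable
qed

lemma nn_integral_prior:
  assumes G [measurable]: "G \<in> borel_measurable (param_base k)"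
    and g [measurable]: "g \<in> borel_measurable borel" and nonneg: "\<forall>x. 0 \<le> g x" and a0: "0 < a0"
  shows "(\<integral>\<^sup>+\<theta>. G \<theta> * ennreal (prior_density k g a0 b0 \<theta>) \<partial>param_base k) =
    (\<integral>\<^sup>+v. ennreal (inverse_gamma_density a0 b0 v) *
       (\<integral>\<^sup>+\<beta>. G (\<beta>, v) * ennreal (coef_prior k g \<beta> v) \<partial>(\<Pi>\<^sub>M j\<in>{..<k}. lborel)) \<partial>lborel)"
proof -
  have "(\<integral>\<^sup>+\<theta>. G \<theta> * ennreal (prior_density k g a0 b0 \<theta>) \<partial>param_base k) =
      (\<integral>\<^sup>+v. \<integral>\<^sup>+\<beta>. G (\<beta>, v) * ennreal (prior_density k g a0 b0 (\<beta>, v)) \<partial>(\<Pi>\<^sub>M j\<in>{..<k}. lborel) \<partial>lborel)"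
    by (rule nn_integral_param_base) measurable
  also have "\<dots> = (\<integral>\<^sup>+v. ennreal (inverse_gamma_density a0 b0 v) *
       (\<integral>\<^sup>+\<beta>. G (\<beta>, v) * ennreal (coef_prior k g \<beta> v) \<partial>(\<Pi>\<^sub>M j\<in>{..<k}. lborel)) \<partial>lborel)"
  proof (rule nn_integral_cong)
    fix v :: real
    have [measurable]: "(\<lambda>\<beta>. G (\<beta>, v)) \<in> borel_measurable (\<Pi>\<^sub>M j\<in>{..<k}. lborel)"
      using measurable_compose[OF measurable_Pair2' G[unfolded param_base_def], of v] by simp
    have [measurable]: "(\<lambda>\<beta>. coef_prior k g \<beta> v) \<in> borel_measurable (\<Pi>\<^sub>M j\<in>{..<k}. lborel)"
      unfolding coef_prior_def by measurable
    have eq: "G (\<beta>, v) * ennreal (prior_density k g a0 b0 (\<beta>, v)) =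
        ennreal (inverse_gamma_density a0 b0 v) * (G (\<beta>, v) * ennreal (coef_prior k g \<beta> v))" for \<beta>
    proof (cases "0 < v")
      case True
      thus ?thesis using nonneg a0
        by (simp add: prior_density_def ennreal_mult coef_prior_nonneg inverse_gamma_density_nonneg mult_ac)
    next
      case False
      thus ?thesis by (simp add: prior_density_def inverse_gamma_density_def)
    qed
    show "(\<integral>\<^sup>+\<beta>. G (\<beta>, v) * ennreal (prior_density k g a0 b0 (\<beta>, v)) \<partial>(\<Pi>\<^sub>M j\<in>{..<k}. lborel)) =
      ennreal (inverse_gamma_density a0 b0 v) *
       (\<integral>\<^sup>+\<beta>. G (\<beta>, v) * ennreal (coef_prior k g \<beta> v) \<partial>(\<Pi>\<^sub>M j\<in>{..<k}. lborel))"
      unfolding eq by (rule nn_integral_cmult) measurable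
  qed
  finally show ?thesis .
qed

lemma prior_mass_upper:
  assumes G [measurable]: "G \<in> borel_measurable (param_base k)"
    and g [measurable]: "g \<in> borel_measurable borel" and nonneg: "\<forall>x. 0 \<le> g x" and a0: "0 < a0"
    and CI: "(\<integral>\<^sup>+v. ennreal (inverse_gamma_density a0 b0 v) \<partial>lborel) \<le> ennreal CI" "0 \<le> CI"
    and B: "\<And>v. 0 < v \<Longrightarrow>
      (\<integral>\<^sup>+\<beta>. G (\<beta>, v) * ennreal (coef_prior k g \<beta> v) \<partial>(\<Pi>\<^sub>M j\<in>{..<k}. lborel)) \<le> ennreal B" "0 \<le> B"
  shows "(\<integral>\<^sup>+\<theta>. G \<theta> * ennreal (prior_density k g a0 b0 \<theta>) \<partial>param_base k) \<le> ennreal (CI * B)"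
proof -
  have "(\<integral>\<^sup>+\<theta>. G \<theta> * ennreal (prior_density k g a0 b0 \<theta>) \<partial>param_base k) \<le>
      (\<integral>\<^sup>+v. ennreal (inverse_gamma_density a0 b0 v) * ennreal B \<partial>lborel)"
    unfolding nn_integral_prior[OF G g nonneg a0]
  proof (rule nn_integral_mono)
    fix v :: real
    show "ennreal (inverse_gamma_density a0 b0 v) *
       (\<integral>\<^sup>+\<beta>. G (\<beta>, v) * ennreal (coef_prior k g \<beta> v) \<partial>(\<Pi>\<^sub>M j\<in>{..<k}. lborel))
       \<le> ennreal (inverse_gamma_density a0 b0 v) * ennreal B"
      by (cases "0 < v") (auto intro!: mult_left_mono B simp: inverse_gamma_density_def)
  qed
  also have "\<dots> = (\<integral>\<^sup>+v. ennreal (inverse_gamma_density a0 b0 v) \<partial>lborel) * ennreal B"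
    by (rule nn_integral_multc) measurable
  also have "\<dots> \<le> ennreal CI * ennreal B" by (rule mult_right_mono[OF CI(1)]) simp
  finally show ?thesis using CI B by (simp add: ennreal_mult)
qed

lemma prior_total_mass:
  assumes g: "prob_density g" and a0: "0 < a0"
    and CI: "(\<integral>\<^sup>+v. ennreal (inverse_gamma_density a0 b0 v) \<partial>lborel) \<le> ennreal CI" "0 \<le> CI"
  shows "(\<integral>\<^sup>+\<theta>. ennreal (prior_density k g a0 b0 \<theta>) \<partial>param_base k) \<le> ennreal CI"
proof -
  have g': "g \<in> borel_measurable borel" "\<forall>x. 0 \<le> g x" "(\<integral>\<^sup>+x. ennreal (g x) \<partial>lborel) = 1"
    using g by (auto simp: prob_density_def)
  have "(\<integral>\<^sup>+\<theta>. 1 * ennreal (prior_density k g a0 b0 \<theta>) \<partial>param_base k) \<le> ennreal (CI * 1)"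
  proof (rule prior_mass_upper[OF _ g'(1,2) a0 CI])
    fix v :: real assume v: "0 < v"
    show "(\<integral>\<^sup>+\<beta>. 1 * ennreal (coef_prior k g \<beta> v) \<partial>(\<Pi>\<^sub>M j\<in>{..<k}. lborel)) \<le> ennreal 1"
      using nn_integral_coef_prior[of k "\<lambda>_ _. 1", OF _ g'(1,2) v]
        nn_integral_scaled_density[of "\<lambda>_. 1", OF _ g'(1) v] g'(3) by simp
  qed auto
  thus ?thesis by simp
qed

text \<open>Exponential Markov inequality for the number of large coordinates, with weight \<open>p powr u\<close> per
  large coordinate: this weight is what a tail mass of \<open>p powr (- (1 + u))\<close> can still absorb.\<close>

lemma prior_mass_many_large:
  assumes g: "prob_density g" and a0: "0 < a0"
    and CI: "(\<integral>\<^sup>+v. ennreal (inverse_gamma_density a0 b0 v) \<partial>lborel) \<le> ennreal CI" "0 \<le> CI"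
    and p: "0 < p" and u: "0 < u"
    and tail: "(\<integral>\<^sup>+x. indicator {x. a < \<bar>x\<bar>} x * ennreal (g x) \<partial>lborel) \<le> ennreal (real p powr (- (1 + u)))"
  shows "(\<integral>\<^sup>+\<theta>. indicator {\<theta>. 0 < snd \<theta> \<and> m \<le> card {j. j < p \<and> a * sqrt (snd \<theta>) < \<bar>fst \<theta> j\<bar>}} \<theta> *
      ennreal (prior_density p g a0 b0 \<theta>) \<partial>param_base p) \<le> ennreal (CI * (exp 1 * real p powr (- u * real m)))"
proof -
  have g': "g \<in> borel_measurable borel" "\<forall>x. 0 \<le> g x" "(\<integral>\<^sup>+x. ennreal (g x) \<partial>lborel) = 1"
    using g by (auto simp: prob_density_def)
  note [measurable] = g'(1)
  have [measurable]: "(\<lambda>\<theta>. fst \<theta> j) \<in> borel_measurable (param_base p)" if "j < p" for j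
    using that by (rule param_coord_measurable)
  have [measurable]: "snd \<in> borel_measurable (param_base p)" by (rule param_coord_measurable)
  define P where "P = real p powr u"
  have P1: "1 \<le> P" using p u by (simp add: P_def ge_one_powr_ge_zero)
  \<comment> \<open>Weight \<open>p powr u\<close> for a large standardised coordinate and 1
    otherwise. The product of these weights is at least \<open>p powr (u * m)\<close> when
    \<open>m\<close> coordinates are large.\<close>
  define h where "h x = 1 + ennreal (P - 1) * indicator {x. a < \<bar>x\<bar>} x" for x :: real
  have h_eq: "h x = (if a < \<bar>x\<bar> then ennreal P else 1)" for x
    using P1 ennreal_plus[of 1 "P - 1"] by (auto simp: h_def)
  have [measurable]: "h \<in> borel_measurable borel" unfolding h_def by measurable
  define G where "G \<theta> = ennreal (real p powr (- u * real m)) * (\<Prod>j<p. h (fst \<theta> j / sqrt (snd \<theta>)))"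
    for \<theta> :: "(nat \<Rightarrow> real) \<times> real"
  have [measurable]: "G \<in> borel_measurable (param_base p)" unfolding G_def by measurable
  have dom: "indicator {\<theta>. 0 < snd \<theta> \<and> m \<le> card {j. j < p \<and> a * sqrt (snd \<theta>) < \<bar>fst \<theta> j\<bar>}} \<theta> \<le> G \<theta>" for \<theta>
  proof (cases "0 < snd \<theta> \<and> m \<le> card {j. j < p \<and> a * sqrt (snd \<theta>) < \<bar>fst \<theta> j\<bar>}")
    case True
    define J where "J = {j. j < p \<and> a * sqrt (snd \<theta>) < \<bar>fst \<theta> j\<bar>}"
    have J: "J \<subseteq> {..<p}" by (auto simp: J_def)
    have "(\<Prod>j<p. h (fst \<theta> j / sqrt (snd \<theta>))) = (\<Prod>j<p. if j \<in> J then ennreal P else 1)"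
      using True by (intro prod.cong refl) (auto simp: h_eq J_def field_simps)
    also have "\<dots> = ennreal P ^ card J"
      using J by (simp add: prod.If_cases Int_absorb1)
    finally have "G \<theta> = ennreal (real p powr (- u * real m) * P ^ card J)"
      using P1 by (simp add: G_def ennreal_power ennreal_mult)
    moreover have "real p powr (- u * real m) * P ^ m \<le> real p powr (- u * real m) * P ^ card J"
      using True P1 by (intro mult_left_mono power_increasing) (auto simp: J_def)
    moreover have "P ^ m = real p powr (u * real m)"
      using p by (simp add: P_def powr_powr powr_realpow[symmetric])
    hence "real p powr (- u * real m) * P ^ m = 1" using p by (simp add: powr_add[symmetric])
    ultimately show ?thesis using True by (simp add: ennreal_ge_1)
  qed simp
  have "(\<integral>\<^sup>+\<theta>. G \<theta> * ennreal (prior_density p g a0 b0 \<theta>) \<partial>param_base p) \<le>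
      ennreal (CI * (exp 1 * real p powr (- u * real m)))"
  proof (rule prior_mass_upper[OF _ g'(1,2) a0 CI])
    fix v :: real assume v: "0 < v"
    have one: "(\<integral>\<^sup>+t. h (t / sqrt v) * ennreal (g (t / sqrt v) / sqrt v) \<partial>lborel) \<le> ennreal (1 + 1 / real p)"
    proof -
      have "(\<integral>\<^sup>+t. h (t / sqrt v) * ennreal (g (t / sqrt v) / sqrt v) \<partial>lborel) =
          (\<integral>\<^sup>+x. h x * ennreal (g x) \<partial>lborel)"
        using v by (intro nn_integral_scaled_density) measurable
      also have "\<dots> = (\<integral>\<^sup>+x. ennreal (g x) + ennreal (P - 1) * (indicator {x. a < \<bar>x\<bar>} x * ennreal (g x)) \<partial>lborel)"
        by (simp add: h_def distrib_right mult.assoc)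
      also have "\<dots> = 1 + ennreal (P - 1) * (\<integral>\<^sup>+x. indicator {x. a < \<bar>x\<bar>} x * ennreal (g x) \<partial>lborel)"
        by (subst nn_integral_add) (auto simp: g' nn_integral_cmult)
      also have "\<dots> \<le> 1 + ennreal P * ennreal (real p powr (- (1 + u)))"
        by (intro add_left_mono mult_mono tail ennreal_leI) auto
      also have "\<dots> = ennreal (1 + P * real p powr (- (1 + u)))"
        using P1 by (simp add: ennreal_mult ennreal_plus)
      also have "P * real p powr (- (1 + u)) = 1 / real p"
        using p by (simp add: P_def powr_add[symmetric] powr_minus_divide)
      finally show ?thesis .
    qed
    have "(\<integral>\<^sup>+\<beta>. G (\<beta>, v) * ennreal (coef_prior p g \<beta> v) \<partial>(\<Pi>\<^sub>M j\<in>{..<p}. lborel)) =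
        ennreal (real p powr (- u * real m)) *
        (\<integral>\<^sup>+\<beta>. (\<Prod>j<p. h (\<beta> j / sqrt v)) * ennreal (coef_prior p g \<beta> v) \<partial>(\<Pi>\<^sub>M j\<in>{..<p}. lborel))"
      unfolding G_def fst_conv snd_conv mult.assoc coef_prior_def by (rule nn_integral_cmult) measurable
    also have "(\<integral>\<^sup>+\<beta>. (\<Prod>j<p. h (\<beta> j / sqrt v)) * ennreal (coef_prior p g \<beta> v) \<partial>(\<Pi>\<^sub>M j\<in>{..<p}. lborel)) =
        (\<Prod>j<p. \<integral>\<^sup>+t. h (t / sqrt v) * ennreal (g (t / sqrt v) / sqrt v) \<partial>lborel)"
      by (rule nn_integral_coef_prior[OF _ g'(1,2) v]) measurable
    \<comment> \<open>The weight reduces the tail mass to \<open>1 / p\<close> per coordinate, so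
      the product over all \<open>p\<close> coordinates stays below \<open>exp 1\<close>.\<close>
    also have "\<dots> \<le> (\<Prod>j<p. ennreal (1 + 1 / real p))"
      by (intro prod_mono_ennreal one)
    also have "\<dots> = ennreal ((1 + 1 / real p) ^ p)"
      by (simp add: ennreal_power del: ennreal_plus)
    also have "\<dots> \<le> ennreal (exp 1)"
      using exp_ge_one_plus_x_over_n_power_n[of p 1] p by (intro ennreal_leI) simp
    finally show "(\<integral>\<^sup>+\<beta>. G (\<beta>, v) * ennreal (coef_prior p g \<beta> v) \<partial>(\<Pi>\<^sub>M j\<in>{..<p}. lborel))
        \<le> ennreal (exp 1 * real p powr (- u * real m))"
      by (simp add: ennreal_mult mult.commute mult_right_mono)
  qed (use CI in auto)
  moreover have "(\<integral>\<^sup>+\<theta>. indicator {\<theta>. 0 < snd \<theta> \<and> m \<le> card {j. j < p \<and> a * sqrt (snd \<theta>) < \<bar>fst \<theta> j\<bar>}} \<theta> *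
      ennreal (prior_density p g a0 b0 \<theta>) \<partial>param_base p) \<le>
      (\<integral>\<^sup>+\<theta>. G \<theta> * ennreal (prior_density p g a0 b0 \<theta>) \<partial>param_base p)"
    by (intro nn_integral_mono mult_right_mono dom) simp
  ultimately show ?thesis by (rule order_trans[rotated])
qed

text \<open>Intended for the normalising constant, whose finiteness is not established: if it is
  infinite, the quotient in \<open>ennreal\<close> is 0.\<close>

lemma ennreal_divide_le:
  assumes a: "a \<le> ennreal x" and d: "ennreal y \<le> d" and pos: "0 \<le> x" "0 < y"
  shows "a / d \<le> ennreal (x / y)"
proof (cases d)
  case (real z)
  hence z: "y \<le> z" using d pos by simp
  have "a / d \<le> ennreal x / ennreal z" unfolding real by (rule divide_right_mono_ennreal[OF a])
  also have "\<dots> = ennreal (x / z)" using pos z by (intro divide_ennreal) auto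
  also have "\<dots> \<le> ennreal (x / y)" using pos z by (intro ennreal_leI divide_left_mono) auto
  finally show ?thesis .
next
  case top
  thus ?thesis by (simp add: divide_ennreal_def)
qed

lemma density_interval_mass:
  assumes g: "prob_density g" and c: "1 - (LBINT x:{- a..a}. g x) \<le> \<tau>" and \<tau>: "0 \<le> \<tau>"
  shows "(\<integral>\<^sup>+x. indicator {x. a < \<bar>x\<bar>} x * ennreal (g x) \<partial>lborel) \<le> ennreal \<tau>"
    and "ennreal (1 - \<tau>) \<le> (\<integral>\<^sup>+x. indicator {x. \<bar>x\<bar> \<le> a} x * ennreal (g x) \<partial>lborel)"
proof -
  have g' [measurable]: "g \<in> borel_measurable borel" and nn: "\<And>x. 0 \<le> g x"
    and one: "(\<integral>\<^sup>+x. ennreal (g x) \<partial>lborel) = 1"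
    using g by (auto simp: prob_density_def)
  have int: "integrable lborel g"
    by (rule integrableI_nonneg) (auto simp: nn one)
  let ?I = "LBINT x:{- a..a}. g x"
  have set: "{x. \<bar>x\<bar> \<le> a} = {- a..a}" by auto
  have inn: "(\<integral>\<^sup>+x. indicator {x. \<bar>x\<bar> \<le> a} x * ennreal (g x) \<partial>lborel) = ennreal ?I"
  proof -
    have "(\<integral>\<^sup>+x. indicator {x. \<bar>x\<bar> \<le> a} x * ennreal (g x) \<partial>lborel) =
        (\<integral>\<^sup>+x. ennreal (indicator {- a..a} x *\<^sub>R g x) \<partial>lborel)"
      unfolding set by (intro nn_integral_cong) (simp split: split_indicator)
    also have "\<dots> = ennreal ?I"
      unfolding set_lebesgue_integral_def
      using int by (intro nn_integral_eq_integral integrable_mult_indicator) (auto simp: nn)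
    finally show ?thesis .
  qed
  thus "ennreal (1 - \<tau>) \<le> (\<integral>\<^sup>+x. indicator {x. \<bar>x\<bar> \<le> a} x * ennreal (g x) \<partial>lborel)"
    using c by (simp add: ennreal_leI)
  have I0: "0 \<le> ?I" unfolding set_lebesgue_integral_def
    by (intro integral_nonneg_AE) (auto simp: nn)
  have "1 = (\<integral>\<^sup>+x. indicator {x. a < \<bar>x\<bar>} x * ennreal (g x) + indicator {x. \<bar>x\<bar> \<le> a} x * ennreal (g x) \<partial>lborel)"
    unfolding one[symmetric] by (intro nn_integral_cong) (auto split: split_indicator)
  also have "\<dots> = (\<integral>\<^sup>+x. indicator {x. a < \<bar>x\<bar>} x * ennreal (g x) \<partial>lborel) + ennreal ?I"
    unfolding inn[symmetric] by (rule nn_integral_add) measurable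
  finally have split: "(\<integral>\<^sup>+x. indicator {x. a < \<bar>x\<bar>} x * ennreal (g x) \<partial>lborel) + ennreal ?I = 1" ..
  show "(\<integral>\<^sup>+x. indicator {x. a < \<bar>x\<bar>} x * ennreal (g x) \<partial>lborel) \<le> ennreal \<tau>"
  proof (cases "\<integral>\<^sup>+x. indicator {x. a < \<bar>x\<bar>} x * ennreal (g x) \<partial>lborel")
    case (real r)
    hence "ennreal (r + ?I) = ennreal 1" using split I0 by simp
    hence "r + ?I = 1" using real I0 by (subst (asm) ennreal_inj) auto
    thus ?thesis using real c by (simp add: ennreal_leI)
  next
    case top
    thus ?thesis using split by simp
  qed
qed

text \<open>Given \<open>v\<close>, membership in \<open>S\<close> is a product of one-coordinate
  conditions. A coordinate of the true support contributes at least \<open>r * \<gamma>\<close>, any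
  other at least \<open>1 - \<tau>\<close>, and the variance window has length
  \<open>\<delta> * sg\<^sup>2\<close> and density at least \<open>cI\<close>.\<close>

lemma prior_mass_lower:
  fixes bs :: "nat \<Rightarrow> real" and r \<gamma> \<tau> \<delta> sg :: real
  assumes g: "prob_density g" and a0: "0 < a0" and sg: "0 < sg"
    and ig: "\<And>v. sg\<^sup>2 \<le> v \<Longrightarrow> v \<le> 2 * sg\<^sup>2 \<Longrightarrow> cI \<le> inverse_gamma_density a0 b0 v" "0 < cI"
    and \<delta>: "0 < \<delta>" "\<delta> \<le> 1" and r: "0 < r"
    and \<gamma>: "\<And>x. \<bar>x\<bar> \<le> E \<Longrightarrow> \<gamma> \<le> g x" "0 < \<gamma>"
    and bs: "\<And>j. j < p \<Longrightarrow> \<bar>bs j\<bar> / sg + r \<le> E"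
    and \<tau>: "1 - (LBINT x:{- a..a}. g x) \<le> \<tau>" "0 \<le> \<tau>" "\<tau> \<le> 1"
    and S: "S = {\<theta>. sg\<^sup>2 \<le> snd \<theta> \<and> snd \<theta> \<le> sg\<^sup>2 * (1 + \<delta>) \<and>
        (\<forall>j<p. if bs j \<noteq> 0 then \<bar>fst \<theta> j - bs j\<bar> \<le> r * sg else \<bar>fst \<theta> j\<bar> \<le> a * sqrt (snd \<theta>))}"
  shows "ennreal (cI * \<delta> * sg\<^sup>2 * ((r * \<gamma>) ^ card (supp p bs) * (1 - \<tau>) ^ p)) \<le>
    (\<integral>\<^sup>+\<theta>. indicator S \<theta> * ennreal (prior_density p g a0 b0 \<theta>) \<partial>param_base p)"
proof -
  have g': "g \<in> borel_measurable borel" "\<forall>x. 0 \<le> g x"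
    using g by (auto simp: prob_density_def)
  note [measurable] = g'(1)
  have [measurable]: "(\<lambda>\<theta>. fst \<theta> j) \<in> borel_measurable (param_base p)" if "j < p" for j
    using that by (rule param_coord_measurable)
  have [measurable]: "snd \<in> borel_measurable (param_base p)" by (rule param_coord_measurable)
  define Iv where "Iv = {sg\<^sup>2..sg\<^sup>2 * (1 + \<delta>)}"
  define h where "h v j = (if bs j \<noteq> 0 then indicator {t. \<bar>t - bs j\<bar> \<le> r * sg}
      else indicator {t. \<bar>t\<bar> \<le> a * sqrt v} :: real \<Rightarrow> ennreal)" for v j
  have h_meas: "(\<lambda>x. h (f1 x) j (f2 x)) \<in> borel_measurable M"
    if [measurable]: "f1 \<in> borel_measurable M" "f2 \<in> borel_measurable M" for f1 f2 :: "'z \<Rightarrow> real" and j M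
  proof (cases "bs j = 0")
    case True
    have "(\<lambda>x. h (f1 x) j (f2 x)) = (\<lambda>x. indicator {x. \<bar>f2 x\<bar> \<le> a * sqrt (f1 x)} x)"
      using True by (auto simp: h_def indicator_def)
    thus ?thesis by simp measurable
  next
    case False
    thus ?thesis by (simp add: h_def) measurable
  qed
  define G where "G \<theta> = indicator Iv (snd \<theta>) * (\<Prod>j<p. h (snd \<theta>) j (fst \<theta> j))" for \<theta> :: "(nat \<Rightarrow> real) \<times> real"
  have G_eq: "G \<theta> = indicator S \<theta>" for \<theta>
  proof -
    have "(\<Prod>j<p. h (snd \<theta>) j (fst \<theta> j)) = (if \<forall>j<p. (if bs j \<noteq> 0 then \<bar>fst \<theta> j - bs j\<bar> \<le> r * sg else \<bar>fst \<theta> j\<bar> \<le> a * sqrt (snd \<theta>)) then 1 else 0)"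
    proof (cases "\<forall>j<p. (if bs j \<noteq> 0 then \<bar>fst \<theta> j - bs j\<bar> \<le> r * sg else \<bar>fst \<theta> j\<bar> \<le> a * sqrt (snd \<theta>))")
      case True
      thus ?thesis by (auto simp: h_def intro!: prod.neutral split: if_splits)
    next
      case False
      then obtain j where "j < p" "h (snd \<theta>) j (fst \<theta> j) = 0"
        by (auto simp: h_def split: if_splits)
      hence "(\<Prod>j<p. h (snd \<theta>) j (fst \<theta> j)) = 0" by (intro prod_zero) auto
      thus ?thesis by (simp only: False if_False)
    qed
    thus ?thesis by (auto simp: G_def S Iv_def split: split_indicator)
  qed
  have G_meas: "G \<in> borel_measurable (param_base p)"
  proof -
    have "(\<lambda>\<theta>. h (snd \<theta>) j (fst \<theta> j)) \<in> borel_measurable (param_base p)" if "j < p" for j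
      using that by (intro h_meas) measurable
    thus ?thesis unfolding G_def Iv_def by measurable
  qed
  have inner: "ennreal ((r * \<gamma>) ^ card (supp p bs) * (1 - \<tau>) ^ p) \<le>
      (\<integral>\<^sup>+\<beta>. (\<Prod>j<p. h v j (\<beta> j)) * ennreal (coef_prior p g \<beta> v) \<partial>(\<Pi>\<^sub>M j\<in>{..<p}. lborel))"
    if v: "v \<in> Iv" for v
  proof -
    have "sg\<^sup>2 * (1 + \<delta>) \<le> sg\<^sup>2 * 4" using \<delta> by (intro mult_left_mono) auto
    hence v1: "sg\<^sup>2 \<le> v" "v \<le> 4 * sg\<^sup>2" using v by (auto simp: Iv_def)
    have v0: "0 < v" using v1 sg by (smt (verit) zero_less_power)
    have sv: "sg \<le> sqrt v" "sqrt v \<le> 2 * sg" "0 < sqrt v"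
      using v1 sg v0 real_sqrt_le_mono[OF v1(1)] real_sqrt_le_mono[OF v1(2)] by (auto simp: real_sqrt_mult)
    have fac: "ennreal (if bs j \<noteq> 0 then r * \<gamma> else 1 - \<tau>) \<le>
        (\<integral>\<^sup>+t. h v j t * ennreal (g (t / sqrt v) / sqrt v) \<partial>lborel)" if j: "j < p" for j
    proof (cases "bs j = 0")
      case False
      \<comment> \<open>Density bound times interval length; the factor 2 of the length compensates
        for \<open>sqrt v\<close> being up to \<open>2 * sg\<close>.\<close>
      have "ennreal (r * \<gamma>) \<le> ennreal (\<gamma> / sqrt v) * ennreal (2 * (r * sg))"
      proof -
        have "r * \<gamma> * sqrt v \<le> r * \<gamma> * (2 * sg)" using r \<gamma> sv by (intro mult_left_mono) auto
        hence "r * \<gamma> \<le> \<gamma> / sqrt v * (2 * (r * sg))" using sv by (simp add: field_simps)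
        thus ?thesis using \<gamma> sv r sg by (simp add: ennreal_mult[symmetric] ennreal_leI)
      qed
      also have "\<dots> = (\<integral>\<^sup>+t. ennreal (\<gamma> / sqrt v) * indicator {bs j - r * sg..bs j + r * sg} t \<partial>lborel)"
        using r sg by (subst nn_integral_cmult_indicator) (auto simp: algebra_simps)
      also have "\<dots> \<le> (\<integral>\<^sup>+t. h v j t * ennreal (g (t / sqrt v) / sqrt v) \<partial>lborel)"
      proof (rule nn_integral_mono)
        fix t :: real
        show "ennreal (\<gamma> / sqrt v) * indicator {bs j - r * sg..bs j + r * sg} t \<le>
            h v j t * ennreal (g (t / sqrt v) / sqrt v)"
        proof (cases "\<bar>t - bs j\<bar> \<le> r * sg")
          case True
          \<comment> \<open>The variance window starts at the truth instead of being centred there: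
            a larger \<open>v\<close> only shrinks the standardised coefficient, which therefore
            remains in the range where \<open>g\<close> is at least \<gamma>.\<close>
          have "\<bar>t / sqrt v\<bar> \<le> \<bar>t\<bar> / sg" using sv sg by (simp add: frac_le)
          also have "\<dots> \<le> (\<bar>bs j\<bar> + r * sg) / sg" using True sg by (intro divide_right_mono) auto
          also have "\<dots> \<le> E" using bs[OF j] sg by (simp add: add_divide_distrib)
          finally have "\<gamma> \<le> g (t / sqrt v)" by (rule \<gamma>)
          hence "\<gamma> / sqrt v \<le> g (t / sqrt v) / sqrt v" using sv by (intro divide_right_mono) auto
          thus ?thesis using True \<open>bs j \<noteq> 0\<close> by (simp add: h_def abs_le_iff ennreal_leI indicator_def)
        next
          case False
          hence "t \<notin> {bs j - r * sg..bs j + r * sg}" by (auto simp: abs_le_iff)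
          thus ?thesis by simp
        qed
      qed
      finally show ?thesis using False by simp
    next
      case True
      have eq: "h v j t = indicator {x. \<bar>x\<bar> \<le> a} (t / sqrt v)" for t
        using True sv by (simp add: h_def indicator_def field_simps)
      have "(\<integral>\<^sup>+t. h v j t * ennreal (g (t / sqrt v) / sqrt v) \<partial>lborel) =
          (\<integral>\<^sup>+x. indicator {x. \<bar>x\<bar> \<le> a} x * ennreal (g x) \<partial>lborel)"
        unfolding eq using v0 by (intro nn_integral_scaled_density) measurable
      thus ?thesis using True density_interval_mass(2)[OF g \<tau>(1,2)] by simp
    qed
    have "ennreal ((r * \<gamma>) ^ card (supp p bs) * (1 - \<tau>) ^ p) \<le>
        ennreal (\<Prod>j<p. if bs j \<noteq> 0 then r * \<gamma> else 1 - \<tau>)"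
    proof (rule ennreal_leI)
      have "(\<Prod>j<p. if bs j \<noteq> 0 then r * \<gamma> else 1 - \<tau>) =
          (r * \<gamma>) ^ card (supp p bs) * (1 - \<tau>) ^ card ({..<p} \<inter> - {j. bs j \<noteq> 0})"
      proof -
        have "{..<p} \<inter> {j. bs j \<noteq> 0} = supp p bs" by (auto simp: supp_def)
        thus ?thesis by (simp add: prod.If_cases)
      qed
      moreover have "card ({..<p} \<inter> - {j. bs j \<noteq> 0}) \<le> p"
        using card_mono[of "{..<p}" "{..<p} \<inter> - {j. bs j \<noteq> 0}"] by simp
      hence "(1 - \<tau>) ^ p \<le> (1 - \<tau>) ^ card ({..<p} \<inter> - {j. bs j \<noteq> 0})"
        using \<tau> by (intro power_decreasing) auto
      ultimately show "(r * \<gamma>) ^ card (supp p bs) * (1 - \<tau>) ^ p \<le> (\<Prod>j<p. if bs j \<noteq> 0 then r * \<gamma> else 1 - \<tau>)"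
        using r \<gamma> by (simp add: mult_left_mono)
    qed
    also have "\<dots> = (\<Prod>j<p. ennreal (if bs j \<noteq> 0 then r * \<gamma> else 1 - \<tau>))"
      using r \<gamma> \<tau> by (intro prod_ennreal[symmetric]) auto
    also have "\<dots> \<le> (\<Prod>j<p. \<integral>\<^sup>+t. h v j t * ennreal (g (t / sqrt v) / sqrt v) \<partial>lborel)"
      by (intro prod_mono_ennreal fac) auto
    also have "\<dots> = (\<integral>\<^sup>+\<beta>. (\<Prod>j<p. h v j (\<beta> j)) * ennreal (coef_prior p g \<beta> v) \<partial>(\<Pi>\<^sub>M j\<in>{..<p}. lborel))"
      by (rule nn_integral_coef_prior[OF _ g' v0, symmetric]) (rule h_meas; simp)
    finally show ?thesis .
  qed
  let ?B = "(r * \<gamma>) ^ card (supp p bs) * (1 - \<tau>) ^ p"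
  have B0: "0 \<le> ?B" using r \<gamma> \<tau> by simp
  have "ennreal (cI * \<delta> * sg\<^sup>2 * ?B) = ennreal (cI * ?B) * emeasure lborel Iv"
    using ig \<delta> sg B0 by (simp add: Iv_def ennreal_mult[symmetric] algebra_simps)
  also have "\<dots> = (\<integral>\<^sup>+v. ennreal (cI * ?B) * indicator Iv v \<partial>lborel)"
    by (simp add: Iv_def nn_integral_cmult_indicator)
  also have "\<dots> \<le> (\<integral>\<^sup>+v. ennreal (inverse_gamma_density a0 b0 v) *
       (\<integral>\<^sup>+\<beta>. G (\<beta>, v) * ennreal (coef_prior p g \<beta> v) \<partial>(\<Pi>\<^sub>M j\<in>{..<p}. lborel)) \<partial>lborel)"
  proof (rule nn_integral_mono)
    fix v :: real
    show "ennreal (cI * ?B) * indicator Iv v \<le> ennreal (inverse_gamma_density a0 b0 v) *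
       (\<integral>\<^sup>+\<beta>. G (\<beta>, v) * ennreal (coef_prior p g \<beta> v) \<partial>(\<Pi>\<^sub>M j\<in>{..<p}. lborel))"
    proof (cases "v \<in> Iv")
      case True
      hence "v \<le> sg\<^sup>2 * (1 + \<delta>)" "sg\<^sup>2 \<le> v" by (auto simp: Iv_def)
      moreover have "sg\<^sup>2 * (1 + \<delta>) \<le> sg\<^sup>2 * 2" using \<delta> by (intro mult_left_mono) auto
      ultimately have "cI \<le> inverse_gamma_density a0 b0 v" by (intro ig) auto
      thus ?thesis using True inner[OF True] ig B0
        by (simp add: G_def ennreal_mult mult_mono ennreal_leI)
    qed simp
  qed
  also have "\<dots> = (\<integral>\<^sup>+\<theta>. G \<theta> * ennreal (prior_density p g a0 b0 \<theta>) \<partial>param_base p)"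
    by (rule nn_integral_prior[OF G_meas g' a0, symmetric])
  finally show ?thesis unfolding G_eq .
qed

section \<open>The linear model with a fixed design\<close>

lemma log_lr_measurable:
  assumes [measurable]: "\<rho> \<in> borel_measurable M" "Z \<in> borel_measurable M" "N \<in> borel_measurable M"
  shows "(\<lambda>x. log_lr c (\<rho> x) (Z x) (N x)) \<in> borel_measurable M"
  unfolding log_lr_def by measurable

text \<open>A fixed sample size. Randomness is carried by the noise \<open>e\<close>; the response
  is the function \<open>resp e\<close>, so that noise events translate directly into statements on
  the posterior.\<close>

locale gaussian_design =
  fixes n p :: nat and X :: "real mat" and \<beta>s :: "nat \<Rightarrow> real" and \<sigma>s :: real
  assumes X: "X \<in> carrier_mat n p"
    and X_bound: "\<And>i j. i < n \<Longrightarrow> j < p \<Longrightarrow> \<bar>X $$ (i, j)\<bar> \<le> 1"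
    and \<sigma>s: "0 < \<sigma>s" and n: "0 < n"
begin

definition fit :: "(nat \<Rightarrow> real) \<Rightarrow> nat \<Rightarrow> real" where
  "fit d i = (\<Sum>j<p. X $$ (i, j) * d j)"

definition dev :: "(nat \<Rightarrow> real) \<Rightarrow> nat \<Rightarrow> real" where
  "dev \<beta> j = (\<beta> j - \<beta>s j) / \<sigma>s"

definition resp :: "(nat \<Rightarrow> real) \<Rightarrow> nat \<Rightarrow> real" where
  "resp e = (\<lambda>i\<in>{..<n}. lin_pred X \<beta>s i + \<sigma>s * e i)"

text \<open>The likelihood at the true parameters. It is positive and free of the parameter
  \<theta>, hence cancels from the posterior.\<close>

definition lstar :: "(nat \<Rightarrow> real) \<Rightarrow> real" where
  "lstar e = inverse \<sigma>s ^ n * exp (- ip n e e / 2)"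

definition resid :: "(nat \<Rightarrow> real) \<Rightarrow> (nat \<Rightarrow> real) \<Rightarrow> nat \<Rightarrow> real" where
  "resid e \<beta> i = e i - fit (dev \<beta>) i"

definition log_ratio :: "(nat \<Rightarrow> real) \<Rightarrow> (nat \<Rightarrow> real) \<times> real \<Rightarrow> real" where
  "log_ratio e \<theta> = log_lr (real n) (sqrt (snd \<theta>) / \<sigma>s)
     (ip n (resid e (fst \<theta>)) (resid e (fst \<theta>))) (ip n e e)"

lemma lstar_pos: "0 < lstar e" using \<sigma>s by (simp add: lstar_def)

lemma lin_pred_eq: "i < n \<Longrightarrow> lin_pred X \<beta> i = (\<Sum>j<p. X $$ (i, j) * \<beta> j)"
  using X by (simp add: lin_pred_def scalar_prod_def atLeast0LessThan)

lemma resp_minus_lin_pred: "i < n \<Longrightarrow> resp e i - lin_pred X \<beta> i = \<sigma>s * resid e \<beta> i"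
proof -
  assume i: "i < n"
  have "\<sigma>s * fit (dev \<beta>) i = (\<Sum>j<p. X $$ (i, j) * \<beta> j) - (\<Sum>j<p. X $$ (i, j) * \<beta>s j)"
    using \<sigma>s unfolding fit_def dev_def sum_distrib_left sum_subtractf[symmetric]
    by (intro sum.cong refl) (simp add: field_simps)
  thus ?thesis using i by (simp add: resp_def resid_def lin_pred_eq right_diff_distrib)
qed

lemma likelihood_eq:
  assumes v: "0 < v"
  shows "likelihood X (resp e) \<beta> v = lstar e * exp (log_ratio e (\<beta>, v))"
proof -
  have dim: "dim_row X = n" using X by simp
  define Z where "Z = ip n (resid e \<beta>) (resid e \<beta>)"
  have "(l2_norm n (\<lambda>i. resp e i - lin_pred X \<beta> i))\<^sup>2 = (\<Sum>i<n. (resp e i - lin_pred X \<beta> i)\<^sup>2)"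
    unfolding l2_norm_def L2_set_def by (intro real_sqrt_pow2 sum_nonneg) simp
  also have "\<dots> = (\<Sum>i<n. (\<sigma>s * resid e \<beta> i)\<^sup>2)"
    by (intro sum.cong refl) (simp add: resp_minus_lin_pred)
  also have "\<dots> = \<sigma>s\<^sup>2 * Z"
    by (simp add: Z_def ip_def sum_distrib_left power2_eq_square mult_ac)
  finally have res: "(l2_norm n (\<lambda>i. resp e i - lin_pred X \<beta> i))\<^sup>2 = \<sigma>s\<^sup>2 * Z" .
  have "exp (- real n * ln (sqrt v / \<sigma>s)) = (\<sigma>s / sqrt v) ^ n"
  proof -
    have "- real n * ln (sqrt v / \<sigma>s) = real n * ln (\<sigma>s / sqrt v)"
      using v \<sigma>s by (simp add: ln_div algebra_simps)
    moreover have "exp (real n * ln (\<sigma>s / sqrt v)) = (\<sigma>s / sqrt v) ^ n"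
      using v \<sigma>s by (simp add: exp_of_nat_mult)
    ultimately show ?thesis by simp
  qed
  hence "inverse \<sigma>s ^ n * exp (- real n * ln (sqrt v / \<sigma>s)) = inverse (sqrt v) ^ n"
    using \<sigma>s by (simp add: power_mult_distrib[symmetric] divide_inverse mult.assoc[symmetric])
  moreover have "Z / (2 * (sqrt v / \<sigma>s)\<^sup>2) = \<sigma>s\<^sup>2 * Z / (2 * v)"
    using v \<sigma>s by (simp add: power_divide)
  hence "exp (log_ratio e (\<beta>, v)) = exp (- real n * ln (sqrt v / \<sigma>s)) * (exp (- (\<sigma>s\<^sup>2 * Z / (2 * v))) * exp (ip n e e / 2))"
    unfolding log_ratio_def log_lr_def Z_def[symmetric] fst_conv snd_conv exp_add[symmetric]
    by (simp add: Z_def)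
  ultimately have "lstar e * exp (log_ratio e (\<beta>, v)) =
      inverse (sqrt v) ^ n * exp (- (\<sigma>s\<^sup>2 * Z / (2 * v))) * (exp (- ip n e e / 2) * exp (ip n e e / 2))"
    by (simp add: lstar_def mult_ac)
  also have "exp (- ip n e e / 2) * exp (ip n e e / 2) = 1"
    by (simp add: exp_add[symmetric])
  finally show ?thesis unfolding likelihood_def dim res by simp
qed

lemma unnorm_posterior_eq:
  "unnorm_posterior g a0 b0 X (resp e) \<theta> =
     lstar e * (exp (log_ratio e \<theta>) * prior_density p g a0 b0 \<theta>)"
proof (cases "0 < snd \<theta>")
  case True
  have "dim_col X = p" using X by simp
  thus ?thesis using likelihood_eq[OF True, of e "fst \<theta>"]
    by (simp add: unnorm_posterior_def prior_density_def split_beta mult.assoc)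
next
  case False
  thus ?thesis by (simp add: unnorm_posterior_def prior_density_def split_beta inverse_gamma_density_def)
qed

text \<open>The ratio is the density of a normal law with mean \<open>fit (dev \<beta>)\<close> and
  standard deviation \<rho> relative to the noise law. It factorises over the observations, and each
  factor integrates to 1.\<close>

lemma expected_ratio:
  assumes v: "0 < v"
  shows "(\<integral>\<^sup>+e. ennreal (exp (log_ratio e (\<beta>, v))) \<partial>std_gaussian n) = 1"
proof -
  define \<rho> where "\<rho> = sqrt v / \<sigma>s"
  have \<rho>: "0 < \<rho>" using v \<sigma>s by (simp add: \<rho>_def)
  define m where "m i = fit (dev \<beta>) i" for i
  define f where "f i x = 1 / \<rho> * exp (- (x - m i)\<^sup>2 / (2 * \<rho>\<^sup>2) + x\<^sup>2 / 2)" for i x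
  have eq: "exp (log_ratio e (\<beta>, v)) = (\<Prod>i<n. f i (e i))" for e
  proof -
    have "(\<Prod>i<n. f i (e i)) = (1 / \<rho>) ^ n * exp (\<Sum>i<n. - (e i - m i)\<^sup>2 / (2 * \<rho>\<^sup>2) + (e i)\<^sup>2 / 2)"
      unfolding f_def by (simp add: prod.distrib exp_sum prod_dividef power_divide)
    also have "(\<Sum>i<n. - (e i - m i)\<^sup>2 / (2 * \<rho>\<^sup>2) + (e i)\<^sup>2 / 2) =
        - ip n (resid e \<beta>) (resid e \<beta>) / (2 * \<rho>\<^sup>2) + ip n e e / 2"
      by (simp add: ip_def resid_def m_def sum.distrib sum_subtractf sum_divide_distrib sum_negf power2_eq_square)
    also have "(1 / \<rho>) ^ n = exp (- real n * ln \<rho>)"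
    proof -
      have "exp (- real n * ln \<rho>) = exp (real n * ln (1 / \<rho>))" using \<rho> by (simp add: ln_div)
      thus ?thesis using \<rho> by (simp add: exp_of_nat_mult)
    qed
    finally show ?thesis
      by (simp add: log_ratio_def log_lr_def \<rho>_def exp_add[symmetric])
  qed
  have f_nonneg: "0 \<le> f i x" for i x using \<rho> by (simp add: f_def)
  have "(\<integral>\<^sup>+e. ennreal (exp (log_ratio e (\<beta>, v))) \<partial>std_gaussian n) =
      (\<integral>\<^sup>+e. (\<Prod>i<n. ennreal (f i (e i))) \<partial>std_gaussian n)"
    by (simp add: eq prod_ennreal f_nonneg)
  also have "\<dots> = (\<Prod>i<n. \<integral>\<^sup>+x. ennreal (std_normal_density x) * ennreal (f i x) \<partial>lborel)"
    by (rule nn_integral_std_gaussian_prod) (simp add: f_def)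
  also have "\<dots> = (\<Prod>i<n. \<integral>\<^sup>+x. ennreal (normal_density (m i) \<rho> x) \<partial>lborel)"
  proof (intro prod.cong refl nn_integral_cong)
    fix i x
    have "std_normal_density x * f i x = normal_density (m i) \<rho> x"
    proof -
      have "sqrt (2 * pi * \<rho>\<^sup>2) = sqrt (2 * pi) * \<rho>" using \<rho> by (simp add: real_sqrt_mult)
      moreover have "exp (- x\<^sup>2 / 2) * exp (- (x - m i)\<^sup>2 / (2 * \<rho>\<^sup>2) + x\<^sup>2 / 2) = exp (- (x - m i)\<^sup>2 / (2 * \<rho>\<^sup>2))"
        by (simp add: exp_add[symmetric])
      ultimately show ?thesis unfolding normal_density_def f_def by simp
    qed
    thus "ennreal (std_normal_density x) * ennreal (f i x) = ennreal (normal_density (m i) \<rho> x)"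
      by (simp add: ennreal_mult[symmetric] f_nonneg)
  qed
  also have "\<dots> = 1" using \<rho> by (simp add: nn_integral_normal_density)
  finally show ?thesis .
qed

lemma log_ratio_measurable_pair:
  "(\<lambda>z. log_ratio (fst z) (snd z)) \<in> borel_measurable (std_gaussian n \<Otimes>\<^sub>M param_base p)"
proof -
  let ?M = "std_gaussian n \<Otimes>\<^sub>M param_base p"
  have e: "(\<lambda>z. fst z i) \<in> borel_measurable ?M" if "i < n" for i
    using measurable_compose[OF measurable_fst measurable_gaussian_coord[OF that]] .
  have b: "(\<lambda>z. fst (snd z) j) \<in> borel_measurable ?M" if "j < p" for j
    using measurable_compose[OF measurable_snd param_coord_measurable(1)[OF that]] .
  have v: "(\<lambda>z. snd (snd z)) \<in> borel_measurable ?M"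
    using measurable_compose[OF measurable_snd param_coord_measurable(2)] .
  have "(\<lambda>z. resid (fst z) (fst (snd z)) i) \<in> borel_measurable ?M" if "i < n" for i
    unfolding resid_def fit_def dev_def using e[OF that] b
    by (intro borel_measurable_diff borel_measurable_sum borel_measurable_times borel_measurable_divide) auto
  thus ?thesis unfolding log_ratio_def using e v
    by (intro log_lr_measurable measurable_ip borel_measurable_divide borel_measurable_sqrt) auto
qed

lemma log_ratio_measurable: "log_ratio e \<in> borel_measurable (param_base p)"
proof -
  have "(\<lambda>\<theta>. resid e (fst \<theta>) i) \<in> borel_measurable (param_base p)" for i
    unfolding resid_def fit_def dev_def using param_coord_measurable(1)
    by (intro borel_measurable_diff borel_measurable_sum borel_measurable_times borel_measurable_divide) auto
  thus ?thesis unfolding log_ratio_def using param_coord_measurable(2)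
    by (intro log_lr_measurable measurable_ip borel_measurable_divide borel_measurable_sqrt) auto
qed

text \<open>Posterior mass of \<open>A\<close> before normalisation, with \<open>lstar e\<close>
  divided out. The choice \<open>A = UNIV\<close> gives the normalising constant on the same
  scale.\<close>

definition num :: "(real \<Rightarrow> real) \<Rightarrow> real \<Rightarrow> real \<Rightarrow> (nat \<Rightarrow> real) \<Rightarrow> ((nat \<Rightarrow> real) \<times> real) set \<Rightarrow> ennreal" where
  "num g a0 b0 e A = (\<integral>\<^sup>+\<theta>. indicator A \<theta> * ennreal (exp (log_ratio e \<theta>) * prior_density p g a0 b0 \<theta>) \<partial>param_base p)"

lemma posterior_prob_le:
  assumes g: "prob_density g" and a0: "0 < a0"
    and N: "num g a0 b0 e {\<theta>. Q (fst \<theta>)} \<le> ennreal x" "0 \<le> x"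
    and D: "ennreal y \<le> num g a0 b0 e UNIV" "0 < y"
  shows "posterior_prob g a0 b0 X (resp e) Q \<le> x / y"
proof -
  have g': "g \<in> borel_measurable borel" "\<forall>x. 0 \<le> g x" using g by (auto simp: prob_density_def)
  note [measurable] = prior_density_measurable[OF g'(1)] log_ratio_measurable
  have dim: "dim_col X = p" using X by simp
  define U where "U \<theta> = exp (log_ratio e \<theta>) * prior_density p g a0 b0 \<theta>" for \<theta>
  have U0: "0 \<le> U \<theta>" for \<theta> using prior_density_nonneg[OF g'(2) a0] by (simp add: U_def)
  have [measurable]: "U \<in> borel_measurable (param_base p)" unfolding U_def by measurable
  let ?Z = "\<integral>\<^sup>+\<theta>. ennreal (lstar e * U \<theta>) \<partial>param_base p"
  have un: "unnorm_posterior g a0 b0 X (resp e) \<theta> = lstar e * U \<theta>" for \<theta>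
    by (simp add: unnorm_posterior_eq U_def)
  let ?P = "density (param_base p) (\<lambda>\<theta>. ennreal (lstar e * U \<theta>) / ?Z)"
  have post: "posterior g a0 b0 X (resp e) = ?P"
    unfolding posterior_def dim un ..
  define A where "A = {\<theta> \<in> space ?P. Q (fst \<theta>)}"
  have Z: "?Z = ennreal (lstar e) * num g a0 b0 e UNIV"
    unfolding num_def U_def[symmetric] using lstar_pos[of e] U0
    by (subst nn_integral_cmult[symmetric]) (auto simp: ennreal_mult less_imp_le)
  have "measure ?P A \<le> x / y"
  proof (cases "A \<in> sets (param_base p)")
    case True
    note [measurable] = True
    have "emeasure ?P A = (\<integral>\<^sup>+\<theta>. ennreal (lstar e * U \<theta>) / ?Z * indicator A \<theta> \<partial>param_base p)"
      by (intro emeasure_density) measurable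
    also have "\<dots> = (\<integral>\<^sup>+\<theta>. (ennreal (lstar e) * (indicator A \<theta> * ennreal (U \<theta>))) / ?Z \<partial>param_base p)"
      using lstar_pos[of e] U0
      by (intro nn_integral_cong) (auto simp: ennreal_mult less_imp_le split: split_indicator)
    also have "\<dots> = (ennreal (lstar e) * (\<integral>\<^sup>+\<theta>. indicator A \<theta> * ennreal (U \<theta>) \<partial>param_base p)) / ?Z"
      by (subst nn_integral_divide) (measurable, subst nn_integral_cmult, measurable)
    also have "\<dots> \<le> ennreal ((lstar e * x) / (lstar e * y))"
    proof (rule ennreal_divide_le)
      have "(\<integral>\<^sup>+\<theta>. indicator A \<theta> * ennreal (U \<theta>) \<partial>param_base p) \<le> num g a0 b0 e {\<theta>. Q (fst \<theta>)}"
        unfolding num_def U_def[symmetric]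
        by (intro nn_integral_mono mult_right_mono) (auto simp: A_def split: split_indicator)
      also have "\<dots> \<le> ennreal x" by (rule N)
      finally show "ennreal (lstar e) * (\<integral>\<^sup>+\<theta>. indicator A \<theta> * ennreal (U \<theta>) \<partial>param_base p) \<le> ennreal (lstar e * x)"
        using lstar_pos[of e] N(2) by (simp add: ennreal_mult less_imp_le mult_left_mono)
      show "ennreal (lstar e * y) \<le> ?Z"
        unfolding Z using lstar_pos[of e] D by (simp add: ennreal_mult less_imp_le mult_left_mono)
    qed (use lstar_pos[of e] N D in auto)
    also have "(lstar e * x) / (lstar e * y) = x / y" using lstar_pos[of e] by simp
    finally show ?thesis unfolding measure_def
      using N D by (intro enn2real_leI) auto
  next
    \<comment> \<open>\<open>measure\<close> is 0 on nonmeasurable sets, so the bound needs no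
      measurability of the event \<open>Q\<close>.\<close>
    case False
    hence "measure ?P A = 0" by (intro measure_notin_sets) simp
    thus ?thesis using N D by simp
  qed
  thus ?thesis unfolding posterior_prob_def post A_def .
qed

text \<open>The likelihood ratio has expectation 1, so the expected numerator is the prior mass.\<close>

lemma num_tail:
  assumes g: "prob_density g" and a0: "0 < a0" and A: "A \<in> sets (param_base p)"
    and mass: "(\<integral>\<^sup>+\<theta>. indicator A \<theta> * ennreal (prior_density p g a0 b0 \<theta>) \<partial>param_base p) \<le> ennreal B"
    and B: "0 \<le> B" and x: "0 < x"
  shows "\<exists>G\<in>sets (std_gaussian n). measure (std_gaussian n) (space (std_gaussian n) - G) \<le> B / x \<and>
    (\<forall>e\<in>G. num g a0 b0 e A \<le> ennreal x)"
proof -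
  have g': "g \<in> borel_measurable borel" "\<forall>x. 0 \<le> g x" using g by (auto simp: prob_density_def)
  note [measurable] = prior_density_measurable[OF g'(1)] A log_ratio_measurable_pair
  interpret N: prob_space "std_gaussian n" by (rule prob_space_std_gaussian)
  interpret L: sigma_finite_measure "\<Pi>\<^sub>M j\<in>{..<p}. (lborel :: real measure)" by (rule sigma_finite_PiM_lborel)
  interpret LL: pair_sigma_finite "\<Pi>\<^sub>M j\<in>{..<p}. (lborel :: real measure)" "lborel :: real measure" ..
  interpret P: sigma_finite_measure "param_base p" unfolding param_base_def by (rule LL.sigma_finite_measure_axioms)
  interpret NP: pair_sigma_finite "std_gaussian n" "param_base p" ..
  define f where "f e \<theta> = indicator A \<theta> * ennreal (exp (log_ratio e \<theta>) * prior_density p g a0 b0 \<theta>)" for e \<theta>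
  have f_meas: "(\<lambda>z. f (fst z) (snd z)) \<in> borel_measurable (std_gaussian n \<Otimes>\<^sub>M param_base p)"
    unfolding f_def by measurable
  have num_eq: "num g a0 b0 e A = (\<integral>\<^sup>+\<theta>. f e \<theta> \<partial>param_base p)" for e
    by (simp add: num_def f_def)
  have num_meas [measurable]: "(\<lambda>e. num g a0 b0 e A) \<in> borel_measurable (std_gaussian n)"
    unfolding num_eq using P.borel_measurable_nn_integral_fst[OF f_meas] by simp
  have "(\<integral>\<^sup>+e. num g a0 b0 e A \<partial>std_gaussian n) = (\<integral>\<^sup>+\<theta>. \<integral>\<^sup>+e. f e \<theta> \<partial>std_gaussian n \<partial>param_base p)"
    unfolding num_eq using f_meas by (intro NP.Fubini'[symmetric]) (simp add: split_beta')
  also have "\<dots> = (\<integral>\<^sup>+\<theta>. indicator A \<theta> * ennreal (prior_density p g a0 b0 \<theta>) \<partial>param_base p)"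
  proof (rule nn_integral_cong)
    fix \<theta> assume \<theta>: "\<theta> \<in> space (param_base p)"
    have [measurable]: "(\<lambda>e. log_ratio e \<theta>) \<in> borel_measurable (std_gaussian n)"
      using measurable_compose[OF measurable_Pair2'[OF \<theta>] log_ratio_measurable_pair] by simp
    show "(\<integral>\<^sup>+e. f e \<theta> \<partial>std_gaussian n) = indicator A \<theta> * ennreal (prior_density p g a0 b0 \<theta>)"
    proof (cases "0 < snd \<theta>")
      case True
      have "f e \<theta> = indicator A \<theta> * ennreal (prior_density p g a0 b0 \<theta>) * ennreal (exp (log_ratio e \<theta>))" for e
        using prior_density_nonneg[OF g'(2) a0] by (simp add: f_def ennreal_mult mult_ac)
      thus ?thesis using expected_ratio[OF True, of "fst \<theta>"] by (simp add: nn_integral_cmult)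
    next
      case False
      thus ?thesis by (simp add: f_def prior_density_eq_0)
    qed
  qed
  finally have E: "(\<integral>\<^sup>+e. num g a0 b0 e A \<partial>std_gaussian n) \<le> ennreal B" using mass by simp
  define Bad where "Bad = {e \<in> space (std_gaussian n). 1 \<le> ennreal (1 / x) * num g a0 b0 e A}"
  have Bad [measurable]: "Bad \<in> sets (std_gaussian n)" unfolding Bad_def by measurable
  have "emeasure (std_gaussian n) Bad \<le>
      ennreal (1 / x) * (\<integral>\<^sup>+e. num g a0 b0 e A * indicator (space (std_gaussian n)) e \<partial>std_gaussian n)"
    unfolding Bad_def by (rule nn_integral_Markov_inequality) auto
  also have "(\<integral>\<^sup>+e. num g a0 b0 e A * indicator (space (std_gaussian n)) e \<partial>std_gaussian n) =
      (\<integral>\<^sup>+e. num g a0 b0 e A \<partial>std_gaussian n)"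
    by (intro nn_integral_cong) simp
  also have "ennreal (1 / x) * \<dots> \<le> ennreal (1 / x) * ennreal B"
    by (rule mult_left_mono[OF E]) simp
  also have "\<dots> = ennreal (B / x)" using B x by (simp add: ennreal_mult[symmetric])
  finally have "measure (std_gaussian n) Bad \<le> B / x"
    using B x by (simp add: N.emeasure_eq_measure)
  moreover have "space (std_gaussian n) - (space (std_gaussian n) - Bad) = Bad"
    by (auto simp: Bad_def)
  moreover have "num g a0 b0 e A \<le> ennreal x" if "e \<in> space (std_gaussian n) - Bad" for e
  proof (rule ccontr)
    assume "\<not> num g a0 b0 e A \<le> ennreal x"
    hence "ennreal (1 / x) * ennreal x \<le> ennreal (1 / x) * num g a0 b0 e A" by (intro mult_left_mono) auto
    hence "1 \<le> ennreal (1 / x) * num g a0 b0 e A" using x by (simp add: ennreal_mult[symmetric])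
    thus False using that by (simp add: Bad_def)
  qed
  ultimately show ?thesis by (intro bexI[of _ "space (std_gaussian n) - Bad"]) auto
qed

section \<open>Deterministic bounds on the likelihood ratio for given noise\<close>

lemma resid_square: "ip n (resid e \<beta>) (resid e \<beta>) =
    ip n e e - 2 * ip n e (fit (dev \<beta>)) + ip n (fit (dev \<beta>)) (fit (dev \<beta>))"
  by (simp add: resid_def ip_def sum_subtractf[symmetric] sum.distrib[symmetric] sum_distrib_left algebra_simps)

text \<open>The squared scale ratio lies between 1 and \<open>1 + \<delta>\<close>: the log
  determinant costs at most \<open>n * \<delta> / 2\<close>, and dividing the residual by a number
  at least 1 only helps. What remains is the change of the residual sum of squares.\<close>

lemma log_ratio_lower:
  assumes v: "\<sigma>s\<^sup>2 \<le> v" "v \<le> \<sigma>s\<^sup>2 * (1 + \<delta>)" and \<delta>: "0 \<le> \<delta>"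
    and B: "\<bar>ip n e (fit (dev \<beta>))\<bar> \<le> B" and R: "ip n (fit (dev \<beta>)) (fit (dev \<beta>)) \<le> R"
  shows "- real n * \<delta> / 2 - B - R / 2 \<le> log_ratio e (\<beta>, v)"
proof -
  define \<rho> where "\<rho> = sqrt v / \<sigma>s"
  define Z where "Z = ip n (resid e \<beta>) (resid e \<beta>)"
  have v0: "0 < v" using v \<sigma>s by (smt (verit) zero_less_power)
  hence \<rho>0: "0 < \<rho>" using \<sigma>s by (simp add: \<rho>_def)
  have \<rho>2: "\<rho>\<^sup>2 = v / \<sigma>s\<^sup>2" using v0 by (simp add: \<rho>_def power_divide)
  have \<rho>2b: "1 \<le> \<rho>\<^sup>2" "\<rho>\<^sup>2 \<le> 1 + \<delta>" unfolding \<rho>2 using v \<sigma>s by (auto simp: field_simps)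
  have "ln (\<rho>\<^sup>2) \<le> \<rho>\<^sup>2 - 1" using \<rho>0 by (intro ln_le_minus_one) simp
  moreover have "ln (\<rho>\<^sup>2) = 2 * ln \<rho>" using \<rho>0 by (simp add: ln_realpow)
  ultimately have "ln \<rho> \<le> \<delta> / 2" using \<rho>2b by linarith
  hence "real n * ln \<rho> \<le> real n * (\<delta> / 2)" by (intro mult_left_mono) auto
  moreover have "Z / (2 * \<rho>\<^sup>2) \<le> Z / 2"
    using \<rho>2b \<rho>0 by (intro divide_left_mono) (auto simp: Z_def)
  ultimately show ?thesis using resid_square[of e \<beta>] B R
    unfolding log_ratio_def log_lr_def fst_conv snd_conv \<rho>_def[symmetric] Z_def[symmetric] abs_le_iff
    by linarith
qed

text \<open>Hoelder duality between the l1 norm and the maximum. It handles the many tiny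
  coordinates, for which no sparsity is available.\<close>

lemma partial_fit_noise:
  assumes J: "J \<subseteq> {..<p}" and T: "\<And>j. j < p \<Longrightarrow> \<bar>ip n e (\<lambda>i. X $$ (i, j))\<bar> \<le> T"
  shows "\<bar>ip n e (\<lambda>i. \<Sum>j\<in>J. X $$ (i, j) * d j)\<bar> \<le> T * (\<Sum>j\<in>J. \<bar>d j\<bar>)"
proof -
  have "ip n e (\<lambda>i. \<Sum>j\<in>J. X $$ (i, j) * d j) = (\<Sum>i<n. \<Sum>j\<in>J. e i * X $$ (i, j) * d j)"
    by (simp add: ip_def sum_distrib_left mult.assoc)
  also have "\<dots> = (\<Sum>j\<in>J. \<Sum>i<n. e i * X $$ (i, j) * d j)" by (rule sum.swap)
  also have "\<dots> = (\<Sum>j\<in>J. ip n e (\<lambda>i. X $$ (i, j)) * d j)"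
    by (simp add: ip_def sum_distrib_right)
  also have "\<bar>\<dots>\<bar> \<le> (\<Sum>j\<in>J. \<bar>ip n e (\<lambda>i. X $$ (i, j)) * d j\<bar>)" by (rule sum_abs)
  also have "\<dots> \<le> (\<Sum>j\<in>J. T * \<bar>d j\<bar>)"
    using J T by (intro sum_mono) (auto simp: abs_mult intro!: mult_right_mono)
  finally show ?thesis by (simp add: sum_distrib_left)
qed

text \<open>Entries bounded by 1 bound every fitted value by the l1 norm of the coefficients. The
  boundedness condition on the design enters here.\<close>

lemma partial_fit_norm:
  assumes J: "J \<subseteq> {..<p}"
  shows "ip n (\<lambda>i. \<Sum>j\<in>J. X $$ (i, j) * d j) (\<lambda>i. \<Sum>j\<in>J. X $$ (i, j) * d j)
    \<le> real n * (\<Sum>j\<in>J. \<bar>d j\<bar>)\<^sup>2"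
proof -
  have "(\<Sum>j\<in>J. X $$ (i, j) * d j) * (\<Sum>j\<in>J. X $$ (i, j) * d j) \<le> (\<Sum>j\<in>J. \<bar>d j\<bar>)\<^sup>2" if i: "i < n" for i
  proof -
    have "\<bar>\<Sum>j\<in>J. X $$ (i, j) * d j\<bar> \<le> (\<Sum>j\<in>J. \<bar>X $$ (i, j) * d j\<bar>)" by (rule sum_abs)
    also have "\<dots> \<le> (\<Sum>j\<in>J. 1 * \<bar>d j\<bar>)"
      using J X_bound[OF i] unfolding abs_mult by (intro sum_mono mult_right_mono) auto
    finally have "\<bar>\<Sum>j\<in>J. X $$ (i, j) * d j\<bar> \<le> (\<Sum>j\<in>J. \<bar>d j\<bar>)" by simp
    from power_mono[OF this, of 2] show ?thesis by (simp add: power2_eq_square)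
  qed
  hence "ip n (\<lambda>i. \<Sum>j\<in>J. X $$ (i, j) * d j) (\<lambda>i. \<Sum>j\<in>J. X $$ (i, j) * d j) \<le> (\<Sum>i<n. (\<Sum>j\<in>J. \<bar>d j\<bar>)\<^sup>2)"
    unfolding ip_def by (intro sum_mono) auto
  thus ?thesis by simp
qed

text \<open>The part of the fit outside \<xi> is controlled only relative to \<rho>. Its correlation
  with the noise is of order \<open>L * \<rho>\<close> and its squared norm of order
  \<open>L * \<rho>\<^sup>2\<close>; since \<open>2 * \<rho> \<le> 1 + \<rho>\<^sup>2\<close>, both
  fit the error term that \<open>log_lr_upper\<close> tolerates.\<close>

lemma sparse_log_ratio_upper:
  assumes \<xi>: "\<xi> \<subseteq> {..<p}" and v: "0 < v"
    and T: "\<And>j. j < p \<Longrightarrow> \<bar>ip n e (\<lambda>i. X $$ (i, j))\<bar> \<le> T"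
    and A: "\<And>d. (ip n e (\<lambda>i. \<Sum>j\<in>\<xi>. X $$ (i, j) * d j))\<^sup>2 \<le>
        c2 * L * ip n (\<lambda>i. \<Sum>j\<in>\<xi>. X $$ (i, j) * d j) (\<lambda>i. \<Sum>j\<in>\<xi>. X $$ (i, j) * d j)"
    and out: "(\<Sum>j\<in>{..<p} - \<xi>. \<bar>dev \<beta> j\<bar>) \<le> \<eta> * (sqrt v / \<sigma>s)"
    and re: "\<And>d. \<kappa> * (\<Sum>j\<in>\<xi>. (d j)\<^sup>2) \<le> (\<Sum>i<n. (\<Sum>j\<in>\<xi>. X $$ (i, j) * d j)\<^sup>2)"
    and b: "T * \<eta> \<le> b * L" and r: "real n * \<eta>\<^sup>2 \<le> r * L"
    and nonneg: "0 \<le> T" "0 \<le> \<eta>" "0 \<le> b" "0 \<le> r" "0 \<le> c2" "0 < L"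
    and N: "\<bar>ip n e e - real n\<bar> \<le> 2 * sqrt (real n * L)"
    and c: "c = 4 * c2 + b + 4 * r"
    and small: "400 * L \<le> real n" "20 * c * L \<le> real n"
  shows "sqrt v / \<sigma>s \<le> 2 \<Longrightarrow>
      log_ratio e (\<beta>, v) \<le> (c + 8 + 2 * c\<^sup>2) * L - \<kappa> * (\<Sum>j\<in>\<xi>. (dev \<beta> j)\<^sup>2) / 16"
    and "2 \<le> sqrt v / \<sigma>s \<Longrightarrow> log_ratio e (\<beta>, v) \<le> - real n / 8"
proof -
  define \<rho> where "\<rho> = sqrt v / \<sigma>s"
  have \<rho>: "0 < \<rho>" using v \<sigma>s by (simp add: \<rho>_def)
  define w where "w i = (\<Sum>j\<in>\<xi>. X $$ (i, j) * dev \<beta> j)" for i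
  define r' where "r' i = (\<Sum>j\<in>{..<p} - \<xi>. X $$ (i, j) * dev \<beta> j)" for i
  define \<Omega> where "\<Omega> = (\<Sum>j\<in>{..<p} - \<xi>. \<bar>dev \<beta> j\<bar>)"
  have \<Omega>: "0 \<le> \<Omega>" "\<Omega> \<le> \<eta> * \<rho>" using out by (auto simp: \<Omega>_def \<rho>_def sum_nonneg)
  have fit_split: "fit (dev \<beta>) i = w i + r' i" for i
    unfolding fit_def w_def r'_def using \<xi> by (subst sum.subset_diff[of \<xi> "{..<p}"]) auto
  have resid_eq: "resid e \<beta> = (\<lambda>i. e i - (w i + r' i))"
    by (simp add: resid_def fit_split fun_eq_iff)
  have "\<bar>ip n e r'\<bar> \<le> T * \<Omega>"
    unfolding r'_def \<Omega>_def using T by (intro partial_fit_noise) auto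
  also have "\<dots> \<le> T * (\<eta> * \<rho>)" using \<Omega> nonneg by (intro mult_left_mono) auto
  also have "\<dots> \<le> b * L * \<rho>" using b \<rho> by (simp add: mult.assoc[symmetric])
  finally have er: "\<bar>ip n e r'\<bar> \<le> b * L * \<rho>" .
  have "ip n r' r' \<le> real n * \<Omega>\<^sup>2" unfolding r'_def \<Omega>_def by (intro partial_fit_norm) auto
  also have "\<dots> \<le> real n * (\<eta> * \<rho>)\<^sup>2" using \<Omega> by (intro mult_left_mono power_mono) auto
  also have "\<dots> \<le> r * L * \<rho>\<^sup>2"
    using mult_right_mono[OF r, of "\<rho>\<^sup>2"] by (simp add: power_mult_distrib mult.assoc)
  finally have rr: "ip n r' r' \<le> r * L * \<rho>\<^sup>2" .
  define W where "W = ip n w w"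
  have W: "\<kappa> * (\<Sum>j\<in>\<xi>. (dev \<beta> j)\<^sup>2) \<le> W" "0 \<le> W"
    using re[of "dev \<beta>"] by (auto simp: W_def w_def ip_def power2_eq_square sum_nonneg)
  have c0: "0 \<le> c" using nonneg by (simp add: c)
  have ew: "(ip n e w)\<^sup>2 \<le> c2 * L * ip n w w"
    using A[of "dev \<beta>"] by (simp add: w_def[abs_def])
  have "ip n e e + W / 2 - 4 * (c2 * L) - 2 * (b * L * \<rho>) - 4 * (r * L * \<rho>\<^sup>2) \<le> ip n (resid e \<beta>) (resid e \<beta>)"
    unfolding W_def resid_eq using nonneg
    by (intro residual_lower_bound er rr ew) auto
  moreover have "4 * (c2 * L) + 2 * (b * L * \<rho>) + 4 * (r * L * \<rho>\<^sup>2) \<le> c * L * (1 + \<rho>\<^sup>2)"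
  proof -
    have "2 * \<rho> \<le> 1 + \<rho>\<^sup>2" using sum_squares_ge_zero[of "\<rho> - 1" 0] by (simp add: power2_eq_square algebra_simps)
    hence "b * L * (2 * \<rho>) \<le> b * L * (1 + \<rho>\<^sup>2)" using nonneg by (intro mult_left_mono) auto
    moreover have "c2 * L * 1 \<le> c2 * L * (1 + \<rho>\<^sup>2)" using nonneg by (intro mult_left_mono) auto
    moreover have "r * L * \<rho>\<^sup>2 \<le> r * L * (1 + \<rho>\<^sup>2)" using nonneg by (intro mult_left_mono) auto
    ultimately show ?thesis unfolding c by (simp add: algebra_simps)
  qed
  ultimately have Z: "ip n e e + W / 2 - c * L * (1 + \<rho>\<^sup>2) \<le> ip n (resid e \<beta>) (resid e \<beta>)" by linarith
  have n0: "0 < real n" using n by simp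
  note up = log_lr_upper[OF n0 nonneg(6) \<rho> c0 W(2) Z N small]
  show "log_ratio e (\<beta>, v) \<le> (c + 8 + 2 * c\<^sup>2) * L - \<kappa> * (\<Sum>j\<in>\<xi>. (dev \<beta> j)\<^sup>2) / 16" if "sqrt v / \<sigma>s \<le> 2"
    using up(1) that W(1) unfolding log_ratio_def fst_conv snd_conv \<rho>_def[symmetric] by linarith
  show "log_ratio e (\<beta>, v) \<le> - real n / 8" if "2 \<le> sqrt v / \<sigma>s"
    using up(2) that unfolding log_ratio_def fst_conv snd_conv \<rho>_def[symmetric] by linarith
qed

text \<open>If at most \<open>m\<close> coordinates exceed \<open>a * sqrt v\<close>, then \<open>\<beta>\<close> is, up to \<open>a * sqrt v\<close> per coordinate,
  supported on these and the true support, where the restricted eigenvalue bound applies.\<close>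

lemma sparse_far_log_ratio:
  fixes m :: nat and a L c2 Ca C0 H :: real
  assumes v: "0 < v"
    and sparse: "card {j. j < p \<and> a * sqrt v < \<bar>\<beta> j\<bar>} \<le> m"
    and supp: "supp p \<beta>s \<noteq> {}" "card (supp p \<beta>s) + m \<le> k"
    and T: "\<And>j. j < p \<Longrightarrow> \<bar>ip n e (\<lambda>i. X $$ (i, j))\<bar> \<le> C0 * sqrt (L * real n)"
    and A: "\<And>\<xi> d. \<xi> \<subseteq> {..<p} \<Longrightarrow> \<xi> \<noteq> {} \<Longrightarrow> card \<xi> \<le> k \<Longrightarrow>
        (ip n e (\<lambda>i. \<Sum>j\<in>\<xi>. X $$ (i, j) * d j))\<^sup>2 \<le>
        c2 * L * ip n (\<lambda>i. \<Sum>j\<in>\<xi>. X $$ (i, j) * d j) (\<lambda>i. \<Sum>j\<in>\<xi>. X $$ (i, j) * d j)"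
    and re: "\<And>\<xi>. \<xi> \<subseteq> {..<p} \<Longrightarrow> \<xi> \<noteq> {} \<Longrightarrow> card \<xi> \<le> k \<Longrightarrow>
        real n * lam \<le> lambda_min (gram (cols_submatrix X \<xi>))"
    and a: "0 \<le> a" "real p * a \<le> Ca * sqrt (L / real n)"
    and nonneg: "0 \<le> C0" "0 \<le> Ca" "0 \<le> c2" "0 < L" "0 \<le> lam"
    and N: "\<bar>ip n e e - real n\<bar> \<le> 2 * sqrt (real n * L)"
    and c: "c = 4 * c2 + C0 * Ca + 4 * Ca\<^sup>2"
    and small: "400 * L \<le> real n" "20 * c * L \<le> real n" "8 * D * L \<le> real n"
    and H: "c + 8 + 2 * c\<^sup>2 + D \<le> lam * H / 16"
    and far: "\<And>\<xi>. \<xi> \<subseteq> {..<p} \<Longrightarrow> \<xi> \<noteq> {} \<Longrightarrow> card \<xi> \<le> k \<Longrightarrow> sqrt v / \<sigma>s \<le> 2 \<Longrightarrow>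
        (\<Sum>j\<in>{..<p} - \<xi>. \<bar>dev \<beta> j\<bar>) \<le> 2 * Ca * sqrt (L / real n) \<Longrightarrow>
        H * (L / real n) \<le> (\<Sum>j\<in>\<xi>. (dev \<beta> j)\<^sup>2)"
  shows "log_ratio e (\<beta>, v) \<le> - D * L"
proof -
  define \<rho> where "\<rho> = sqrt v / \<sigma>s"
  have \<rho>: "0 < \<rho>" using v \<sigma>s by (simp add: \<rho>_def)
  define \<xi> where "\<xi> = supp p \<beta>s \<union> {j. j < p \<and> a * sqrt v < \<bar>\<beta> j\<bar>}"
  have \<xi>: "\<xi> \<subseteq> {..<p}" "\<xi> \<noteq> {}" using supp by (auto simp: \<xi>_def supp_def)
  have "card \<xi> \<le> card (supp p \<beta>s) + card {j. j < p \<and> a * sqrt v < \<bar>\<beta> j\<bar>}"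
    unfolding \<xi>_def by (rule card_Un_le)
  hence \<xi>k: "card \<xi> \<le> k" using sparse supp by linarith
  define q where "q = sqrt (L / real n)"
  have n0: "0 < real n" using n by simp
  have q: "0 \<le> q" "q\<^sup>2 = L / real n" using nonneg n0 by (auto simp: q_def)
  have "(\<Sum>j\<in>{..<p} - \<xi>. \<bar>dev \<beta> j\<bar>) \<le> (\<Sum>j\<in>{..<p} - \<xi>. a * \<rho>)"
  proof (rule sum_mono)
    fix j assume "j \<in> {..<p} - \<xi>"
    hence "\<beta>s j = 0" "\<bar>\<beta> j\<bar> \<le> a * sqrt v" by (auto simp: \<xi>_def supp_def)
    thus "\<bar>dev \<beta> j\<bar> \<le> a * \<rho>" using \<sigma>s by (simp add: dev_def \<rho>_def divide_right_mono)
  qed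
  also have "\<dots> \<le> real p * a * \<rho>"
  proof -
    have "card ({..<p} - \<xi>) \<le> p" using card_mono[of "{..<p}" "{..<p} - \<xi>"] by simp
    thus ?thesis using a \<rho> by (simp add: mult.assoc mult_right_mono)
  qed
  also have "\<dots> \<le> Ca * q * \<rho>" using a \<rho> by (intro mult_right_mono) (auto simp: q_def)
  finally have out: "(\<Sum>j\<in>{..<p} - \<xi>. \<bar>dev \<beta> j\<bar>) \<le> Ca * q * \<rho>" .
  have sqn: "sqrt (L * real n) = real n * q"
    using n0 nonneg by (simp add: q_def real_sqrt_mult real_sqrt_divide field_simps)
  have TT: "C0 * sqrt (L * real n) * (Ca * q) \<le> C0 * Ca * L"
    using n0 q unfolding sqn by (simp add: power2_eq_square field_simps)
  have RR: "real n * (Ca * q)\<^sup>2 \<le> Ca\<^sup>2 * L"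
    using n0 q by (simp add: power_mult_distrib)
  have RE: "real n * lam * (\<Sum>j\<in>\<xi>. (d j)\<^sup>2) \<le> (\<Sum>i<n. (\<Sum>j\<in>\<xi>. X $$ (i, j) * d j)\<^sup>2)" for d
  proof -
    have "real n * lam * (\<Sum>j\<in>\<xi>. (d j)\<^sup>2) \<le> lambda_min (gram (cols_submatrix X \<xi>)) * (\<Sum>j\<in>\<xi>. (d j)\<^sup>2)"
      by (intro mult_right_mono re \<xi> \<xi>k sum_nonneg) simp
    also have "\<dots> \<le> (\<Sum>i<n. (\<Sum>j\<in>\<xi>. X $$ (i, j) * d j)\<^sup>2)"
      by (rule restricted_eigenvalue[OF X \<xi>])
    finally show ?thesis .
  qed
  have nn: "0 \<le> C0 * sqrt (L * real n)" "0 \<le> Ca * q" "0 \<le> C0 * Ca" "0 \<le> Ca\<^sup>2"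
    using nonneg q by auto
  note up = sparse_log_ratio_upper[OF \<xi>(1) v T A[OF \<xi> \<xi>k] out[unfolded \<rho>_def] RE TT RR nn nonneg(3,4) N c small(1,2)]
  show ?thesis
  \<comment> \<open>Only for \<rho> at most 2 is the distance to the truth used, since there the
    remainder outside \<xi> has a bound free of \<rho>. Otherwise the scale alone yields
    \<open>- n / 8\<close>.\<close>
  proof (cases "\<rho> \<le> 2")
    case True
    have "(\<Sum>j\<in>{..<p} - \<xi>. \<bar>dev \<beta> j\<bar>) \<le> 2 * Ca * sqrt (L / real n)"
      using out mult_left_mono[OF True nn(2)] by (simp add: q_def)
    hence "H * (L / real n) \<le> (\<Sum>j\<in>\<xi>. (dev \<beta> j)\<^sup>2)"
      using True by (intro far \<xi> \<xi>k) (auto simp: \<rho>_def)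
    hence "real n * lam * (H * (L / real n)) \<le> real n * lam * (\<Sum>j\<in>\<xi>. (dev \<beta> j)\<^sup>2)"
      using nonneg by (intro mult_left_mono) auto
    hence "lam * H * L \<le> real n * lam * (\<Sum>j\<in>\<xi>. (dev \<beta> j)\<^sup>2)" using n0 by simp
    moreover have "(c + 8 + 2 * c\<^sup>2 + D) * L \<le> lam * H / 16 * L"
      using H nonneg by (intro mult_right_mono) auto
    moreover have "log_ratio e (\<beta>, v) \<le> (c + 8 + 2 * c\<^sup>2) * L - real n * lam * (\<Sum>j\<in>\<xi>. (dev \<beta> j)\<^sup>2) / 16"
      using up(1) True by (simp add: \<rho>_def)
    ultimately show ?thesis by (simp add: algebra_simps)
  next
    case False
    hence "log_ratio e (\<beta>, v) \<le> - real n / 8" using up(2) by (simp add: \<rho>_def)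
    thus ?thesis using small by simp
  qed
qed

text \<open>The l2 norm outside \<xi> is at most the l1 norm there, which is of the order of the
  target radius; a larger total distance must come from \<xi>.\<close>

lemma far_l2:
  assumes \<xi>: "\<xi> \<subseteq> {..<p}"
    and far: "K * \<sigma>s * q \<le> l2_norm p (\<lambda>j. \<beta> j - \<beta>s j)"
    and out: "(\<Sum>j\<in>{..<p} - \<xi>. \<bar>dev \<beta> j\<bar>) \<le> 2 * Ca * q"
    and q: "0 \<le> q" and K: "0 \<le> K"
  shows "(K\<^sup>2 - 4 * Ca\<^sup>2) * q\<^sup>2 \<le> (\<Sum>j\<in>\<xi>. (dev \<beta> j)\<^sup>2)"
proof -
  have "(K * \<sigma>s * q)\<^sup>2 \<le> (l2_norm p (\<lambda>j. \<beta> j - \<beta>s j))\<^sup>2"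
    using far K q \<sigma>s by (intro power_mono) auto
  also have "\<dots> = (\<Sum>j<p. (\<beta> j - \<beta>s j)\<^sup>2)"
    unfolding l2_norm_def L2_set_def by (intro real_sqrt_pow2 sum_nonneg) simp
  also have "\<dots> = \<sigma>s\<^sup>2 * (\<Sum>j<p. (dev \<beta> j)\<^sup>2)"
    using \<sigma>s by (simp add: dev_def power_divide sum_distrib_left)
  finally have "K\<^sup>2 * q\<^sup>2 \<le> (\<Sum>j<p. (dev \<beta> j)\<^sup>2)"
    using \<sigma>s by (simp add: power_mult_distrib algebra_simps)
  also have "\<dots> = (\<Sum>j\<in>{..<p} - \<xi>. (dev \<beta> j)\<^sup>2) + (\<Sum>j\<in>\<xi>. (dev \<beta> j)\<^sup>2)"
    using \<xi> by (intro sum.subset_diff) auto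
  also have "(\<Sum>j\<in>{..<p} - \<xi>. (dev \<beta> j)\<^sup>2) \<le> (\<Sum>j\<in>{..<p} - \<xi>. \<bar>dev \<beta> j\<bar>)\<^sup>2"
    using L2_set_le_sum_abs[of "dev \<beta>" "{..<p} - \<xi>"] power_mono[OF L2_set_le_sum_abs[of "dev \<beta>" "{..<p} - \<xi>"], of 2]
    by (simp add: L2_set_def sum_nonneg)
  also have "\<dots> \<le> (2 * Ca * q)\<^sup>2" using out by (intro power_mono) (auto simp: sum_nonneg)
  finally show ?thesis by (simp add: power_mult_distrib algebra_simps)
qed

text \<open>Cauchy-Schwarz on \<xi> converts l1 to l2 at the price of the root of its cardinality,
  at most \<open>sqrt (\<kappa> * s)\<close>. This is the source of the factor \<open>sqrt s\<close>
  in the l1 rate.\<close>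

lemma far_l1:
  assumes \<xi>: "\<xi> \<subseteq> {..<p}" and card: "real (card \<xi>) \<le> \<kappa> * real s" "1 \<le> s" "0 < \<kappa>"
    and far: "K * sqrt (real s) * q * \<sigma>s \<le> l1_norm p (\<lambda>j. \<beta> j - \<beta>s j)"
    and out: "(\<Sum>j\<in>{..<p} - \<xi>. \<bar>dev \<beta> j\<bar>) \<le> 2 * Ca * q"
    and q: "0 \<le> q" and K: "2 * Ca \<le> K" "0 \<le> Ca"
  shows "(K - 2 * Ca)\<^sup>2 / \<kappa> * q\<^sup>2 \<le> (\<Sum>j\<in>\<xi>. (dev \<beta> j)\<^sup>2)"
proof -
  define V where "V = (\<Sum>j\<in>\<xi>. (dev \<beta> j)\<^sup>2)"
  have V: "0 \<le> V" by (simp add: V_def sum_nonneg)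
  have s1: "1 \<le> sqrt (real s)" using card by simp
  have "l1_norm p (\<lambda>j. \<beta> j - \<beta>s j) = \<sigma>s * (\<Sum>j<p. \<bar>dev \<beta> j\<bar>)"
    using \<sigma>s by (simp add: l1_norm_def dev_def sum_distrib_left)
  hence "\<sigma>s * (K * sqrt (real s) * q) \<le> \<sigma>s * (\<Sum>j<p. \<bar>dev \<beta> j\<bar>)"
    using far by (simp add: mult_ac)
  hence "K * sqrt (real s) * q \<le> (\<Sum>j<p. \<bar>dev \<beta> j\<bar>)" using \<sigma>s by simp
  also have "\<dots> = (\<Sum>j\<in>{..<p} - \<xi>. \<bar>dev \<beta> j\<bar>) + (\<Sum>j\<in>\<xi>. \<bar>dev \<beta> j\<bar>)"
    using \<xi> by (intro sum.subset_diff) auto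
  also have "(\<Sum>j\<in>\<xi>. \<bar>dev \<beta> j\<bar>) \<le> sqrt (real (card \<xi>)) * sqrt V"
    using L2_set_mult_ineq[of "\<lambda>_. 1" "dev \<beta>" \<xi>] by (simp add: L2_set_def V_def)
  also have "\<dots> \<le> sqrt (\<kappa> * real s) * sqrt V" using card V by (intro mult_right_mono) auto
  finally have "K * sqrt (real s) * q \<le> 2 * Ca * q + sqrt \<kappa> * sqrt V * sqrt (real s)"
    using out by (simp add: real_sqrt_mult mult_ac)
  moreover have "2 * Ca * q * 1 \<le> 2 * Ca * q * sqrt (real s)"
    using s1 q K by (intro mult_left_mono) auto
  ultimately have "sqrt (real s) * ((K - 2 * Ca) * q) \<le> sqrt (real s) * (sqrt \<kappa> * sqrt V)"
    by (simp add: algebra_simps)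
  hence "(K - 2 * Ca) * q \<le> sqrt \<kappa> * sqrt V" using s1 by simp
  from power_mono[OF this, of 2] have "(K - 2 * Ca)\<^sup>2 * q\<^sup>2 \<le> \<kappa> * V"
    using q K card V by (simp add: power_mult_distrib)
  thus ?thesis using card by (simp add: V_def field_simps)
qed

text \<open>Restrict the integral to a neighbourhood \<open>S\<close> of the truth. Its variance
  window of relative width \<open>L / n\<close> costs \<open>L / 2\<close>. Its l1 radius is at most
  \<open>(1 + 2 * Ca) * sqrt (L / n)\<close>: \<open>s / n\<close> from the support and
  \<open>2 * p * a\<close> from elsewhere. The last two terms of \<open>C1\<close> are the resulting
  noise correlation and half squared norm of the fit.\<close>

lemma num_UNIV_lower:
  fixes a L Ca C0 :: real
  assumes g: "prob_density g" and a0: "0 < a0"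
    and ig: "\<And>v. \<sigma>s\<^sup>2 \<le> v \<Longrightarrow> v \<le> 2 * \<sigma>s\<^sup>2 \<Longrightarrow> cI \<le> inverse_gamma_density a0 b0 v" "0 < cI"
    and L: "0 < L" "L \<le> real n"
    and \<gamma>: "\<And>x. \<bar>x\<bar> \<le> E \<Longrightarrow> \<gamma> \<le> g x" "0 < \<gamma>"
    and bs: "\<And>j. j < p \<Longrightarrow> \<bar>\<beta>s j\<bar> / \<sigma>s + 1 / real n \<le> E"
    and \<tau>: "1 - (LBINT x:{- a..a}. g x) \<le> \<tau>" "0 \<le> \<tau>" "\<tau> \<le> 1"
    and T: "\<And>j. j < p \<Longrightarrow> \<bar>ip n e (\<lambda>i. X $$ (i, j))\<bar> \<le> C0 * sqrt (L * real n)"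
    and a: "0 \<le> a" "real p * a \<le> Ca * sqrt (L / real n)"
    and s: "real (card (supp p \<beta>s)) / real n \<le> sqrt (L / real n)"
    and nonneg: "0 \<le> C0" "0 \<le> Ca"
    and C1: "C1 = 1 / 2 + C0 * (1 + 2 * Ca) + (1 + 2 * Ca)\<^sup>2 / 2"
    and mass: "mass = cI * (L / real n) * \<sigma>s\<^sup>2 * ((1 / real n * \<gamma>) ^ card (supp p \<beta>s) * (1 - \<tau>) ^ p)"
  shows "ennreal (exp (- C1 * L) * mass) \<le> num g a0 b0 e UNIV"
proof -
  have g': "g \<in> borel_measurable borel" "\<forall>x. 0 \<le> g x" using g by (auto simp: prob_density_def)
  have n0: "0 < real n" using n by simp
  define q where "q = sqrt (L / real n)"
  have q: "0 \<le> q" "q\<^sup>2 = L / real n" using L n0 by (auto simp: q_def)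
  have sqn: "sqrt (L * real n) = real n * q"
    using n0 L by (simp add: q_def real_sqrt_mult real_sqrt_divide field_simps)
  define S where "S = {\<theta>. \<sigma>s\<^sup>2 \<le> snd \<theta> \<and> snd \<theta> \<le> \<sigma>s\<^sup>2 * (1 + L / real n) \<and>
        (\<forall>j<p. if \<beta>s j \<noteq> 0 then \<bar>fst \<theta> j - \<beta>s j\<bar> \<le> 1 / real n * \<sigma>s else \<bar>fst \<theta> j\<bar> \<le> a * sqrt (snd \<theta>))}"
  have mass_le: "ennreal mass \<le> (\<integral>\<^sup>+\<theta>. indicator S \<theta> * ennreal (prior_density p g a0 b0 \<theta>) \<partial>param_base p)"
    unfolding mass using L n0
    by (intro prior_mass_lower[OF g a0 \<sigma>s ig _ _ _ \<gamma> bs \<tau> S_def]) auto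
  have lower: "- C1 * L \<le> log_ratio e \<theta>" if \<theta>: "\<theta> \<in> S" for \<theta>
  proof -
    obtain \<beta> v where bv: "\<theta> = (\<beta>, v)" by (cases \<theta>)
    have v: "\<sigma>s\<^sup>2 \<le> v" "v \<le> \<sigma>s\<^sup>2 * (1 + L / real n)"
      and on: "\<And>j. j < p \<Longrightarrow> \<beta>s j \<noteq> 0 \<Longrightarrow> \<bar>\<beta> j - \<beta>s j\<bar> \<le> 1 / real n * \<sigma>s"
      and off: "\<And>j. j < p \<Longrightarrow> \<beta>s j = 0 \<Longrightarrow> \<bar>\<beta> j\<bar> \<le> a * sqrt v"
      using \<theta> unfolding S_def bv by (auto split: if_splits)
    have "L / real n \<le> 1" using L n0 by simp
    hence "\<sigma>s\<^sup>2 * (1 + L / real n) \<le> \<sigma>s\<^sup>2 * 4" by (intro mult_left_mono) auto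
    hence "sqrt v \<le> sqrt (\<sigma>s\<^sup>2 * 4)" using v by (intro real_sqrt_le_mono) linarith
    hence sv: "sqrt v \<le> 2 * \<sigma>s" using \<sigma>s by (simp add: real_sqrt_mult)
    have "(\<Sum>j<p. \<bar>dev \<beta> j\<bar>) \<le> (\<Sum>j<p. (if \<beta>s j \<noteq> 0 then 1 / real n else 0) + 2 * a)"
    proof (rule sum_mono)
      fix j assume "j \<in> {..<p}"
      hence j: "j < p" by simp
      show "\<bar>dev \<beta> j\<bar> \<le> (if \<beta>s j \<noteq> 0 then 1 / real n else 0) + 2 * a"
      proof (cases "\<beta>s j = 0")
        case True
        have "\<bar>\<beta> j\<bar> \<le> a * (2 * \<sigma>s)" using off[OF j True] mult_left_mono[OF sv a(1)] by linarith
        thus ?thesis using True \<sigma>s by (simp add: dev_def field_simps)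
      next
        case False
        have "\<bar>dev \<beta> j\<bar> \<le> 1 / real n"
          using on[OF j False] \<sigma>s by (simp add: dev_def field_simps)
        thus ?thesis using False a by simp
      qed
    qed
    also have "\<dots> = real (card (supp p \<beta>s)) / real n + 2 * (real p * a)"
    proof -
      have "(\<Sum>j<p. if \<beta>s j \<noteq> 0 then 1 / real n else 0) = real (card (supp p \<beta>s)) / real n"
        by (simp add: sum.If_cases supp_def Int_def)
      thus ?thesis by (simp add: sum.distrib)
    qed
    also have "\<dots> \<le> q + 2 * (Ca * q)" using s a unfolding q_def by linarith
    finally have l1: "(\<Sum>j<p. \<bar>dev \<beta> j\<bar>) \<le> (1 + 2 * Ca) * q" by (simp add: algebra_simps)
    have "\<bar>ip n e (fit (dev \<beta>))\<bar> \<le> C0 * sqrt (L * real n) * (\<Sum>j<p. \<bar>dev \<beta> j\<bar>)"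
      using partial_fit_noise[of "{..<p}" e _ "dev \<beta>", OF _ T] by (simp add: fit_def[abs_def])
    also have "\<dots> \<le> C0 * sqrt (L * real n) * ((1 + 2 * Ca) * q)"
      using nonneg L by (intro mult_left_mono l1) auto
    also have "\<dots> = C0 * (1 + 2 * Ca) * L"
    proof -
      have "real n * q * q = L" using q n0 by (simp add: mult.assoc power2_eq_square[symmetric])
      moreover have "C0 * (real n * q) * ((1 + 2 * Ca) * q) = C0 * (1 + 2 * Ca) * (real n * q * q)"
        by (simp add: algebra_simps)
      ultimately show ?thesis unfolding sqn by simp
    qed
    finally have B: "\<bar>ip n e (fit (dev \<beta>))\<bar> \<le> C0 * (1 + 2 * Ca) * L" .
    have "ip n (fit (dev \<beta>)) (fit (dev \<beta>)) \<le> real n * (\<Sum>j<p. \<bar>dev \<beta> j\<bar>)\<^sup>2"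
      using partial_fit_norm[of "{..<p}" "dev \<beta>"] by (simp add: fit_def[abs_def])
    also have "\<dots> \<le> real n * ((1 + 2 * Ca) * q)\<^sup>2"
      using l1 by (intro mult_left_mono power_mono) (auto simp: sum_nonneg)
    also have "\<dots> = (1 + 2 * Ca)\<^sup>2 * L" using q n0 by (simp add: power_mult_distrib)
    finally have R: "ip n (fit (dev \<beta>)) (fit (dev \<beta>)) \<le> (1 + 2 * Ca)\<^sup>2 * L" .
    have "- real n * (L / real n) / 2 - C0 * (1 + 2 * Ca) * L - (1 + 2 * Ca)\<^sup>2 * L / 2 \<le> log_ratio e (\<beta>, v)"
      using v L n0 by (intro log_ratio_lower B R) auto
    moreover have "- real n * (L / real n) / 2 - C0 * (1 + 2 * Ca) * L - (1 + 2 * Ca)\<^sup>2 * L / 2 = - C1 * L"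
      unfolding C1 using n0 by (simp add: algebra_simps)
    ultimately show ?thesis by (simp add: bv)
  qed
  note [measurable] = prior_density_measurable[OF g'(1)] log_ratio_measurable
  note mass_le
  also have "(\<integral>\<^sup>+\<theta>. indicator S \<theta> * ennreal (prior_density p g a0 b0 \<theta>) \<partial>param_base p) \<le>
      (\<integral>\<^sup>+\<theta>. ennreal (exp (C1 * L)) * (indicator UNIV \<theta> * ennreal (exp (log_ratio e \<theta>) * prior_density p g a0 b0 \<theta>)) \<partial>param_base p)"
  proof (rule nn_integral_mono)
    fix \<theta>
    note nn = prior_density_nonneg[OF g'(2) a0, of p b0 \<theta>]
    show "indicator S \<theta> * ennreal (prior_density p g a0 b0 \<theta>) \<le>
        ennreal (exp (C1 * L)) * (indicator UNIV \<theta> * ennreal (exp (log_ratio e \<theta>) * prior_density p g a0 b0 \<theta>))"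
    proof (cases "\<theta> \<in> S")
      case True
      have "1 * prior_density p g a0 b0 \<theta> \<le> exp (C1 * L + log_ratio e \<theta>) * prior_density p g a0 b0 \<theta>"
        using lower[OF True] nn by (intro mult_right_mono) auto
      thus ?thesis using True nn by (simp add: exp_add mult.assoc ennreal_mult[symmetric] ennreal_leI)
    qed simp
  qed
  also have "\<dots> = ennreal (exp (C1 * L)) * num g a0 b0 e UNIV"
    unfolding num_def by (rule nn_integral_cmult) measurable
  finally have "ennreal (exp (- C1 * L)) * ennreal mass \<le>
      ennreal (exp (- C1 * L)) * (ennreal (exp (C1 * L)) * num g a0 b0 e UNIV)"
    by (rule mult_left_mono) simp
  thus ?thesis
    by (simp add: ennreal_mult' mult.assoc[symmetric] ennreal_mult[symmetric] exp_add[symmetric])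
qed

text \<open>The condition \<open>0 < snd \<theta>\<close> discards parameters of prior density 0,
  where \<open>sqrt (snd \<theta>)\<close> would not be a standard deviation.\<close>

definition dense :: "real \<Rightarrow> nat \<Rightarrow> ((nat \<Rightarrow> real) \<times> real) set" where
  "dense a m = {\<theta>. 0 < snd \<theta> \<and> m \<le> card {j. j < p \<and> a * sqrt (snd \<theta>) < \<bar>fst \<theta> j\<bar>}}"

lemma dense_indicator_measurable:
  "(\<lambda>\<theta>. indicator (dense a m) \<theta> :: ennreal) \<in> borel_measurable (param_base p)"
proof -
  have [measurable]: "(\<lambda>\<theta>. fst \<theta> j) \<in> borel_measurable (param_base p)" if "j < p" for j
    using that by (rule param_coord_measurable)
  have [measurable]: "snd \<in> borel_measurable (param_base p)" by (rule param_coord_measurable)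
  define f where "f \<theta> = (\<Sum>j<p. indicator {0::real<..} (\<bar>fst \<theta> j\<bar> - a * sqrt (snd \<theta>)) :: real)"
    for \<theta> :: "(nat \<Rightarrow> real) \<times> real"
  have card: "real (card {j. j < p \<and> a * sqrt (snd \<theta>) < \<bar>fst \<theta> j\<bar>}) = f \<theta>" for \<theta>
  proof -
    have "f \<theta> = (\<Sum>j<p. if a * sqrt (snd \<theta>) < \<bar>fst \<theta> j\<bar> then 1 else 0)"
      unfolding f_def by (intro sum.cong refl) (simp add: indicator_def)
    thus ?thesis by (simp add: sum.If_cases Int_def)
  qed
  have [measurable]: "f \<in> borel_measurable (param_base p)" unfolding f_def by measurable
  have "(\<lambda>\<theta>. indicator (dense a m) \<theta> :: ennreal) = (\<lambda>\<theta>. indicator {0<..} (snd \<theta>) * indicator {real m..} (f \<theta>))"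
    by (auto simp: dense_def card[symmetric] indicator_def fun_eq_iff)
  also have "\<dots> \<in> borel_measurable (param_base p)" by measurable
  finally show ?thesis .
qed

text \<open>Outside \<open>dense a m\<close> the likelihood ratio is uniformly small on the event,
  so that part is at most this value times the total prior mass. The dense part has its own
  bound.\<close>

lemma num_upper:
  assumes g: "prob_density g" and a0: "0 < a0"
    and CI: "(\<integral>\<^sup>+v. ennreal (inverse_gamma_density a0 b0 v) \<partial>lborel) \<le> ennreal CI" "0 \<le> CI"
    and dense: "num g a0 b0 e (dense a m) \<le> ennreal x" "0 \<le> x"
    and far: "\<And>\<beta> v. 0 < v \<Longrightarrow> Q \<beta> \<Longrightarrow> card {j. j < p \<and> a * sqrt v < \<bar>\<beta> j\<bar>} \<le> m \<Longrightarrow> log_ratio e (\<beta>, v) \<le> - l"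
  shows "num g a0 b0 e {\<theta>. Q (fst \<theta>)} \<le> ennreal (x + exp (- l) * CI)"
proof -
  have g': "g \<in> borel_measurable borel" "\<forall>x. 0 \<le> g x" using g by (auto simp: prob_density_def)
  note [measurable] = prior_density_measurable[OF g'(1)] log_ratio_measurable dense_indicator_measurable
  have "num g a0 b0 e {\<theta>. Q (fst \<theta>)} \<le>
      (\<integral>\<^sup>+\<theta>. indicator (dense a m) \<theta> * ennreal (exp (log_ratio e \<theta>) * prior_density p g a0 b0 \<theta>) +
        ennreal (exp (- l)) * ennreal (prior_density p g a0 b0 \<theta>) \<partial>param_base p)"
    unfolding num_def
  proof (rule nn_integral_mono)
    fix \<theta>
    note nn = prior_density_nonneg[OF g'(2) a0, of p b0 \<theta>]
    show "indicator {\<theta>. Q (fst \<theta>)} \<theta> * ennreal (exp (log_ratio e \<theta>) * prior_density p g a0 b0 \<theta>) \<le>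
        indicator (dense a m) \<theta> * ennreal (exp (log_ratio e \<theta>) * prior_density p g a0 b0 \<theta>) +
        ennreal (exp (- l)) * ennreal (prior_density p g a0 b0 \<theta>)"
    proof (cases "Q (fst \<theta>) \<and> \<theta> \<notin> dense a m \<and> 0 < snd \<theta>")
      case True
      hence "log_ratio e (fst \<theta>, snd \<theta>) \<le> - l" by (intro far) (auto simp: dense_def)
      hence "exp (log_ratio e \<theta>) * prior_density p g a0 b0 \<theta> \<le> exp (- l) * prior_density p g a0 b0 \<theta>"
        using nn by (intro mult_right_mono) auto
      thus ?thesis using True nn by (simp add: ennreal_mult[symmetric] ennreal_leI)
    next
      case False
      thus ?thesis
        by (cases "0 < snd \<theta>") (auto simp: prior_density_eq_0 add_increasing2 split: split_indicator)
    qed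
  qed
  also have "\<dots> = num g a0 b0 e (dense a m) + ennreal (exp (- l)) * (\<integral>\<^sup>+\<theta>. ennreal (prior_density p g a0 b0 \<theta>) \<partial>param_base p)"
    unfolding num_def by (subst nn_integral_add) (measurable, simp add: nn_integral_cmult)
  also have "\<dots> \<le> ennreal x + ennreal (exp (- l)) * ennreal CI"
    by (intro add_mono dense mult_left_mono prior_total_mass[OF g a0 CI]) simp
  also have "\<dots> = ennreal (x + exp (- l) * CI)"
    using dense CI by (simp add: ennreal_mult[symmetric])
  finally show ?thesis .
qed

text \<open>The response is the image of the noise under \<open>resp\<close>, so the bad responses
  pull back into the complement of \<open>G\<close>. If their set is not measurable, its
  \<open>measure\<close> is 0.\<close>

lemma response_law_tail:
  fixes F :: "(nat \<Rightarrow> real) \<Rightarrow> real"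
  assumes G: "G \<in> sets (std_gaussian n)" "measure (std_gaussian n) (space (std_gaussian n) - G) \<le> \<eta>"
    and small: "\<And>e. e \<in> G \<Longrightarrow> F (resp e) < t"
  shows "measure (response_law X \<beta>s \<sigma>s) {y \<in> space (response_law X \<beta>s \<sigma>s). t \<le> F y} \<le> \<eta>"
proof -
  interpret N: prob_space "std_gaussian n" by (rule prob_space_std_gaussian)
  have dim: "dim_row X = n" using X by simp
  have meas: "resp \<in> measurable (std_gaussian n) (\<Pi>\<^sub>M i\<in>{..<n}. borel)"
    unfolding resp_def using measurable_gaussian_coord
    by (intro measurable_restrict borel_measurable_add borel_measurable_times) auto
  have law: "response_law X \<beta>s \<sigma>s = distr (std_gaussian n) (\<Pi>\<^sub>M i\<in>{..<n}. borel) resp"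
    unfolding response_law_def dim resp_def[abs_def] ..
  define A where "A = {y \<in> space (response_law X \<beta>s \<sigma>s). t \<le> F y}"
  have \<eta>: "0 \<le> \<eta>" using G(2) measure_nonneg order_trans by blast
  show ?thesis
  proof (cases "A \<in> sets (response_law X \<beta>s \<sigma>s)")
    case True
    hence A: "A \<in> sets (\<Pi>\<^sub>M i\<in>{..<n}. borel)" by (simp add: law)
    have "measure (response_law X \<beta>s \<sigma>s) A = measure (std_gaussian n) (resp -` A \<inter> space (std_gaussian n))"
      unfolding law by (rule measure_distr[OF meas A])
    also have "\<dots> \<le> measure (std_gaussian n) (space (std_gaussian n) - G)"
      using small G(1) by (intro N.finite_measure_mono) (auto simp: A_def dest!: small)
    finally show ?thesis using G(2) by (simp add: A_def)
  next
    case False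
    thus ?thesis using \<eta> by (simp add: A_def measure_notin_sets)
  qed
qed

end

text \<open>The finite-sample form of the result: all asymptotic conditions appear as explicit
  inequalities. \<open>Q\<close> ranges over the l2 and the l1 event because the argument differs
  only in how distance yields signal on \<xi>.\<close>

lemma (in gaussian_design) posterior_tail:
  fixes K s :: nat and a L Ca H CI cI lam u \<gamma> E :: real
  assumes g: "prob_density g" and a0: "0 < a0"
    and CI: "(\<integral>\<^sup>+v. ennreal (inverse_gamma_density a0 b0 v) \<partial>lborel) \<le> ennreal CI" "0 \<le> CI"
    and ig: "\<And>v. \<sigma>s\<^sup>2 \<le> v \<Longrightarrow> v \<le> 2 * \<sigma>s\<^sup>2 \<Longrightarrow> cI \<le> inverse_gamma_density a0 b0 v" "0 < cI"
    and u: "0 < u" and p: "1 \<le> ln (real p)"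
    and s: "s = card (supp p \<beta>s)" "1 \<le> s"
    and L: "L = real s * ln (real p)"
    and \<gamma>: "\<And>x. \<bar>x\<bar> \<le> E \<Longrightarrow> \<gamma> \<le> g x" "0 < \<gamma>"
    and bs: "\<And>j. j < p \<Longrightarrow> \<bar>\<beta>s j\<bar> / \<sigma>s + 1 / real n \<le> E"
    and tail: "1 - (LBINT x:{- a..a}. g x) \<le> real p powr (- (1 + u))" "real p powr (- u) \<le> 1 / 2"
    and a: "0 \<le> a" "real p * a \<le> Ca * sqrt (L / real n)"
    and re: "\<And>\<xi>. \<xi> \<subseteq> {..<p} \<Longrightarrow> \<xi> \<noteq> {} \<Longrightarrow> card \<xi> \<le> (K + 1) * s \<Longrightarrow>
        real n * lam \<le> lambda_min (gram (cols_submatrix X \<xi>))"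
    and nonneg: "0 \<le> Ca" "0 \<le> lam" "0 \<le> H"
    and C1: "C1 = 1 / 2 + 4 * (1 + 2 * Ca) + (1 + 2 * Ca)\<^sup>2 / 2 + Cm" "0 \<le> Cm"
    and mass: "exp (- Cm * L) \<le> cI * (L / real n) * \<sigma>s\<^sup>2 * ((1 / real n * \<gamma>) ^ s * (1 / 2))"
    and K: "C1 + 3 \<le> u * real K"
    and c2: "c2 = 8 * (real K + 1) + 4"
    and c: "c = 4 * c2 + 4 * Ca + 4 * Ca\<^sup>2"
    and small: "400 * L \<le> real n" "20 * c * L \<le> real n" "8 * (C1 + 2) * L \<le> real n"
    and H: "c + 8 + 2 * c\<^sup>2 + (C1 + 2) \<le> lam * H / 16"
    and R: "R = 2 * Ca + (real K + 1) * (H + 1)"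
    and big: "5 + exp 1 * CI \<le> exp (L / 8)" "1 + CI < exp L"
    and Q: "Q = (\<lambda>\<beta>. R * \<sigma>s * sqrt (L / real n) \<le> l2_norm p (\<lambda>j. \<beta> j - \<beta>s j)) \<or>
      Q = (\<lambda>\<beta>. R * sqrt (real s) * sqrt (L / real n) * \<sigma>s \<le> l1_norm p (\<lambda>j. \<beta> j - \<beta>s j))"
  shows "measure (response_law X \<beta>s \<sigma>s)
    {y \<in> space (response_law X \<beta>s \<sigma>s). exp (- L) \<le> posterior_prob g a0 b0 X y Q} \<le> exp (- L / 8)"
proof -
  interpret N: prob_space "std_gaussian n" by (rule prob_space_std_gaussian)
  have n0: "0 < real n" using n by simp
  have p0: "0 < p" using p by (cases p) auto
  have s1: "1 \<le> real s" using s by simp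
  have p2: "2 \<le> real p"
  proof (rule ccontr)
    assume "\<not> ?thesis"
    hence "p < 2" by simp
    hence "p = 1" using p0 by simp
    thus False using p by simp
  qed
  have Ls: "real s \<le> L" using mult_left_mono[OF p, of "real s"] by (simp add: L)
  have L0: "0 < L" "1 \<le> L" using Ls s1 by auto
  have lnpL: "ln (real p) \<le> L" using mult_right_mono[OF s1, of "ln (real p)"] p by (simp add: L)
  have Ln: "L \<le> real n" using small L0 by linarith
  have sn: "real s / real n \<le> sqrt (L / real n)"
  proof (rule real_le_rsqrt)
    have "real s * real s \<le> L * real n" using Ls Ln s1 by (intro mult_mono) auto
    thus "(real s / real n)\<^sup>2 \<le> L / real n"
      using n0 by (simp add: power2_eq_square field_simps)
  qed
  define \<tau> where "\<tau> = real p powr (- (1 + u))"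
  have \<tau>: "0 \<le> \<tau>" "real p * \<tau> \<le> 1 / 2"
  proof -
    have "real p * \<tau> = real p powr (1 + - (1 + u))"
      unfolding \<tau>_def powr_add using p0 by simp
    thus "real p * \<tau> \<le> 1 / 2" using tail by simp
  qed (simp add: \<tau>_def)
  have \<tau>1: "\<tau> \<le> 1" using \<tau> p2 mult_right_mono[of 2 "real p" \<tau>] by linarith
  \<comment> \<open>The normalising constant is at least \<open>exp (- C1 * L)\<close>, so a
    numerator of order \<open>exp (- D * L)\<close> leaves \<open>exp (- 2 * L)\<close>; one factor
    \<open>exp (- L)\<close> then pays for the constant \<open>1 + CI\<close>.\<close>
  define D where "D = C1 + 2"
  define k where "k = (K + 1) * s"
  define m where "m = K * s"

  let ?x = "\<lambda>j i. X $$ (i, j)"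
  \<comment> \<open>Single columns, at a level not depending on \<open>K\<close>. The level 16 and
    columns of squared norm at most \<open>n\<close> give the correlation bound
    \<open>4 * sqrt (L * n)\<close>.\<close>
  obtain G1 where G1: "G1 \<in> sets (std_gaussian n)"
    "measure (std_gaussian n) (space (std_gaussian n) - G1) \<le> (2 * real p) ^ 1 * exp (- (16 * L) / 4)"
    "\<forall>e\<in>G1. projection_bounded n p ?x 1 (16 * L) e"
    using uniform_projection_event[OF p0, of n 1 "16 * L" ?x] by blast
  \<comment> \<open>The union bound costs at most
    \<open>p ^ (2 * k) = exp (2 * (K + 1) * L)\<close>; the choice of \<open>c2\<close> cancels it
    and leaves \<open>exp (- L)\<close>.\<close>
  obtain G2 where G2: "G2 \<in> sets (std_gaussian n)"
    "measure (std_gaussian n) (space (std_gaussian n) - G2) \<le> (2 * real p) ^ k * exp (- (c2 * L) / 4)"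
    "\<forall>e\<in>G2. projection_bounded n p ?x k (c2 * L) e"
    using uniform_projection_event[OF p0, of n k "c2 * L" ?x] by blast
  obtain G3 where G3: "G3 \<in> sets (std_gaussian n)"
    "measure (std_gaussian n) (space (std_gaussian n) - G3) \<le> 2 * exp (- L / 4)"
    "\<And>e. e \<in> G3 \<Longrightarrow> \<bar>ip n e e - real n\<bar> \<le> 2 * sqrt (real n * L)"
    using chi_square_event[OF L0(1) Ln] by blast
  define x where "x = exp (- D * L)"
  have dense_set: "dense a m \<inter> space (param_base p) \<in> sets (param_base p)"
    using dense_indicator_measurable[of a m] by (rule borel_measurable_indicator_iff[THEN iffD1])
  \<comment> \<open>\<open>dense a m\<close> also contains functions that are not extensional, so
    only its part inside the space is a measurable set. The integrals do not see the
    difference.\<close>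
  define A where "A = dense a m \<inter> space (param_base p)"
  have num_A: "num g a0 b0 e A = num g a0 b0 e (dense a m)" for e
    unfolding num_def A_def by (intro nn_integral_cong) (simp split: split_indicator)
  have "(\<integral>\<^sup>+\<theta>. indicator A \<theta> * ennreal (prior_density p g a0 b0 \<theta>) \<partial>param_base p) =
      (\<integral>\<^sup>+\<theta>. indicator (dense a m) \<theta> * ennreal (prior_density p g a0 b0 \<theta>) \<partial>param_base p)"
    unfolding A_def by (intro nn_integral_cong) (simp split: split_indicator)
  also have "\<dots> \<le> ennreal (CI * (exp 1 * real p powr (- u * real m)))"
    unfolding dense_def
    using prior_mass_many_large[OF g a0 CI p0 u density_interval_mass(1)[OF g tail(1)]] by simp
  finally have Amass: "(\<integral>\<^sup>+\<theta>. indicator A \<theta> * ennreal (prior_density p g a0 b0 \<theta>) \<partial>param_base p)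
      \<le> ennreal (CI * (exp 1 * real p powr (- u * real m)))" .
  have "\<exists>G\<in>sets (std_gaussian n).
      measure (std_gaussian n) (space (std_gaussian n) - G) \<le> CI * (exp 1 * real p powr (- u * real m)) / x \<and>
      (\<forall>e\<in>G. num g a0 b0 e A \<le> ennreal x)"
    using CI by (intro num_tail[OF g a0 _ Amass]) (use dense_set in \<open>auto simp: A_def x_def\<close>)
  then obtain G4 where G4: "G4 \<in> sets (std_gaussian n)"
    "measure (std_gaussian n) (space (std_gaussian n) - G4) \<le> CI * (exp 1 * real p powr (- u * real m)) / x"
    "\<And>e. e \<in> G4 \<Longrightarrow> num g a0 b0 e (dense a m) \<le> ennreal x"
    unfolding num_A by blast

  define G where "G = G1 \<inter> G2 \<inter> G3 \<inter> G4"
  have exp_p: "real p = exp (ln (real p))" using p0 by simp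
  have p_pow: "real p ^ i = exp (real i * ln (real p))" for i
    using p0 by (simp add: exp_of_nat_mult)
  have G: "G \<in> sets (std_gaussian n)" using G1(1) G2(1) G3(1) G4(1) by (simp add: G_def)
  have "measure (std_gaussian n) (space (std_gaussian n) - G) \<le> exp (- L / 8)"
  proof -
    let ?c = "\<lambda>G. space (std_gaussian n) - G"
    have 1: "measure (std_gaussian n) (?c G1) \<le> 2 * exp (- L / 4)"
    proof -
      have "(2 * real p) ^ 1 * exp (- (16 * L) / 4) = 2 * exp (ln (real p) - 4 * L)"
        using p0 by (simp add: exp_diff exp_minus field_simps)
      also have "\<dots> \<le> 2 * exp (- L / 4)" using lnpL L0 by simp
      finally show ?thesis using G1(2) by linarith
    qed
    have 2: "measure (std_gaussian n) (?c G2) \<le> exp (- L / 4)"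
    proof -
      have "(2 * real p) ^ k \<le> (real p * real p) ^ k"
        using p2 by (intro power_mono mult_right_mono) auto
      also have "\<dots> = exp (2 * (real k * ln (real p)))"
        by (simp add: power_mult_distrib p_pow exp_add[symmetric])
      also have "real k * ln (real p) = (real K + 1) * L" by (simp add: k_def L algebra_simps)
      finally have "(2 * real p) ^ k * exp (- (c2 * L) / 4) \<le>
          exp (2 * ((real K + 1) * L)) * exp (- (c2 * L) / 4)"
        by (rule mult_right_mono) simp
      also have "\<dots> = exp (- L)"
      proof -
        have "2 * ((real K + 1) * L) + - (c2 * L) / 4 = - L" by (simp add: c2 field_simps)
        thus ?thesis by (simp only: exp_add[symmetric])
      qed
      also have "\<dots> \<le> exp (- L / 4)" using L0 by simp
      finally show ?thesis using G2(2) by linarith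
    qed
    have 4: "measure (std_gaussian n) (?c G4) \<le> exp 1 * CI * exp (- L / 4)"
    proof -
      have "real p powr (- u * real m) = exp (- (u * real K * L))"
        using p0 by (simp add: powr_def m_def L algebra_simps)
      also have "\<dots> \<le> exp (- ((D + 1) * L))"
        \<comment> \<open>The choice of \<open>K\<close> makes the prior mass of dense vectors
          smaller than the Markov threshold \<open>x\<close> by a further factor
          \<open>exp (- L)\<close>.\<close>
        using K L0 by (simp add: D_def mult_right_mono)
      finally have "real p powr (- u * real m) / x \<le> exp (- ((D + 1) * L)) / x"
        by (rule divide_right_mono) (simp add: x_def)
      also have "\<dots> = exp (- L)" by (simp add: x_def exp_diff[symmetric] algebra_simps)
      also have "\<dots> \<le> exp (- L / 4)" using L0 by simp
      finally have "CI * exp 1 * (real p powr (- u * real m) / x) \<le> CI * exp 1 * exp (- L / 4)"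
        using CI by (intro mult_left_mono) auto
      thus ?thesis using G4(2) by (simp add: mult_ac)
    qed
    have "?c G = (?c G1 \<union> ?c G2) \<union> (?c G3 \<union> ?c G4)" by (auto simp: G_def)
    also have "measure (std_gaussian n) \<dots> \<le>
        measure (std_gaussian n) (?c G1 \<union> ?c G2) + measure (std_gaussian n) (?c G3 \<union> ?c G4)"
      using G1(1) G2(1) G3(1) G4(1) by (intro measure_Un_le) auto
    also have "\<dots> \<le> (measure (std_gaussian n) (?c G1) + measure (std_gaussian n) (?c G2)) +
        (measure (std_gaussian n) (?c G3) + measure (std_gaussian n) (?c G4))"
      using G1(1) G2(1) G3(1) G4(1) by (intro add_mono measure_Un_le) auto
    \<comment> \<open>The events contribute 2, 1, 2 and \<open>exp 1 * CI\<close> in turn.\<close>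
    also have "\<dots> \<le> (5 + exp 1 * CI) * exp (- L / 4)"
      using 1 2 G3(2) 4 by (simp add: algebra_simps)
    also have "\<dots> \<le> exp (L / 8) * exp (- L / 4)" using big by (intro mult_right_mono) auto
    also have "\<dots> = exp (- L / 8)" by (simp add: exp_add[symmetric])
    finally show ?thesis .
  qed
  moreover have "posterior_prob g a0 b0 X (resp e) Q < exp (- L)" if e: "e \<in> G" for e
  proof -
    have eG: "e \<in> G1" "e \<in> G2" "e \<in> G3" "e \<in> G4" using e by (auto simp: G_def)
    have T: "\<bar>ip n e (\<lambda>i. X $$ (i, j))\<bar> \<le> 4 * sqrt (L * real n)" if j: "j < p" for j
    proof -
      have "(ip n e (\<lambda>i. X $$ (i, j)))\<^sup>2 \<le> 16 * L * ip n (\<lambda>i. X $$ (i, j)) (\<lambda>i. X $$ (i, j))"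
        using projection_boundedD[OF G1(3)[rule_format, OF eG(1)], of "{j}" "\<lambda>_. 1"] j by simp
      also have "\<dots> \<le> 16 * L * real n"
        using partial_fit_norm[of "{j}" "\<lambda>_. 1"] j L0 by simp
      finally have "sqrt ((ip n e (\<lambda>i. X $$ (i, j)))\<^sup>2) \<le> sqrt (16 * (L * real n))"
        by (intro real_sqrt_le_mono) simp
      thus ?thesis by (simp add: real_sqrt_mult)
    qed
    have CD: "0 \<le> D" using C1 nonneg by (simp add: D_def)
    have far: "log_ratio e (\<beta>, v) \<le> - D * L"
      if v: "0 < v" and Qb: "Q \<beta>" and sp: "card {j. j < p \<and> a * sqrt v < \<bar>\<beta> j\<bar>} \<le> m" for \<beta> v
    proof (rule sparse_far_log_ratio[where a = a and m = m and L = L and k = k and ?C0.0 = 4 and Ca = Ca and lam = lam and H = H and ?c2.0 = c2 and c = c])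
      show "supp p \<beta>s \<noteq> {}" using s by auto
      show "card (supp p \<beta>s) + m \<le> k" by (simp add: k_def m_def s(1)[symmetric])
      show "c = 4 * c2 + 4 * Ca + 4 * Ca\<^sup>2" by (rule c)
      show "8 * D * L \<le> real n" using small by (simp add: D_def)
      show "c + 8 + 2 * c\<^sup>2 + D \<le> lam * H / 16" using H by (simp add: D_def)
      show "0 \<le> c2" by (simp add: c2)
    next
      fix \<xi> assume \<xi>: "\<xi> \<subseteq> {..<p}" "card \<xi> \<le> k"
        and out: "(\<Sum>j\<in>{..<p} - \<xi>. \<bar>dev \<beta> j\<bar>) \<le> 2 * Ca * sqrt (L / real n)"
      have q2: "(sqrt (L / real n))\<^sup>2 = L / real n" "0 \<le> sqrt (L / real n)" "0 \<le> L / real n"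
        using L0 n0 by auto
      \<comment> \<open>\<open>Y\<close> is large enough for both norms: the square of
        \<open>R\<close> minus \<open>4 * Ca\<^sup>2\<close> is at least \<open>Y\<close>, and
        \<open>Y\<^sup>2 / (K + 1) = Y * (H + 1)\<close>; both exceed \<open>H\<close>.\<close>
      define Y where "Y = (real K + 1) * (H + 1)"
      have RY: "R = 2 * Ca + Y" by (simp add: R Y_def)
      have Y: "H + 1 \<le> Y" unfolding Y_def using nonneg by (simp add: algebra_simps)
      have Y1: "1 \<le> Y" using Y nonneg by linarith
      show "H * (L / real n) \<le> (\<Sum>j\<in>\<xi>. (dev \<beta> j)\<^sup>2)"
        using Q
      proof
        assume Q2: "Q = (\<lambda>\<beta>. R * \<sigma>s * sqrt (L / real n) \<le> l2_norm p (\<lambda>j. \<beta> j - \<beta>s j))"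
        have "(R\<^sup>2 - 4 * Ca\<^sup>2) * (sqrt (L / real n))\<^sup>2 \<le> (\<Sum>j\<in>\<xi>. (dev \<beta> j)\<^sup>2)"
          using Qb Y1 nonneg q2 unfolding Q2 by (intro far_l2[OF \<xi>(1) _ out]) (auto simp: RY)
        moreover have "H \<le> R\<^sup>2 - 4 * Ca\<^sup>2"
        proof -
          have "Y * 1 \<le> Y * Y" "0 \<le> Ca * Y" using Y1 nonneg by (auto intro!: mult_left_mono)
          thus ?thesis using Y unfolding RY by (simp add: power2_eq_square algebra_simps)
        qed
        hence "H * (L / real n) \<le> (R\<^sup>2 - 4 * Ca\<^sup>2) * (L / real n)" using q2 by (intro mult_right_mono) auto
        ultimately show ?thesis by (simp only: q2)
      next
        assume Q1: "Q = (\<lambda>\<beta>. R * sqrt (real s) * sqrt (L / real n) * \<sigma>s \<le> l1_norm p (\<lambda>j. \<beta> j - \<beta>s j))"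
        have "real (card \<xi>) \<le> real ((K + 1) * s)" using \<xi>(2) unfolding k_def by (intro of_nat_mono)
        hence card: "real (card \<xi>) \<le> (real K + 1) * real s" by (simp add: algebra_simps)
        have "(R - 2 * Ca)\<^sup>2 / (real K + 1) * (sqrt (L / real n))\<^sup>2 \<le> (\<Sum>j\<in>\<xi>. (dev \<beta> j)\<^sup>2)"
          using Qb Y1 nonneg q2 s(2) unfolding Q1
          by (intro far_l1[OF \<xi>(1) card _ _ _ out]) (auto simp: RY)
        moreover have "H \<le> (R - 2 * Ca)\<^sup>2 / (real K + 1)"
        proof -
          have eq: "(R - 2 * Ca)\<^sup>2 / (real K + 1) = Y * (H + 1)"
            by (simp add: RY) (simp add: Y_def power2_eq_square)
          have "1 * (H + 1) \<le> Y * (H + 1)" using Y1 nonneg by (intro mult_right_mono) auto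
          thus ?thesis unfolding eq by (rule order_trans[rotated]) simp
        qed
        hence "H * (L / real n) \<le> (R - 2 * Ca)\<^sup>2 / (real K + 1) * (L / real n)" using q2 by (intro mult_right_mono) auto
        ultimately show ?thesis by (simp only: q2)
      qed
    qed (use v sp T projection_boundedD[OF G2(3)[rule_format, OF eG(2)]] re a nonneg L0 G3(3)[OF eG(3)] small in \<open>auto simp: k_def\<close>)
    have "num g a0 b0 e {\<theta>. Q (fst \<theta>)} \<le> ennreal (x + exp (- (D * L)) * CI)"
      using far by (intro num_upper[OF g a0 CI G4(3)[OF eG(4)]]) (auto simp: x_def)
    hence up: "num g a0 b0 e {\<theta>. Q (fst \<theta>)} \<le> ennreal ((1 + CI) * exp (- (D * L)))"
      by (simp add: x_def algebra_simps)
    define ms where "ms = cI * (L / real n) * \<sigma>s\<^sup>2 * ((1 / real n * \<gamma>) ^ card (supp p \<beta>s) * (1 - \<tau>) ^ p)"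
    \<comment> \<open>\<open>C1 - Cm\<close> accounts for the likelihood ratio on the neighbourhood;
      \<open>Cm\<close> is the exponent of its prior mass.\<close>
    have "ennreal (exp (- (C1 - Cm) * L) * ms) \<le> num g a0 b0 e UNIV"
      using C1 nonneg a L0 Ln sn \<tau>1 \<tau>(1) tail(1)
      by (intro num_UNIV_lower[OF g a0 ig _ _ \<gamma> bs _ _ _ T _ _ _ _ _ _ ms_def])
         (auto simp: \<tau>_def s(1)[symmetric])
    moreover have "exp (- C1 * L) \<le> exp (- (C1 - Cm) * L) * ms"
    proof -
      \<comment> \<open>Bernoulli: as \<open>p * \<tau>\<close> is at most 1/2, all the zero
        coordinates together cost only a factor 2.\<close>
      have "1 / 2 \<le> 1 + real p * (- \<tau>)" using \<tau> by simp
      also have "\<dots> \<le> (1 + (- \<tau>)) ^ p" using \<tau>1 by (intro Bernoulli_inequality) simp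
      finally have "1 / 2 \<le> (1 - \<tau>) ^ p" by simp
      hence "cI * (L / real n) * \<sigma>s\<^sup>2 * ((1 / real n * \<gamma>) ^ s * (1 / 2)) \<le> ms"
        unfolding ms_def s(1)[symmetric] using ig \<gamma> L0 n0 by (intro mult_left_mono) auto
      with mass have "exp (- Cm * L) \<le> ms" by linarith
      hence "exp (- (C1 - Cm) * L) * exp (- Cm * L) \<le> exp (- (C1 - Cm) * L) * ms"
        by (intro mult_left_mono) auto
      thus ?thesis by (simp add: exp_add[symmetric] algebra_simps)
    qed
    ultimately have low: "ennreal (exp (- C1 * L)) \<le> num g a0 b0 e UNIV"
      using ennreal_leI order_trans by blast
    have "posterior_prob g a0 b0 X (resp e) Q \<le> (1 + CI) * exp (- (D * L)) / exp (- C1 * L)"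
      using CI by (intro posterior_prob_le[OF g a0 up _ low]) auto
    also have "\<dots> = (1 + CI) * exp (- (2 * L))"
    proof -
      have "exp (- (D * L)) / exp (- C1 * L) = exp (- (2 * L))"
        by (simp add: exp_diff[symmetric] D_def algebra_simps)
      thus ?thesis by (simp only: times_divide_eq_right[symmetric])
    qed
    also have "\<dots> < exp L * exp (- (2 * L))" using big by (intro mult_strict_right_mono) auto
    also have "\<dots> = exp (- L)" by (simp add: exp_add[symmetric])
    finally show ?thesis .
  qed
  ultimately show ?thesis using G by (intro response_law_tail[of G]) auto
qed

section \<open>Asymptotics\<close>

lemma preceq_imp_bigo:
  assumes "preceq a b"
  obtains C where "0 < C" "\<forall>\<^sub>F n in sequentially. a n \<le> C * b n"
proof -
  have "\<exists>C>0. \<forall>\<^sub>F n in sequentially. 0 < b n \<and> a n / b n < C"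
  proof (cases "prec a b")
    case True
    hence "(\<lambda>n. a n / b n) \<longlonglongrightarrow> 0" "ev_positive b" by (auto simp: prec_def)
    from order_tendstoD(2)[OF this(1), of 1] this(2) show ?thesis
      by (intro exI[of _ 1]) (auto simp: ev_positive_def elim: eventually_elim2)
  next
    case False
    hence b: "ev_positive b" and lim: "limsup (\<lambda>n. ereal (a n / b n)) < \<infinity>"
      using assms by (auto simp: preceq_def asymp_order_def)
    obtain C :: real where C: "limsup (\<lambda>n. ereal (a n / b n)) < ereal C"
      using ereal_dense2[OF lim] by blast
    have "\<forall>\<^sub>F n in sequentially. ereal (a n / b n) < ereal C"
      using Limsup_lessD[OF C] .
    hence "\<forall>\<^sub>F n in sequentially. 0 < b n \<and> a n / b n < max C 1"
      using b unfolding ev_positive_def by eventually_elim auto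
    thus ?thesis by (intro exI[of _ "max C 1"]) auto
  qed
  then obtain C where C: "0 < C" and ev: "\<forall>\<^sub>F n in sequentially. 0 < b n \<and> a n / b n < C" by blast
  from ev have "\<forall>\<^sub>F n in sequentially. a n \<le> C * b n"
    by (rule eventually_mono) (use C in \<open>auto simp: field_simps\<close>)
  with C show ?thesis by (rule that)
qed

lemma prec_eventually_le:
  assumes "prec a b" "0 < c"
  shows "\<forall>\<^sub>F n in sequentially. c * a n \<le> b n"
proof -
  have "(\<lambda>n. a n / b n) \<longlonglongrightarrow> 0" "ev_positive b" using assms by (auto simp: prec_def)
  hence "\<forall>\<^sub>F n in sequentially. a n / b n < 1 / c" "\<forall>\<^sub>F n in sequentially. 0 < b n"
    using order_tendstoD(2)[of "\<lambda>n. a n / b n" 0 sequentially "1 / c"] assms(2)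
    by (auto simp: ev_positive_def)
  thus ?thesis
  proof eventually_elim
    case (elim n)
    thus ?case using assms(2) by (simp add: field_simps)
  qed
qed

text \<open>Positivity of the infimum is a separate hypothesis because \<open>ln 0 = 0\<close>: a
  vanishing infimum, which should make the left side of the growth condition infinite, would
  otherwise satisfy it. Empty \<xi> is excluded from the eigenvalue condition since a matrix of
  dimension 0 has no eigenvalues.\<close>

theorem theorem2p1:
  fixes X :: "nat \<Rightarrow> real mat"
    and p :: "nat \<Rightarrow> nat"
    and \<beta>s :: "nat \<Rightarrow> nat \<Rightarrow> real"
    and \<sigma>s :: real
    and s :: "nat \<Rightarrow> nat"
    and pbar :: "nat \<Rightarrow> nat"
    and lam0 gam3 a0 b0 u :: real
    and E a :: "nat \<Rightarrow> real"
    and g :: "nat \<Rightarrow> real \<Rightarrow> real"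
  assumes X_dim: "\<forall>n\<ge>1. X n \<in> carrier_mat n (p n)"
    and \<sigma>s: "0 < \<sigma>s"
    and s_def: "\<forall>n. s n = card (supp (p n) (\<beta>s n))"
    and A1_1: "\<forall>n\<ge>1. \<forall>i<n. \<forall>j<p n. X n $$ (i, j) \<in> {-1..1}"
    and A1_2: "preceq (\<lambda>n. real n) (\<lambda>n. real (p n))"
    and A1_3: "0 < lam0"
      "prec (\<lambda>n. real (s n)) (\<lambda>n. real (pbar n))"
      "\<forall>n\<ge>1. \<forall>\<xi>\<subseteq>{..<p n}. \<xi> \<noteq> {} \<and> card \<xi> \<le> pbar n \<longrightarrow>
         real n * lam0 \<le> lambda_min (gram (cols_submatrix (X n) \<xi>))"
    and A2_1: "prec (\<lambda>n. real (s n) * ln (real (p n))) (\<lambda>n. real n)"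
    and A2_2: "0 < gam3" "gam3 < 1" "\<forall>n\<ge>1. 0 < E n" "mono_on {1..} E"
      "\<forall>n\<ge>1. \<forall>j<p n. \<bar>\<beta>s n j / \<sigma>s\<bar> \<le> gam3 * E n"
    and IG: "0 < a0" "0 < b0"
    and g_density: "\<forall>n\<ge>1. prob_density (g n)"
    and u: "0 < u"
    and a_seq: "asymp_order a (\<lambda>n. sqrt (real (s n) * ln (real (p n)) / real n) / real (p n))"
    and g_concentration:
      "\<forall>n\<ge>1. 1 - (LBINT x:{- a n..a n}. g n x) \<le> real (p n) powr (- (1 + u))"
    and g_inf_pos: "\<forall>\<^sub>F n in sequentially. 0 < (INF x\<in>{- E n..E n}. g n x)"
    and g_inf: "(\<lambda>n. - ln (INF x\<in>{- E n..E n}. g n x)) \<in> O(\<lambda>n. ln (real (p n)))"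
  shows "\<exists>M0>0. \<forall>M\<ge>M0.
    (let \<epsilon> = (\<lambda>n. M * sqrt (real (s n) * ln (real (p n)) / real n)) in
     \<exists>c1>0. \<exists>c2>0. \<exists>c3>0. \<forall>\<^sub>F n in sequentially.
       (let P = response_law (X n) (\<beta>s n) \<sigma>s;
            \<pi> = (\<lambda>y. posterior_prob (g n) a0 b0 (X n) y) in
        measure P {y \<in> space P.
            \<pi> y (\<lambda>\<beta>. c1 * \<sigma>s * \<epsilon> n \<le> l2_norm (p n) (\<lambda>j. \<beta> j - \<beta>s n j))
              \<ge> exp (- c2 * real n * (\<epsilon> n)\<^sup>2)}
          \<le> exp (- c3 * real n * (\<epsilon> n)\<^sup>2) \<and>
        measure P {y \<in> space P.
            \<pi> y (\<lambda>\<beta>. c1 * sqrt (real (s n)) * \<epsilon> n * \<sigma>s \<le> l1_norm (p n) (\<lambda>j. \<beta> j - \<beta>s n j))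
              \<ge> exp (- c2 * real n * (\<epsilon> n)\<^sup>2)}
          \<le> exp (- c3 * real n * (\<epsilon> n)\<^sup>2)))"
proof -
  define L where "L n = real (s n) * ln (real (p n))" for n
  note L_fold = L_def[symmetric]
  obtain Ca where Ca: "0 < Ca" and ev_a: "\<forall>\<^sub>F n in sequentially. a n \<le> Ca * (sqrt (L n / real n) / real (p n))"
    using preceq_imp_bigo[of a] a_seq unfolding preceq_def L_fold by blast
  have ev_a0: "\<forall>\<^sub>F n in sequentially. 0 < a n"
    using a_seq by (simp add: asymp_order_def ev_positive_def)
  obtain Cp where Cp: "0 < Cp" and ev_p: "\<forall>\<^sub>F n in sequentially. real n \<le> Cp * real (p n)"
    using preceq_imp_bigo[OF A1_2] by blast
  obtain CI where CI: "0 < CI" "(\<integral>\<^sup>+v. ennreal (inverse_gamma_density a0 b0 v) \<partial>lborel) \<le> ennreal CI"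
    using inverse_gamma_total_mass_finite[OF IG] by blast
  obtain cI where cI: "0 < cI"
    and ig: "\<And>v. \<sigma>s\<^sup>2 \<le> v \<Longrightarrow> v \<le> 2 * \<sigma>s\<^sup>2 \<Longrightarrow> cI \<le> inverse_gamma_density a0 b0 v"
    by (rule inverse_gamma_density_lower[OF IG, of "\<sigma>s\<^sup>2"]) (use \<sigma>s in auto)
  obtain Cg where Cg: "0 < Cg"
    and ev_g: "\<forall>\<^sub>F n in sequentially. norm (- ln (INF x\<in>{- E n..E n}. g n x)) \<le> Cg * norm (ln (real (p n)))"
    using landau_o.bigE[OF g_inf] by blast
  \<comment> \<open>The exponent of the prior mass: 1 for the constant
    \<open>cI * \<sigma>s\<^sup>2 / 2\<close>, 2 for the variance window \<open>L / n\<close>, and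
    \<open>2 + Cg\<close> for the factor \<open>\<gamma> / n\<close> in each of the \<open>s\<close>
    support coordinates.\<close>
  define Cm where "Cm = 5 + Cg"
  define C1 where "C1 = 1 / 2 + 4 * (1 + 2 * Ca) + (1 + 2 * Ca)\<^sup>2 / 2 + Cm"
  define K where "K = nat \<lceil>(C1 + 3) / u\<rceil>"
  define c2 where "c2 = 8 * (real K + 1) + 4"
  define c where "c = 4 * c2 + 4 * Ca + 4 * Ca\<^sup>2"
  define H where "H = 16 * (c + 8 + 2 * c\<^sup>2 + (C1 + 2)) / lam0"
  define R where "R = 2 * Ca + (real K + 1) * (H + 1)"
  have C1: "0 < C1" using Ca Cg by (simp add: C1_def Cm_def add_pos_pos)
  have c2: "0 < c2" by (simp add: c2_def)
  have c: "0 < c" using Ca c2 by (simp add: c_def add_pos_pos)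
  have H: "0 \<le> H" using c C1 A1_3(1) by (simp add: H_def)
  have lamH: "c + 8 + 2 * c\<^sup>2 + (C1 + 2) \<le> lam0 * H / 16" using A1_3(1) by (simp add: H_def)
  have R: "0 < R" using Ca H by (simp add: R_def add_pos_nonneg)
  have uK: "C1 + 3 \<le> u * real K"
  proof -
    have "(C1 + 3) / u \<le> real K" unfolding K_def by (rule real_nat_ceiling_ge)
    thus ?thesis using u by (simp add: field_simps)
  qed
  have ev_n: "\<forall>\<^sub>F n in sequentially. B \<le> real n" for B
    using filterlim_real_sequentially by (simp add: filterlim_at_top)
  have ev_pB: "\<forall>\<^sub>F n in sequentially. B \<le> real (p n)" for B
    using ev_p ev_n[of "Cp * B"]
  proof eventually_elim
    case (elim n)
    hence "Cp * B \<le> Cp * real (p n)" by linarith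
    thus ?case using Cp by simp
  qed
  have ev_ln: "\<forall>\<^sub>F n in sequentially. B \<le> ln (real (p n))" for B
    using ev_pB[of "exp B"]
  proof eventually_elim
    case (elim n)
    moreover have "0 < exp B" by simp
    ultimately have "0 < real (p n)" by linarith
    thus ?case using elim by (simp add: ln_ge_iff)
  qed
  have ev_s: "\<forall>\<^sub>F n in sequentially. 0 < real (s n)"
    using A1_3(2) by (simp add: prec_def ev_positive_def)
  have ev_k: "\<forall>\<^sub>F n in sequentially. (real K + 1) * real (s n) \<le> real (pbar n)"
    by (rule prec_eventually_le[OF A1_3(2)]) simp
  have ev_small: "\<forall>\<^sub>F n in sequentially. C * L n \<le> real n" if "0 < C" for C
    using prec_eventually_le[OF A2_1 that] by (simp add: L_def)
  have sm1: "\<forall>\<^sub>F n in sequentially. 400 * L n \<le> real n" by (rule ev_small) simp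
  have sm2: "\<forall>\<^sub>F n in sequentially. 20 * c * L n \<le> real n" by (rule ev_small) (use c in simp)
  have sm3: "\<forall>\<^sub>F n in sequentially. 8 * (C1 + 2) * L n \<le> real n" by (rule ev_small) (use C1 in simp)
  have E1: "0 < (1 - gam3) * E 1" using A2_2 by simp

  \<comment> \<open>Lower bounds to be met by \<open>ln p\<close>; they pass to \<open>L\<close>,
    which is at least \<open>ln p\<close> once \<open>s\<close> is positive.\<close>
  define B where "B = max (max 1 (ln 2 / u)) (max (8 * ln (5 + exp 1 * CI)) (max (ln (2 + CI)) (- ln (cI * \<sigma>s\<^sup>2 / 2))))"
  have main: "\<forall>\<^sub>F n in sequentially. 1 \<le> n \<and> 0 \<le> L n \<and> (\<forall>Q.
      Q = (\<lambda>\<beta>. R * \<sigma>s * sqrt (L n / real n) \<le> l2_norm (p n) (\<lambda>j. \<beta> j - \<beta>s n j)) \<or>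
      Q = (\<lambda>\<beta>. R * sqrt (real (s n)) * sqrt (L n / real n) * \<sigma>s \<le> l1_norm (p n) (\<lambda>j. \<beta> j - \<beta>s n j)) \<longrightarrow>
      measure (response_law (X n) (\<beta>s n) \<sigma>s)
        {y \<in> space (response_law (X n) (\<beta>s n) \<sigma>s). exp (- L n) \<le> posterior_prob (g n) a0 b0 (X n) y Q} \<le> exp (- L n / 8))"
    using ev_a ev_a0 ev_p ev_g g_inf_pos eventually_ge_at_top[of 1] ev_n[of "1 / ((1 - gam3) * E 1)"]
      ev_pB[of "max Cp 1"] ev_ln[of B] ev_s ev_k sm1 sm2 sm3
  proof eventually_elim
    case (elim n)
    have n: "1 \<le> n" "0 < real n" using elim by auto
    interpret gaussian_design n "p n" "X n" "\<beta>s n" \<sigma>s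
      using X_dim A1_1 n \<sigma>s by unfold_locales (auto simp: abs_le_iff)
    have s1: "1 \<le> s n" using elim by simp
    have p1: "1 \<le> real (p n)" "Cp \<le> real (p n)" using elim by auto
    have lnB: "1 \<le> ln (real (p n))" "ln 2 / u \<le> ln (real (p n))" "8 * ln (5 + exp 1 * CI) \<le> ln (real (p n))"
      "ln (2 + CI) \<le> ln (real (p n))" "- ln (cI * \<sigma>s\<^sup>2 / 2) \<le> ln (real (p n))"
      using elim by (auto simp: B_def)
    have lnL: "ln (real (p n)) \<le> L n"
      using mult_right_mono[of 1 "real (s n)" "ln (real (p n))"] s1 lnB(1) by (simp add: L_def)
    have L1: "1 \<le> L n" using lnB(1) lnL by linarith
    \<comment> \<open>This is where \<open>p\<close> of order at least \<open>n\<close> enters: the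
      radius \<open>1 / n\<close> is at least \<open>p\<close> to the power -2.\<close>
    have n_le: "real n \<le> exp (2 * ln (real (p n)))"
    proof -
      have "real n \<le> Cp * real (p n)" using elim by simp
      also have "\<dots> \<le> real (p n) * real (p n)" using p1 by (intro mult_right_mono) auto
      also have "\<dots> = exp (2 * ln (real (p n)))"
        using p1 by (simp only: mult_2 exp_add exp_ln)
      finally show ?thesis .
    qed
    hence n_inv: "exp (- (2 * ln (real (p n)))) \<le> 1 / real n"
      using n le_imp_inverse_le[OF n_le] by (simp add: exp_minus inverse_eq_divide)
    define \<gamma> where "\<gamma> = exp (- (Cg * ln (real (p n))))"
    have \<gamma>: "\<gamma> \<le> g n x" if "\<bar>x\<bar> \<le> E n" for x
    proof -
      have nn: "\<forall>x. 0 \<le> g n x" using g_density n by (simp add: prob_density_def)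
      let ?I = "INF x\<in>{- E n..E n}. g n x"
      have pos: "0 < ?I" using elim by simp
      have "\<bar>ln ?I\<bar> \<le> Cg * ln (real (p n))" using elim lnB(1) by simp
      hence "- (Cg * ln (real (p n))) \<le> ln ?I" by linarith
      hence "\<gamma> \<le> ?I" using pos by (simp add: \<gamma>_def ln_ge_iff)
      also have "?I \<le> g n x"
        using that nn by (intro cINF_lower bdd_belowI2[of _ 0]) auto
      finally show ?thesis .
    qed
    \<comment> \<open>The gap between \<open>gam3 * E n\<close> and \<open>E n\<close> is at least
      \<open>(1 - gam3) * E 1\<close> by monotonicity, and so eventually has room for the radius
      \<open>1 / n\<close>.\<close>
    have bs: "\<bar>\<beta>s n j\<bar> / \<sigma>s + 1 / real n \<le> E n" if "j < p n" for j
    proof -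
      have "1 / ((1 - gam3) * E 1) \<le> real n" using elim by simp
      hence "1 / real n \<le> (1 - gam3) * E 1" using E1 n by (simp add: field_simps)
      also have "E 1 \<le> E n" using A2_2(4) n by (auto simp: mono_on_def)
      hence "(1 - gam3) * E 1 \<le> (1 - gam3) * E n" using A2_2(2) by (intro mult_left_mono) auto
      finally have "1 / real n \<le> (1 - gam3) * E n" .
      moreover have "\<bar>\<beta>s n j\<bar> / \<sigma>s \<le> gam3 * E n" using A2_2(5) n that \<sigma>s by (auto simp: abs_divide)
      ultimately show ?thesis by (simp add: algebra_simps)
    qed
    have pu: "real (p n) powr (- u) \<le> 1 / 2"
    proof -
      have "ln 2 \<le> u * ln (real (p n))" using lnB(2) u by (simp add: field_simps)
      hence "exp (- (u * ln (real (p n)))) \<le> exp (- ln 2)" by simp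
      also have "exp (- ln 2) = 1 / (2 :: real)" by (simp add: exp_minus)
      finally show ?thesis using p1 by (simp add: powr_def)
    qed
    have pa: "real (p n) * a n \<le> Ca * sqrt (L n / real n)"
      using elim(1) p1 by (simp add: field_simps)
    have re: "real n * lam0 \<le> lambda_min (gram (cols_submatrix (X n) \<xi>))"
      if "\<xi> \<subseteq> {..<p n}" "\<xi> \<noteq> {}" "card \<xi> \<le> (K + 1) * s n" for \<xi>
    proof -
      have "real (card \<xi>) \<le> real ((K + 1) * s n)" using that(3) by (rule of_nat_mono)
      also have "\<dots> = (real K + 1) * real (s n)" by (simp add: algebra_simps)
      also have "\<dots> \<le> real (pbar n)" using elim by simp
      finally have "card \<xi> \<le> pbar n" by simp
      thus ?thesis using A1_3(3) n that by auto
    qed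
    have mass: "exp (- Cm * L n) \<le> cI * (L n / real n) * \<sigma>s\<^sup>2 * ((1 / real n * \<gamma>) ^ s n * (1 / 2))"
    proof -
      have pos: "0 < cI * \<sigma>s\<^sup>2 / 2" using cI \<sigma>s by simp
      have "- L n \<le> ln (cI * \<sigma>s\<^sup>2 / 2)" using lnB(5) lnL by linarith
      hence 1: "exp (- L n) \<le> cI * \<sigma>s\<^sup>2 / 2" using pos by (simp add: ln_ge_iff)
      have "exp (- (2 * L n)) \<le> exp (- (2 * ln (real (p n))))" using lnL by simp
      also have "\<dots> \<le> 1 / real n" by (rule n_inv)
      also have "\<dots> \<le> L n / real n" using L1 n by (intro divide_right_mono) auto
      finally have 2: "exp (- (2 * L n)) \<le> L n / real n" .
      have "exp (- (2 * ln (real (p n)))) * \<gamma> \<le> 1 / real n * \<gamma>"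
        using n_inv by (intro mult_right_mono) (auto simp: \<gamma>_def)
      hence "(exp (- (2 * ln (real (p n)))) * \<gamma>) ^ s n \<le> (1 / real n * \<gamma>) ^ s n"
        by (intro power_mono) (auto simp: \<gamma>_def)
      moreover have "(exp (- (2 * ln (real (p n)))) * \<gamma>) ^ s n = exp (- ((2 + Cg) * L n))"
        unfolding \<gamma>_def exp_add[symmetric] exp_of_nat_mult[symmetric] by (simp add: L_def algebra_simps)
      ultimately have 3: "exp (- ((2 + Cg) * L n)) \<le> (1 / real n * \<gamma>) ^ s n" by simp
      have "exp (- L n) * exp (- (2 * L n)) * exp (- ((2 + Cg) * L n)) \<le>
          cI * \<sigma>s\<^sup>2 / 2 * (L n / real n) * (1 / real n * \<gamma>) ^ s n"
        using pos L1 n by (intro mult_mono 1 2 3) auto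
      moreover have "exp (- L n) * exp (- (2 * L n)) * exp (- ((2 + Cg) * L n)) = exp (- Cm * L n)"
        by (simp add: exp_add[symmetric] Cm_def algebra_simps)
      ultimately show ?thesis by (simp add: algebra_simps)
    qed
    have big: "5 + exp 1 * CI \<le> exp (L n / 8)" "1 + CI < exp (L n)"
    proof -
      have "0 < 5 + exp 1 * CI" using CI by (simp add: add_pos_pos)
      moreover have "ln (5 + exp 1 * CI) \<le> L n / 8" using lnB(3) lnL by simp
      ultimately show "5 + exp 1 * CI \<le> exp (L n / 8)" by (metis exp_le_cancel_iff exp_ln)
      have "0 < 2 + CI" using CI by simp
      moreover have "ln (2 + CI) \<le> L n" using lnB(4) lnL by simp
      ultimately have "2 + CI \<le> exp (L n)" by (metis exp_le_cancel_iff exp_ln)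
      thus "1 + CI < exp (L n)" by linarith
    qed
    have small: "400 * L n \<le> real n" "20 * c * L n \<le> real n" "8 * (C1 + 2) * L n \<le> real n"
      using elim c C1 by auto
    have tail: "1 - (LBINT x:{- a n..a n}. g n x) \<le> real (p n) powr (- (1 + u))"
      using g_concentration n by simp
    have gn: "prob_density (g n)" using g_density n by simp
    have sn: "s n = card (supp (p n) (\<beta>s n))" using s_def by simp
    have nonneg: "0 \<le> CI" "0 < \<gamma>" "0 \<le> a n" "0 \<le> Ca" "0 \<le> lam0" "0 \<le> Cm"
      using CI Ca A1_3(1) elim Cg by (auto simp: \<gamma>_def Cm_def)
    note tail_bound = posterior_tail[OF gn IG(1) CI(2) nonneg(1) ig cI u lnB(1) sn s1 L_def \<gamma> nonneg(2) bs
      tail pu nonneg(3) pa re nonneg(4,5) H C1_def nonneg(6) mass uK c2_def c_def small lamH R_def big]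
    show ?case using n(1) L1 tail_bound by auto
  qed
  show ?thesis
  \<comment> \<open>\<open>main\<close> is stated in terms of \<open>L\<close>, so \<open>M\<close>
    is only a rescaling: \<open>c1 = R / M\<close> undoes it in the radius, and
    \<open>c2 = 1 / M\<^sup>2\<close> and \<open>c3 = 1 / (8 * M\<^sup>2)\<close> undo it in the
    rates.\<close>
  proof (intro exI[of _ 1] conjI allI impI)
    fix M :: real assume M: "1 \<le> M"
    have scale: "R / M * \<sigma>s * (M * q) = R * \<sigma>s * q" "R / M * t * (M * q) * \<sigma>s = R * t * q * \<sigma>s" for q t
      using M by auto
    have "\<forall>\<^sub>F n in sequentially.
       (let P = response_law (X n) (\<beta>s n) \<sigma>s; \<pi> = (\<lambda>y. posterior_prob (g n) a0 b0 (X n) y) in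
        measure P {y \<in> space P. \<pi> y (\<lambda>\<beta>. R / M * \<sigma>s * (M * sqrt (L n / real n)) \<le> l2_norm (p n) (\<lambda>j. \<beta> j - \<beta>s n j))
              \<ge> exp (- (1 / M\<^sup>2) * real n * (M * sqrt (L n / real n))\<^sup>2)}
          \<le> exp (- (1 / (8 * M\<^sup>2)) * real n * (M * sqrt (L n / real n))\<^sup>2) \<and>
        measure P {y \<in> space P. \<pi> y (\<lambda>\<beta>. R / M * sqrt (real (s n)) * (M * sqrt (L n / real n)) * \<sigma>s \<le> l1_norm (p n) (\<lambda>j. \<beta> j - \<beta>s n j))
              \<ge> exp (- (1 / M\<^sup>2) * real n * (M * sqrt (L n / real n))\<^sup>2)}
          \<le> exp (- (1 / (8 * M\<^sup>2)) * real n * (M * sqrt (L n / real n))\<^sup>2))"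
      using main
    proof eventually_elim
      case (elim n)
      have "(M * sqrt (L n / real n))\<^sup>2 = M\<^sup>2 * (L n / real n)"
        using elim by (simp add: power_mult_distrib)
      hence rate: "- (1 / M\<^sup>2) * real n * (M * sqrt (L n / real n))\<^sup>2 = - L n"
        "- (1 / (8 * M\<^sup>2)) * real n * (M * sqrt (L n / real n))\<^sup>2 = - L n / 8"
        using elim M by auto
      show ?case unfolding Let_def rate scale using elim by blast
    qed
    thus "let \<epsilon> = (\<lambda>n. M * sqrt (real (s n) * ln (real (p n)) / real n)) in
     \<exists>c1>0. \<exists>c2>0. \<exists>c3>0. \<forall>\<^sub>F n in sequentially.
       (let P = response_law (X n) (\<beta>s n) \<sigma>s;
            \<pi> = (\<lambda>y. posterior_prob (g n) a0 b0 (X n) y) in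
        measure P {y \<in> space P.
            \<pi> y (\<lambda>\<beta>. c1 * \<sigma>s * \<epsilon> n \<le> l2_norm (p n) (\<lambda>j. \<beta> j - \<beta>s n j))
              \<ge> exp (- c2 * real n * (\<epsilon> n)\<^sup>2)}
          \<le> exp (- c3 * real n * (\<epsilon> n)\<^sup>2) \<and>
        measure P {y \<in> space P.
            \<pi> y (\<lambda>\<beta>. c1 * sqrt (real (s n)) * \<epsilon> n * \<sigma>s \<le> l1_norm (p n) (\<lambda>j. \<beta> j - \<beta>s n j))
              \<ge> exp (- c2 * real n * (\<epsilon> n)\<^sup>2)}
          \<le> exp (- c3 * real n * (\<epsilon> n)\<^sup>2))"
      unfolding Let_def L_def using R M
      by (intro exI[of _ "R / M"] exI[of _ "1 / M\<^sup>2"] exI[of _ "1 / (8 * M\<^sup>2)"] conjI) auto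
  qed simp
qed

end
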